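(* Fix a constant $\delta>0$. Let $N(\mathbf L)$ be the number of intercalates in a uniformly random order-$n$ Latin square $\mathbf L$. Then \[\Pr\left[N(\mathbf L)\ge(1+\delta)n^2/4\right]\le\exp\left(-\Omega_\delta(n^{4/3}\log n)\right),\] i.e., there is $c=c(\delta)>0$ such that for all sufficiently large $n$ the probability is at most $\exp(-cn^{4/3}\log n)$.
   Context: A Latin square of order $n$ is an $n\times n$ array filled with the symbols $1,\dots,n$ such that every symbol appears exactly once in each row and each column. An intercalate in a Latin square $L$ is a pair of rows $i<j$ and a pair of columns $x<y$ such that $L_{i,x}=L_{j,y}$ and $L_{i,y}=L_{j,x}$. *)

theory Defs
  imports "HOL-Probability.Probability"
begin

text \<open>
  An order-\<open>n\<close> array is a function on the cells \<open>{1..n} \<times> {1..n}\<close> that is extensional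
  (\<open>undefined\<close> off the cells), so that distinct functions are distinct arrays and the
  Latin squares of a given order form a finite set.
\<close>

definition latin_squares :: "nat \<Rightarrow> (nat \<times> nat \<Rightarrow> nat) set" where
  "latin_squares n =
    {L \<in> ({1..n} \<times> {1..n}) \<rightarrow>\<^sub>E {1..n}.
       (\<forall>s\<in>{1..n}. \<forall>i\<in>{1..n}. \<exists>!x. x \<in> {1..n} \<and> L (i, x) = s) \<and>
       (\<forall>s\<in>{1..n}. \<forall>x\<in>{1..n}. \<exists>!i. i \<in> {1..n} \<and> L (i, x) = s)}"

definition intercalates :: "nat \<Rightarrow> (nat \<times> nat \<Rightarrow> nat) \<Rightarrow> ((nat \<times> nat) \<times> (nat \<times> nat)) set" where
  "intercalates n L =
    {((i, j), (x, y)) | i j x y.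
       i \<in> {1..n} \<and> j \<in> {1..n} \<and> i < j \<and>
       x \<in> {1..n} \<and> y \<in> {1..n} \<and> x < y \<and>
       L (i, x) = L (j, y) \<and> L (i, y) = L (j, x)}"

definition num_intercalates :: "nat \<Rightarrow> (nat \<times> nat \<Rightarrow> nat) \<Rightarrow> nat" where
  "num_intercalates n L = card (intercalates n L)"

lemma finite_intercalates: "finite (intercalates n L)"
proof (rule finite_subset)
  show "intercalates n L \<subseteq> ({1..n} \<times> {1..n}) \<times> ({1..n} \<times> {1..n})"
    by (auto simp: intercalates_def)
qed simp

text \<open>
  The next two facts are what makes \<open>pmf_of_set (latin_squares n)\<close> the uniform distribution.
\<close>

lemma finite_latin_squares: "finite (latin_squares n)"
  by (rule finite_subset[of _ "({1..n} \<times> {1..n}) \<rightarrow>\<^sub>E {1..n}"])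
     (auto simp: latin_squares_def intro!: finite_PiE)

lemma latin_squares_nonempty: "latin_squares n \<noteq> {}"
proof -
  define f :: "nat \<Rightarrow> nat \<Rightarrow> nat" where "f i x = (i + x) mod n + 1" for i x
  have inj: "inj_on (f i) {1..n}" for i
  proof (rule inj_onI)
    fix x y assume xy: "x \<in> {1..n}" "y \<in> {1..n}" "f i x = f i y"
    then have eq: "(i + x) mod n = (i + y) mod n" by (simp add: f_def)
    have "x = y" if "x \<le> y" "y - x < n" "(i + x) mod n = (i + y) mod n" for x y
    proof -
      have "n dvd (i + y) - (i + x)"
        using that mod_eq_dvd_iff_nat[of "i + x" "i + y" n] by simp
      then show ?thesis using that by (metis add_diff_cancel_left diff_is_0_eq le_antisym nat_dvd_not_less neq0_conv)
    qed
    note le = this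
    have "y - x < n" "x - y < n" using xy by auto
    then show "x = y" using le[of x y] le[of y x] eq by (metis nat_le_linear)
  qed
  have maps: "f i x \<in> {1..n}" if "n > 0" for i x
    using that by (simp add: f_def Suc_le_eq)
  have ex1: "\<exists>!x. x \<in> {1..n} \<and> f i x = s" if s: "s \<in> {1..n}" for i s
  proof -
    have "f i ` {1..n} = {1..n}"
    proof (rule endo_inj_surj)
      show "f i ` {1..n} \<subseteq> {1..n}"
        using s by (intro image_subsetI maps) simp
    qed (simp_all only: inj finite_atLeastAtMost)
    then obtain x where x: "x \<in> {1..n}" "f i x = s" using s by (metis imageE)
    show ?thesis
    proof (rule ex1I[of _ x])
      fix y assume "y \<in> {1..n} \<and> f i y = s"
      then show "y = x" using x by (metis inj inj_onD)
    qed (use x in simp)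
  qed
  have comm: "f i x = f x i" for i x by (simp add: f_def add.commute)
  define L where "L = restrict (\<lambda>(i, x). f i x) ({1..n} \<times> {1..n})"
  have L: "L (i, x) = f i x" if "i \<in> {1..n}" "x \<in> {1..n}" for i x
    using that by (simp add: L_def)
  have "L \<in> ({1..n} \<times> {1..n}) \<rightarrow>\<^sub>E {1..n}"
    unfolding L_def restrict_PiE_iff
  proof (intro ballI)
    fix p assume "p \<in> {1..n} \<times> {1..n}"
    then obtain i x where "p = (i, x)" "i \<in> {1..n}" by (metis mem_Sigma_iff surj_pair)
    then show "(case p of (i, x) \<Rightarrow> f i x) \<in> {1..n}" using maps[of i x] by simp
  qed
  moreover have "\<exists>!x. x \<in> {1..n} \<and> L (i, x) = s" if "s \<in> {1..n}" "i \<in> {1..n}" for i s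
    using ex1[OF that(1), of i] L[OF that(2)] by (simp cong: conj_cong)
  moreover have "\<exists>!i. i \<in> {1..n} \<and> L (i, x) = s" if "s \<in> {1..n}" "x \<in> {1..n}" for x s
    using ex1[OF that(1), of x] L[OF _ that(2)] by (simp add: comm[of x] cong: conj_cong)
  ultimately have "L \<in> latin_squares n" by (simp add: latin_squares_def)
  then show ?thesis by blast
qed

end

(* The number of Latin squares containing a given set P of entries lying in at most eps n rows is
   at most ((1 + O(eps)) / n)^|P| times the number of all Latin squares, up to a factor exp(O(n log^2 n)),
   except that entries in rows with more than eps n prescribed entries only count as O(1 / n).
   To see this, expose the square row by row, starting with the rows that meet P. Each new row is a perfect
   matching of a regular bipartite graph, and Bregman's inequality bounds the number of extensions from
   above, while Gurvits' capacity method gives the matching lower bound (r / e)^n of van der Waerden type.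

   By averaging, a square with too many intercalates has a set S of about eps n rows that contains too
   many. Compute the l-th moment of the number of intercalates within S, with l about n^(4/3) log n, by
   choosing the intercalates one at a time: as long as the entries chosen so far contain few intercalates,
   one more step contributes at most (1 + delta/2) times the expected factor. Otherwise the square contains
   a seed, i.e. O(n^(4/3) log n) entries spanning at least beta n^2 intercalates. A seed contains a core,
   in which every entry lies in n^(2/3 - o(1)) of its intercalates. A core with s entries has
   s >= const n^(4/3) and meets only n^(2/3 + o(1)) rows, columns and symbols, so there are few cores and
   a union bound gives exp(-const n^(4/3) log n) for the existence of a seed. *)
theory Submission
  imports Defs "HOL-Computational_Algebra.Fundamental_Theorem_Algebra" "HOL-Real_Asymp.Real_Asymp"
begin

text \<open>The exponent 4/3 is that of an extremal problem: \<open>s\<close> entries of a Latin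
  square contain at most \<open>2 * s * sqrt s\<close> intercalates, so order \<open>n^2\<close> of
  them need order \<open>n powr (4/3)\<close> entries; a subsquare of order about
  \<open>n powr (2/3)\<close> that is the table of an elementary abelian 2-group has that many. Each
  prescribed entry costs about a factor \<open>n\<close>, whence \<open>ln n\<close>. All other
  losses (\<open>total_err\<close>, \<open>2 ^ n\<close> row sets, \<open>8 ^ n\<close> boxes) are
  exponential in \<open>n\<close> times a power of \<open>ln n\<close>, hence negligible.

  Working in about \<open>\<epsilon> * n\<close> rows is forced by the counting: an entry in a row
  exposed after \<open>j\<close> others gains only a factor \<open>n - j\<close>, so the right
  constant is available for early rows only. In \<open>k\<close> such rows about
  \<open>k^2 / 4\<close> intercalates are expected, and averaging preserves the relative excess.

  In the moment computation \<open>total_err\<close> is paid once, for the final set of entries, not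
  at each step. With \<open>m\<close> entries fixed, intercalates that reuse one to three of them,
  or meet a crowded row, add only \<open>O(m + m^2 / n)\<close>, well below \<open>n^2\<close> as
  long as \<open>m\<close> is well below \<open>n powr (3/2)\<close>. Intercalates already completed
  have no such bound: they are the reason for seeds.\<close>

section \<open>A lower bound for permanents by capacity\<close>

text \<open>The permanent by Laplace expansion along \<open>vs\<close>; if \<open>S\<close> is
  larger than \<open>vs\<close>, the sum runs over injections.\<close>

fun perm_sum :: "('v \<Rightarrow> 'a \<Rightarrow> real) \<Rightarrow> 'v list \<Rightarrow> 'a set \<Rightarrow> real" where
  "perm_sum a [] S = 1"
| "perm_sum a (v # vs) S = (\<Sum>i\<in>S. a v i * perm_sum a vs (S - {i}))"

text \<open>What remains of the product of the linear forms after differentiating once in each variable of \<open>vs\<close> and setting these variables to 0.\<close>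

definition residual ::
  "('v \<Rightarrow> 'a \<Rightarrow> real) \<Rightarrow> 'a set \<Rightarrow> 'v set \<Rightarrow> 'v list \<Rightarrow> ('v \<Rightarrow> complex) \<Rightarrow> complex" where
  "residual a I V vs z = (\<Sum>J | J \<subseteq> I \<and> card J = card V.
     of_real (perm_sum a vs (I - J)) * (\<Prod>i\<in>J. \<Sum>v\<in>V. of_real (a v i) * z v))"

text \<open>The residual with one more variable \<open>v\<close> left free, as a polynomial in that
  variable, so that its roots can be used.\<close>

definition residual_poly ::
  "('v \<Rightarrow> 'a \<Rightarrow> real) \<Rightarrow> 'a set \<Rightarrow> 'v set \<Rightarrow> 'v list \<Rightarrow> 'v \<Rightarrow> ('v \<Rightarrow> complex) \<Rightarrow> complex poly" where
  "residual_poly a I V vs v z = (\<Sum>J | J \<subseteq> I \<and> card J = Suc (card V).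
     smult (of_real (perm_sum a vs (I - J)))
       (\<Prod>i\<in>J. [:\<Sum>w\<in>V. of_real (a w i) * z w, of_real (a v i):]))"

text \<open>Stronger than stability on the open half-plane: all variables but one may lie on the
  boundary. This is what makes it admissible to set the differentiated variable to 0. For empty
  \<open>V\<close> the condition is vacuous.\<close>

definition half_plane_stable :: "'v set \<Rightarrow> (('v \<Rightarrow> complex) \<Rightarrow> complex) \<Rightarrow> bool" where
  "half_plane_stable V f \<longleftrightarrow>
    (\<forall>z. (\<forall>v\<in>V. 0 \<le> Re (z v)) \<and> (\<exists>v\<in>V. 0 < Re (z v)) \<longrightarrow> f z \<noteq> 0)"

text \<open>Gurvits' capacity, the infimum of \<open>f x\<close> over the product of the variables,
  written as a lower bound without an infimum. For empty \<open>V\<close> it bounds the constant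
  itself, which is how the permanent is read off in the end.\<close>

definition capacity_ge :: "real \<Rightarrow> 'v set \<Rightarrow> (('v \<Rightarrow> complex) \<Rightarrow> complex) \<Rightarrow> bool" where
  "capacity_ge \<alpha> V f \<longleftrightarrow>
    (\<forall>x. (\<forall>v\<in>V. 0 < x v) \<longrightarrow> \<alpha> * (\<Prod>v\<in>V. x v) \<le> norm (f (\<lambda>v. of_real (x v))))"

lemma pderiv_sum: "pderiv (sum f A) = (\<Sum>x\<in>A. pderiv (f x))"
  by (induction A rule: infinite_finite_induct) (auto simp: pderiv_add)

lemma perm_sum_pos:
  assumes "\<And>v i. 0 < a v i" "finite S" "length vs \<le> card S"
  shows "0 < perm_sum a vs S"
  using assms(2,3)
proof (induction vs arbitrary: S)
  case (Cons v vs)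
  then have "S \<noteq> {}" by auto
  then show ?case
    using Cons assms(1) by (auto intro!: sum_pos mult_pos_pos Cons.IH)
qed simp

lemma residual_cong:
  "(\<And>v. v \<in> V \<Longrightarrow> z v = z' v) \<Longrightarrow> residual a I V vs z = residual a I V vs z'"
  unfolding residual_def by (intro sum.cong prod.cong refl arg_cong2[where f="(*)"]) simp

lemma residual_scale:
  "residual a I V vs (\<lambda>v. c * z v) = c ^ card V * residual a I V vs z"
proof -
  have "(\<Prod>i\<in>J. \<Sum>v\<in>V. of_real (a v i) * (c * z v)) =
      c ^ card V * (\<Prod>i\<in>J. \<Sum>v\<in>V. of_real (a v i) * z v)" if "card J = card V" for J
  proof -
    have "(\<Sum>v\<in>V. of_real (a v i) * (c * z v)) = c * (\<Sum>v\<in>V. of_real (a v i) * z v)" for i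
      by (simp add: sum_distrib_left mult_ac)
    then show ?thesis by (simp add: prod.distrib that)
  qed
  then show ?thesis
    unfolding residual_def sum_distrib_left by (intro sum.cong refl) (simp add: mult_ac)
qed

lemma poly_residual_poly:
  assumes "finite V" "v \<notin> V"
  shows "poly (residual_poly a I V vs v z) t = residual a I (insert v V) vs (z(v := t))"
proof -
  have "(\<Sum>w\<in>insert v V. of_real (a w i) * (z(v := t)) w) =
      (\<Sum>w\<in>V. of_real (a w i) * z w) + t * of_real (a v i)" for i
  proof -
    have "(\<Sum>w\<in>V. of_real (a w i) * (z(v := t)) w) = (\<Sum>w\<in>V. of_real (a w i) * z w)"
      using assms by (intro sum.cong) auto
    then show ?thesis using assms by simp
  qed
  then show ?thesis
    using assms by (simp add: residual_def residual_poly_def poly_sum poly_prod del: sum.insert)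
qed

text \<open>Differentiating a product of forms over \<open>J\<close> at 0 drops one form
  \<open>i\<close> and leaves its coefficient \<open>a v i\<close>. Replacing the pair of
  \<open>J\<close> and \<open>i\<close> by \<open>J - {i}\<close> and \<open>i\<close> collects
  exactly the expansion of the permanent along \<open>v\<close>.\<close>

lemma poly_pderiv_residual_poly:
  assumes "finite I" "finite V"
  shows "poly (pderiv (residual_poly a I V vs v z)) 0 = residual a I V (v # vs) z"
proof -
  define l where "l i = (\<Sum>w\<in>V. of_real (a w i) * z w)" for i
  define D where "D = (SIGMA J:{J. J \<subseteq> I \<and> card J = Suc (card V)}. J)"
  define E where "E = (SIGMA J:{J. J \<subseteq> I \<and> card J = card V}. I - J)"
  have fJ: "finite J" if "J \<subseteq> I" for J using that assms finite_subset by blast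
  have fD: "finite {J. J \<subseteq> I \<and> card J = Suc (card V)}" "finite {J. J \<subseteq> I \<and> card J = card V}"
    using assms by auto
  have "poly (pderiv (residual_poly a I V vs v z)) 0 =
      (\<Sum>J | J \<subseteq> I \<and> card J = Suc (card V). \<Sum>i\<in>J.
        of_real (perm_sum a vs (I - J)) * (of_real (a v i) * (\<Prod>j\<in>J - {i}. l j)))"
    unfolding residual_poly_def pderiv_sum
    by (simp add: pderiv_smult pderiv_prod poly_sum poly_prod sum_distrib_left l_def pderiv_pCons mult.commute)
  also have "\<dots> = (\<Sum>(J, i)\<in>D.
        of_real (perm_sum a vs (I - J)) * (of_real (a v i) * (\<Prod>j\<in>J - {i}. l j)))"
    unfolding D_def using fD fJ by (subst sum.Sigma) auto
  also have "\<dots> = (\<Sum>(J, i)\<in>E.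
        of_real (perm_sum a vs (I - J - {i})) * (of_real (a v i) * (\<Prod>j\<in>J. l j)))"
    by (rule sum.reindex_bij_witness[where i="\<lambda>(J, i). (insert i J, i)" and j="\<lambda>(J, i). (J - {i}, i)"])
       (auto simp: D_def E_def insert_absorb fJ Diff_insert2[symmetric] Diff_insert[symmetric]
          intro!: arg_cong2[where f="(*)"] arg_cong[where f="perm_sum a vs"] prod.cong)
  also have "\<dots> = (\<Sum>J | J \<subseteq> I \<and> card J = card V. \<Sum>i\<in>I - J.
        of_real (perm_sum a vs (I - J - {i})) * (of_real (a v i) * (\<Prod>j\<in>J. l j)))"
    unfolding E_def using fD assms by (subst sum.Sigma) auto
  also have "\<dots> = residual a I V (v # vs) z"
    unfolding residual_def by (simp add: sum_distrib_left l_def mult_ac)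
  finally show ?thesis .
qed

lemma coeff_prod_linear:
  fixes l c :: "'a \<Rightarrow> complex"
  assumes "finite J"
  shows "degree (\<Prod>i\<in>J. [:l i, c i:]) \<le> card J \<and> coeff (\<Prod>i\<in>J. [:l i, c i:]) (card J) = (\<Prod>i\<in>J. c i)"
  using assms
proof (induction J)
  case (insert x J)
  let ?p = "\<Prod>i\<in>J. [:l i, c i:]"
  have "degree ([:l x, c x:] * ?p) \<le> Suc (card J)"
    using insert degree_mult_le[of "[:l x, c x:]" ?p] by (auto split: if_splits)
  moreover have "coeff ?p (Suc (card J)) = 0"
    using insert by (intro coeff_eq_0) auto
  ultimately show ?case using insert by (auto simp: mult_pCons_left)
qed simp

text \<open>The coefficient of degree \<open>Suc (card V)\<close> is a nonempty sum of positive
  numbers. Being nonconstant ensures at least one root, hence a nonzero logarithmic derivative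
  later.\<close>

lemma degree_residual_poly_pos:
  assumes "\<And>v i. 0 < a v i" "finite I" "card V + Suc (length vs) = card I"
  shows "0 < degree (residual_poly a I V vs v z)"
proof -
  let ?F = "{J. J \<subseteq> I \<and> card J = Suc (card V)}"
  have fJ: "finite J" if "J \<subseteq> I" for J using that assms finite_subset by blast
  have "coeff (residual_poly a I V vs v z) (Suc (card V)) =
      (\<Sum>J\<in>?F. of_real (perm_sum a vs (I - J) * (\<Prod>i\<in>J. a v i)))"
    unfolding residual_poly_def coeff_sum
  proof (intro sum.cong refl)
    fix J assume "J \<in> ?F"
    then show "coeff (smult (of_real (perm_sum a vs (I - J)))
       (\<Prod>i\<in>J. [:\<Sum>w\<in>V. of_real (a w i) * z w, of_real (a v i):])) (Suc (card V)) =
       of_real (perm_sum a vs (I - J) * (\<Prod>i\<in>J. a v i))"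
      using coeff_prod_linear[of J "\<lambda>i. \<Sum>w\<in>V. of_real (a w i) * z w" "\<lambda>i. of_real (a v i)"] fJ[of J]
      by simp
  qed
  also have "\<dots> = of_real (\<Sum>J\<in>?F. perm_sum a vs (I - J) * (\<Prod>i\<in>J. a v i))" by simp
  also have "\<dots> \<noteq> 0"
  proof -
    obtain J where "J \<subseteq> I" "card J = Suc (card V)"
      using assms(2,3) obtain_subset_with_card_n[of "Suc (card V)" I] by auto
    then have "?F \<noteq> {}" by auto
    then have "0 < (\<Sum>J\<in>?F. perm_sum a vs (I - J) * (\<Prod>i\<in>J. a v i))"
      using assms fJ by (intro sum_pos mult_pos_pos perm_sum_pos prod_pos)
        (auto simp: card_Diff_subset)
    then show ?thesis by (metis less_irrefl of_real_eq_0_iff)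
  qed
  finally show ?thesis
    by (metis Suc_neq_Zero coeff_eq_0 gr0I zero_less_Suc)
qed

abbreviation root_poly :: "complex multiset \<Rightarrow> complex poly" where
  "root_poly A \<equiv> \<Prod>x\<in>#A. [:- x, 1:]"

lemma root_multiset:
  fixes p :: "complex poly"
  assumes "0 < degree p"
  shows "\<exists>A. A \<noteq> {#} \<and> p = smult (lead_coeff p) (root_poly A) \<and> (\<forall>x\<in>#A. poly p x = 0)"
proof -
  have "p \<noteq> 0" using assms by (metis degree_0 less_irrefl)
  from alg_closed_imp_factorization[OF this]
  obtain A where A: "size A = degree p" "p = smult (lead_coeff p) (root_poly A)"
    by (elim exE conjE)
  have "poly p x = 0" if x: "x \<in># A" for x
  proof -
    obtain B where B: "A = add_mset x B" using multi_member_split[OF x] by blast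
    have "poly (smult c (root_poly A)) x = 0" for c unfolding B by simp
    then have "poly (smult (lead_coeff p) (root_poly A)) x = 0" .
    then show ?thesis by (subst A(2))
  qed
  moreover have "A \<noteq> {#}" using A(1) assms by (cases A) auto
  ultimately show ?thesis by (intro exI[of _ A] conjI ballI A(2))
qed

text \<open>The logarithmic derivative at 0 is the sum of the \<open>- inverse \<rho>\<close> over
  the roots, and inversion preserves the left half-plane. The multiplicative form avoids a
  division.\<close>

lemma pderiv_at_0_roots_left:
  assumes "\<And>z. z \<in># A \<Longrightarrow> Re z < 0"
  shows "\<exists>s. poly (pderiv (root_poly A)) 0 = poly (root_poly A) 0 * s \<and>
           (A \<noteq> {#} \<longrightarrow> 0 < Re s)"
  using assms
proof (induction A)
  case (add \<rho> A)
  then obtain s where s: "poly (pderiv (root_poly A)) 0 = poly (root_poly A) 0 * s"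
    "A \<noteq> {#} \<longrightarrow> 0 < Re s" by auto
  have \<rho>: "Re \<rho> < 0" "\<rho> \<noteq> 0" using add.prems[of \<rho>] by auto
  define s' where "s' = (if A = {#} then 0 else s)"
  have s': "poly (pderiv (root_poly A)) 0 = poly (root_poly A) 0 * s'" "0 \<le> Re s'"
    using s by (auto simp: s'_def)
  have "poly (pderiv (root_poly (add_mset \<rho> A))) 0 =
      poly (root_poly (add_mset \<rho> A)) 0 * (s' - inverse \<rho>)"
    using s'(1) \<rho>
    by (simp add: pderiv_mult pderiv_pCons field_simps del: mult_pCons_left mult_pCons_right)
  moreover have "Re (inverse \<rho>) < 0"
    using \<rho> by (auto simp: inverse_complex.sel complex_eq_iff intro!: divide_neg_pos add_pos_nonneg)
  ultimately show ?case using s'(2) by (intro exI[of _ "s' - inverse \<rho>"]) auto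
qed simp

text \<open>With roots \<open>- r\<close> the polynomial is its value at 0 times the product of the
  \<open>1 + t / r\<close>, which is at most \<open>exp (t * s)\<close> for \<open>s\<close> the sum
  of the \<open>1 / r\<close>, the logarithmic derivative at 0.\<close>

lemma pderiv_at_0_roots_neg_real:
  assumes "\<And>z. z \<in># A \<Longrightarrow> z \<in> \<real> \<and> Re z < 0"
  shows "\<exists>s\<ge>0. poly (pderiv (root_poly A)) 0 = poly (root_poly A) 0 * of_real s \<and>
           (\<forall>t\<ge>0. norm (poly (root_poly A) (of_real t)) \<le>
             norm (poly (root_poly A) 0) * exp (t * s))"
  using assms
proof (induction A)
  case (add \<rho> A)
  then obtain s where s: "0 \<le> s"
    "poly (pderiv (root_poly A)) 0 = poly (root_poly A) 0 * of_real s"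
    "\<And>t. 0 \<le> t \<Longrightarrow> norm (poly (root_poly A) (of_real t)) \<le>
             norm (poly (root_poly A) 0) * exp (t * s)" by auto
  obtain r where r: "\<rho> = of_real (- r)" "0 < r"
  proof
    show "\<rho> = of_real (- (- Re \<rho>))" using add.prems[of \<rho>] by auto
    show "0 < - Re \<rho>" using add.prems[of \<rho>] by auto
  qed
  have "poly (pderiv (root_poly (add_mset \<rho> A))) 0 =
      poly (root_poly (add_mset \<rho> A)) 0 * of_real (s + 1 / r)"
    using s(2) r by (simp add: pderiv_mult pderiv_pCons field_simps del: mult_pCons_left mult_pCons_right)
  moreover have "norm (poly (root_poly (add_mset \<rho> A)) (of_real t)) \<le>
      norm (poly (root_poly (add_mset \<rho> A)) 0) * exp (t * (s + 1 / r))" if "0 \<le> t" for t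
  proof -
    have "norm (of_real r + of_real t :: complex) = r * (1 + t / r)"
      using r that by (simp add: field_simps flip: of_real_add)
    also have "\<dots> \<le> r * exp (t / r)" using r by (intro mult_left_mono exp_ge_add_one_self) auto
    finally have "norm (of_real r + of_real t :: complex) \<le> r * exp (t / r)" .
    then have "norm (of_real r + of_real t :: complex) * norm (poly (root_poly A) (of_real t)) \<le>
       (r * exp (t / r)) * (norm (poly (root_poly A) 0) * exp (t * s))"
      using s(3)[OF that] r by (intro mult_mono) auto
    moreover have "poly (root_poly (add_mset \<rho> A)) u = (of_real r + u) * poly (root_poly A) u" for u
      using r by (simp add: algebra_simps)
    ultimately show ?thesis using r by (simp only: norm_mult) (simp add: exp_add algebra_simps)
  qed
  ultimately show ?case using s(1) r by (intro exI[of _ "s + 1 / r"]) auto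
qed (auto intro!: exI[of _ 0])

text \<open>Gurvits' inequality with the constant \<open>1 / e\<close>: the restriction \<open>R\<close> to the variable \<open>v\<close> has only negative real roots, so
  \<open>R t \<le> R 0 * exp (t * R' 0 / R 0)\<close>, which is used at \<open>t = R 0 / R' 0\<close>.\<close>

lemma residual_step:
  assumes a: "\<And>v i. 0 < a v i" and fin: "finite I" "finite V" "v \<notin> V"
    and card: "card V + Suc (length vs) = card I"
    and stable: "half_plane_stable (insert v V) (residual a I (insert v V) vs)"
  shows "half_plane_stable V (residual a I V (v # vs))"
    and "capacity_ge \<alpha> (insert v V) (residual a I (insert v V) vs) \<Longrightarrow> 0 \<le> \<alpha> \<Longrightarrow>
      capacity_ge (\<alpha> / exp 1) V (residual a I V (v # vs))"
proof -
  define R where "R = residual_poly a I V vs v"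
  have R: "poly (R z) t = residual a I (insert v V) vs (z(v := t))" for z t
    unfolding R_def by (rule poly_residual_poly[OF fin(2,3)])
  have R': "residual a I V (v # vs) z = poly (pderiv (R z)) 0" for z
    unfolding R_def using fin by (simp add: poly_pderiv_residual_poly)
  have deg: "0 < degree (R z)" for z
    unfolding R_def by (rule degree_residual_poly_pos[OF a fin(1) card])
  then have nz: "R z \<noteq> 0" for z by (metis degree_0 less_irrefl)
  have roots: "Re \<rho> < 0"
    if "\<forall>w\<in>V. 0 \<le> Re (z w)" "\<exists>w\<in>V. 0 < Re (z w)" "poly (R z) \<rho> = 0" for z \<rho>
  proof (rule ccontr)
    assume "\<not> Re \<rho> < 0"
    then have "residual a I (insert v V) vs (z(v := \<rho>)) \<noteq> 0"
      using stable that fin unfolding half_plane_stable_def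
      by (intro mp[OF spec[OF stable[unfolded half_plane_stable_def]]]) auto
    then show False using that R by simp
  qed
  have "\<forall>z. \<exists>A. A \<noteq> {#} \<and> R z = smult (lead_coeff (R z)) (root_poly A) \<and> (\<forall>x\<in>#A. poly (R z) x = 0)"
    using root_multiset[OF deg] by (intro allI)
  from choice[OF this] obtain A where "\<forall>z. A z \<noteq> {#} \<and> R z = smult (lead_coeff (R z)) (root_poly (A z)) \<and>
      (\<forall>x\<in>#A z. poly (R z) x = 0)" by (elim exE)
  then obtain A where A: "\<And>z. A z \<noteq> {#}"
    "\<And>z. R z = smult (lead_coeff (R z)) (root_poly (A z))"
    "\<And>z x. x \<in># A z \<Longrightarrow> poly (R z) x = 0"
    by blast
  show "half_plane_stable V (residual a I V (v # vs))"
    unfolding half_plane_stable_def R'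
  proof (intro allI impI)
    fix z assume z: "(\<forall>w\<in>V. 0 \<le> Re (z w)) \<and> (\<exists>w\<in>V. 0 < Re (z w))"
    obtain s where s: "poly (pderiv (root_poly (A z))) 0 = poly (root_poly (A z)) 0 * s"
       "0 < Re s"
      using pderiv_at_0_roots_left[of "A z"] roots[of z] z A(1,3) by blast
    have "poly (pderiv (R z)) 0 = poly (R z) 0 * s"
      by (subst (1 2) A(2)) (simp add: pderiv_smult s)
    moreover have "poly (R z) 0 \<noteq> 0" using roots[of z 0] z by auto
    moreover have "s \<noteq> 0" using s by auto
    ultimately show "poly (pderiv (R z)) 0 \<noteq> 0" by simp
  qed
  assume cap: "capacity_ge \<alpha> (insert v V) (residual a I (insert v V) vs)" and \<alpha>: "0 \<le> \<alpha>"
  show "capacity_ge (\<alpha> / exp 1) V (residual a I V (v # vs))"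
    unfolding capacity_ge_def R'
  proof (intro allI impI)
    fix x assume x: "\<forall>w\<in>V. 0 < (x w :: real)"
    define z where "z = (\<lambda>w. of_real (x w) :: complex)"
    have capR: "\<alpha> * ((\<Prod>w\<in>V. x w) * t) \<le> norm (poly (R z) (of_real t))" if "0 < t" for t
    proof -
      have "\<alpha> * (\<Prod>w\<in>insert v V. (x(v := t)) w) \<le>
          norm (residual a I (insert v V) vs (\<lambda>w. of_real ((x(v := t)) w)))"
        using cap x that unfolding capacity_ge_def
        by (intro mp[OF spec[OF cap[unfolded capacity_ge_def]]]) auto
      moreover have "(\<Prod>w\<in>V. (x(v := t)) w) = (\<Prod>w\<in>V. x w)"
        using fin by (intro prod.cong) auto
      moreover have "(\<lambda>w. of_real ((x(v := t)) w)) = z(v := of_real t)" by (auto simp: z_def)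
      ultimately show ?thesis using fin unfolding R by (simp add: mult_ac)
    qed
    show "\<alpha> / exp 1 * (\<Prod>w\<in>V. x w) \<le> norm (poly (pderiv (R (\<lambda>w. of_real (x w)))) 0)"
    \<comment> \<open>Without a further variable there is no coordinate of positive real part, so
      stability says nothing. By homogeneity the restriction is then a multiple of \<open>t\<close>,
      and its derivative is its value at 1.\<close>
    proof (cases "V = {}")
      case True
      have "poly (R z) t = poly [:0, poly (R z) 1:] t" for t
      proof -
        have "residual a I {v} vs (\<lambda>w. t * (z(v := 1)) w) = t * residual a I {v} vs (z(v := 1))"
          by (simp only: residual_scale) (simp del: fun_upd_apply)
        also have "residual a I {v} vs (\<lambda>w. t * (z(v := 1)) w) = residual a I {v} vs (z(v := t))"
          by (rule residual_cong) auto
        finally show ?thesis by (simp add: R True fun_upd_def)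
      qed
      then have "poly (R z) = poly [:0, poly (R z) 1:]" by blast
      then have "pderiv (R z) = [:poly (R z) 1:]" by (metis pderiv_pCons poly_eq_poly_eq_iff pderiv_0 pCons_0_0 add_0_right pderiv_singleton)
      moreover have "\<alpha> \<le> norm (poly (R z) 1)" using capR[of 1] True by simp
      moreover have "\<alpha> / exp 1 \<le> \<alpha>" using \<alpha> by (simp add: divide_le_eq mult_le_cancel_left1)
      ultimately show ?thesis using True by (simp add: z_def)
    next
      case False
      then have z: "\<forall>w\<in>V. 0 \<le> Re (z w)" "\<exists>w\<in>V. 0 < Re (z w)" using x by (auto simp: z_def less_imp_le)
      have real_roots: "\<rho> \<in> \<real> \<and> Re \<rho> < 0" if \<rho>: "poly (R z) \<rho> = 0" for \<rho>
      proof (rule ccontr)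
        assume neg: "\<not> (\<rho> \<in> \<real> \<and> Re \<rho> < 0)"
        \<comment> \<open>Homogeneity allows multiplying all variables by \<open>inverse w\<close>.
          The variable \<open>v\<close> becomes \<open>\<rho> / w = w\<close> and the positive ones
          become multiples of \<open>inverse w\<close>; all then have positive real part while the
          value stays 0, against stability. So roots are real, hence negative.\<close>
        define w where "w = csqrt \<rho>"
        have w2: "w * w = \<rho>" by (simp add: w_def flip: power2_eq_square)
        have "Re w \<noteq> 0"
        proof
          assume "Re w = 0"
          then have "Im \<rho> = 0" unfolding w2[symmetric] by simp
          then show False using neg roots[OF z \<rho>] by (simp add: complex_is_Real_iff)
        qed
        then have w: "0 < Re w" using csqrt_principal[of \<rho>] by (auto simp: w_def)
        then have w0: "w \<noteq> 0" by auto
        have inv: "0 < Re (inverse w)" using w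
          by (simp add: inverse_complex.sel sum_power2_gt_zero_iff)
        have "residual a I (insert v V) vs (\<lambda>u. inverse w * (z(v := \<rho>)) u) = 0"
          using \<rho> by (simp only: residual_scale flip: R) simp
        moreover have "0 < Re (inverse w * (z(v := \<rho>)) u)" if "u \<in> insert v V" for u
        proof (cases "u = v")
          case True
          have "inverse w * \<rho> = w" using w0 by (simp flip: w2)
          then show ?thesis using True w by simp
        next
          case False
          then show ?thesis using that x mult_pos_pos[OF inv, of "x u"] by (simp add: z_def)
        qed
        ultimately show False using stable unfolding half_plane_stable_def
          by (metis insertI1 less_imp_le)
      qed
      obtain s where s: "0 \<le> s"
        "poly (pderiv (root_poly (A z))) 0 = poly (root_poly (A z)) 0 * of_real s"
        "\<And>t. 0 \<le> t \<Longrightarrow> norm (poly (root_poly (A z)) (of_real t)) \<le>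
             norm (poly (root_poly (A z)) 0) * exp (t * s)"
        using pderiv_at_0_roots_neg_real[of "A z"] real_roots A(3) by blast
      \<comment> \<open>Both lemmas describe the same logarithmic derivative, as the value at 0 is
        nonzero. The half-plane version supplies \<open>0 < s\<close>, so that
        \<open>t = 1 / s\<close> may be chosen.\<close>
      obtain s' where s': "poly (pderiv (root_poly (A z))) 0 = poly (root_poly (A z)) 0 * s'"
         "0 < Re s'"
        using pderiv_at_0_roots_left[of "A z"] roots[of z] z A(1,3) by blast
      have d: "poly (pderiv (R z)) 0 = poly (R z) 0 * of_real s"
        by (subst (1 2) A(2)) (simp add: pderiv_smult s)
      have d': "poly (pderiv (R z)) 0 = poly (R z) 0 * s'"
        by (subst (1 2) A(2)) (simp add: pderiv_smult s')
      have "poly (R z) 0 \<noteq> 0" using roots[OF z, of 0] by auto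
      then have "s' = of_real s" using d d' by simp
      then have "0 < s" using s' by simp
      have "norm (poly (R z) (of_real (1 / s))) \<le> norm (poly (R z) 0) * exp (1 / s * s)"
        using mult_left_mono[OF s(3)[of "1 / s"], of "norm (lead_coeff (R z))"] \<open>0 < s\<close>
        by (subst (1 2) A(2)) (simp add: norm_mult mult_ac)
      then have "\<alpha> * ((\<Prod>w\<in>V. x w) * (1 / s)) \<le> norm (poly (R z) 0) * exp 1"
        using capR[of "1 / s"] \<open>0 < s\<close> by simp
      then have "\<alpha> / exp 1 * (\<Prod>w\<in>V. x w) \<le> norm (poly (R z) 0) * s"
        using \<open>0 < s\<close> by (simp add: field_simps)
      also have "\<dots> = norm (poly (pderiv (R z)) 0)" using \<open>0 < s\<close> by (simp add: d norm_mult)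
      finally show ?thesis by (simp add: z_def)
    qed
  qed
qed

text \<open>The product of the forms has capacity at least 1: weighted AM-GM in each form, then the
  sums over \<open>I\<close> combine the logarithms. Each of the \<open>card I\<close>
  differentiations costs a factor \<open>exp 1\<close>. Positive entries keep the product stable and
  the restrictions nonconstant.\<close>

lemma perm_sum_ge_pos:
  assumes a: "\<And>v i. 0 < a v i" and fin: "finite I"
    and row: "\<And>i. i \<in> I \<Longrightarrow> (\<Sum>v\<in>set us. a v i) = 1"
    and col: "\<And>v. v \<in> set us \<Longrightarrow> (\<Sum>i\<in>I. a v i) = 1"
    and us: "distinct us" "length us = card I"
  shows "exp (- real (card I)) \<le> perm_sum a us I"
proof -
  let ?U = "set us"
  have cU: "card ?U = card I" using us by (simp add: distinct_card)
  have only: "{J. J \<subseteq> I \<and> card J = card ?U} = {I}"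
    using card_subset_eq[OF fin] cU by auto
  have full: "residual a I ?U [] z = (\<Prod>i\<in>I. \<Sum>v\<in>?U. of_real (a v i) * z v)" for z
    unfolding residual_def only by simp
  have "half_plane_stable ?U (residual a I ?U [])"
    unfolding half_plane_stable_def full
  proof (intro allI impI)
    fix z :: "'a \<Rightarrow> complex" assume z: "(\<forall>v\<in>?U. 0 \<le> Re (z v)) \<and> (\<exists>v\<in>?U. 0 < Re (z v))"
    then obtain v where v: "v \<in> ?U" "0 < Re (z v)" by auto
    have "(\<Sum>v\<in>?U. of_real (a v i) * z v) \<noteq> 0" for i
    proof -
      have "0 < (\<Sum>v\<in>?U. a v i * Re (z v))"
        using z v a by (intro sum_pos2[of _ v]) (auto intro!: mult_nonneg_nonneg less_imp_le[OF a])
      then have "Re (\<Sum>v\<in>?U. of_real (a v i) * z v) > 0" by simp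
      then show ?thesis by (metis less_irrefl zero_complex.sel(1))
    qed
    then show "(\<Prod>i\<in>I. \<Sum>v\<in>?U. of_real (a v i) * z v) \<noteq> 0" using fin by simp
  qed
  moreover have "capacity_ge 1 ?U (residual a I ?U [])"
    unfolding capacity_ge_def full
  proof (intro allI impI)
    fix x :: "'a \<Rightarrow> real" assume x: "\<forall>v\<in>?U. 0 < x v"
    define m where "m i = (\<Sum>v\<in>?U. a v i * x v)" for i
    have m: "0 < m i" if "i \<in> I" for i
      unfolding m_def using x a cU that fin by (intro sum_pos mult_pos_pos) auto
    have "(\<Sum>v\<in>?U. a v i * ln (x v)) \<le> ln (m i)" if "i \<in> I" for i
    proof -
      have "(\<Sum>v\<in>?U. a v i * (ln (x v) - ln (m i))) \<le> (\<Sum>v\<in>?U. a v i * (x v / m i - 1))"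
      proof (intro sum_mono mult_left_mono less_imp_le[OF a])
        fix v assume "v \<in> ?U"
        then show "ln (x v) - ln (m i) \<le> x v / m i - 1"
          using bspec[OF x, of v] m[OF that] ln_le_minus_one[of "x v / m i"] by (simp add: ln_div)
      qed
      also have "\<dots> = (\<Sum>v\<in>?U. a v i * x v) / m i - (\<Sum>v\<in>?U. a v i)"
        by (simp add: right_diff_distrib sum_subtractf sum_divide_distrib)
      also have "\<dots> = 0" using m[OF that] row[OF that] by (simp add: m_def)
      finally show ?thesis
        using row[OF that] by (simp add: right_diff_distrib sum_subtractf flip: sum_distrib_right)
    qed
    then have "(\<Sum>i\<in>I. \<Sum>v\<in>?U. a v i * ln (x v)) \<le> (\<Sum>i\<in>I. ln (m i))" by (rule sum_mono)
    also have "(\<Sum>i\<in>I. \<Sum>v\<in>?U. a v i * ln (x v)) = (\<Sum>v\<in>?U. ln (x v))"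
      by (subst sum.swap) (simp add: col flip: sum_distrib_right)
    also have "\<dots> = ln (\<Prod>v\<in>?U. x v)" using x by (intro ln_prod[symmetric]) auto
    also have "(\<Sum>i\<in>I. ln (m i)) = ln (\<Prod>i\<in>I. m i)" using m fin by (intro ln_prod[symmetric]) (auto simp: less_imp_neq[symmetric] dest: m)
    finally have "(\<Prod>v\<in>?U. x v) \<le> (\<Prod>i\<in>I. m i)"
      using x m by (subst (asm) ln_le_cancel_iff) (auto intro!: prod_pos)
    also have "(\<Prod>i\<in>I. m i) \<le> norm (of_real (\<Prod>i\<in>I. m i) :: complex)" by (simp only: norm_of_real abs_ge_self)
    also have "of_real (\<Prod>i\<in>I. m i) = (\<Prod>i\<in>I. \<Sum>v\<in>?U. of_real (a v i) * of_real (x v) :: complex)"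
      by (simp add: m_def)
    finally show "1 * (\<Prod>v\<in>?U. x v) \<le> norm (\<Prod>i\<in>I. \<Sum>v\<in>?U. of_real (a v i) * of_real (x v) :: complex)"
      by simp
  qed
  ultimately have base: "half_plane_stable ?U (residual a I ?U [])" "capacity_ge 1 ?U (residual a I ?U [])" .
  \<comment> \<open>Here \<open>vs\<close> is the suffix of \<open>us\<close> already differentiated
    and \<open>ws\<close> holds the other variables in reverse. The list is consumed from its end
    because each step puts a variable in front of \<open>vs\<close>.\<close>
  have "half_plane_stable (set ws) (residual a I (set ws) vs) \<and>
      capacity_ge (exp (- real (length vs))) (set ws) (residual a I (set ws) vs)"
    if "rev us = rev vs @ ws" for vs ws
    using that
  proof (induction vs arbitrary: ws)
    case Nil
    then show ?case using base by (metis append_Nil list.size(3) of_nat_0 minus_zero exp_zero rev.simps(1) set_rev)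
  next
    case (Cons v vs)
    have d: "distinct (rev vs @ v # ws)" using Cons.prems us by (metis append.assoc append_Cons append_Nil distinct_rev rev.simps(2))
    have IH: "half_plane_stable (insert v (set ws)) (residual a I (insert v (set ws)) vs)"
      "capacity_ge (exp (- real (length vs))) (insert v (set ws)) (residual a I (insert v (set ws)) vs)"
      using Cons.IH[of "v # ws"] Cons.prems by auto
    have c: "card (set ws) + Suc (length vs) = card I"
      using us(2) arg_cong[OF Cons.prems, of length] d by (simp add: distinct_card)
    have e: "exp (- real (length vs)) / exp 1 = exp (- real (length (v # vs)))"
      by (simp add: exp_add exp_diff exp_minus field_simps)
    have v: "v \<notin> set ws" using d by auto
    show ?case
      using residual_step[OF a fin(1) finite_set v c IH(1)] IH(2) unfolding e[symmetric] by auto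
  qed
  from this[of us "[]"] have "capacity_ge (exp (- real (length us))) {} (residual a I {} us)"
    by simp
  moreover have "{J. J \<subseteq> I \<and> card J = 0} = {{}}" using fin finite_subset[of _ I] by (auto simp: card_eq_0_iff)
  ultimately have le: "exp (- real (card I)) \<le> \<bar>perm_sum a us I\<bar>"
    unfolding capacity_ge_def residual_def by (auto simp: us)
  moreover have "0 < perm_sum a us I" by (rule perm_sum_pos[OF a fin]) (simp add: us)
  ultimately show ?thesis by simp
qed

section \<open>Perfect matchings of regular bipartite graphs: lower bound\<close>

definition matchings :: "('c \<Rightarrow> 's set) \<Rightarrow> 'c set \<Rightarrow> 's set \<Rightarrow> ('c \<Rightarrow> 's) set" where
  "matchings A C S = {f \<in> C \<rightarrow>\<^sub>E S. inj_on f C \<and> (\<forall>c\<in>C. f c \<in> A c)}"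

lemma finite_matchings: "finite C \<Longrightarrow> finite S \<Longrightarrow> finite (matchings A C S)"
  unfolding matchings_def by (rule finite_subset[of _ "C \<rightarrow>\<^sub>E S"]) (auto intro: finite_PiE)

lemma bij_betw_matchings_insert:
  assumes "c \<notin> C"
  shows "bij_betw (\<lambda>(s, f). f(c := s)) (SIGMA s:A c \<inter> S. matchings A C (S - {s}))
    (matchings A (insert c C) S)"
proof (rule bij_betw_byWitness[where f' = "\<lambda>f. (f c, f(c := undefined))"])
  show "\<forall>p\<in>(SIGMA s:A c \<inter> S. matchings A C (S - {s})).
      (\<lambda>f. (f c, f(c := undefined))) ((\<lambda>(s, f). f(c := s)) p) = p"
    using assms by (auto simp: matchings_def PiE_def extensional_def fun_eq_iff)
  show "(\<lambda>(s, f). f(c := s)) ` (SIGMA s:A c \<inter> S. matchings A C (S - {s})) \<subseteq> matchings A (insert c C) S"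
  proof (intro image_subsetI, clarify)
    fix s f assume s: "s \<in> A c" "s \<in> S" and f: "f \<in> matchings A C (S - {s})"
    have "f(c := s) \<in> insert c C \<rightarrow>\<^sub>E S"
      using f s by (intro PiE_fun_upd) (auto simp: matchings_def PiE_iff)
    moreover have "inj_on (f(c := s)) (insert c C)"
      using f assms by (auto simp: matchings_def PiE_iff inj_on_insert intro!: inj_on_fun_updI)
    moreover have "\<forall>x\<in>insert c C. (f(c := s)) x \<in> A x"
      using f s assms by (simp add: matchings_def)
    ultimately show "f(c := s) \<in> matchings A (insert c C) S" unfolding matchings_def by blast
  qed
  show "(\<lambda>f. (f c, f(c := undefined))) ` matchings A (insert c C) S \<subseteq> (SIGMA s:A c \<inter> S. matchings A C (S - {s}))"
  proof (intro image_subsetI)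
    fix f assume f: "f \<in> matchings A (insert c C) S"
    then have inj: "inj_on f (insert c C)" by (simp add: matchings_def)
    have "f(c := undefined) \<in> C \<rightarrow>\<^sub>E S - {f c}"
      using f inj_onD[OF inj, of _ c] assms by (auto simp: matchings_def PiE_iff extensional_def)
    moreover have "inj_on (f(c := undefined)) C"
      using inj assms by (simp add: inj_on_def)
    moreover have "\<forall>x\<in>C. (f(c := undefined)) x \<in> A x"
      using f assms by (auto simp: matchings_def)
    moreover have "f c \<in> A c \<inter> S" using f by (auto simp: matchings_def PiE_iff)
    ultimately show "(f c, f(c := undefined)) \<in> (SIGMA s:A c \<inter> S. matchings A C (S - {s}))"
      unfolding matchings_def by blast
  qed
qed auto

lemma card_matchings_insert:
  assumes "c \<notin> C" "finite C" "finite S"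
  shows "card (matchings A (insert c C) S) = (\<Sum>s\<in>A c \<inter> S. card (matchings A C (S - {s})))"
  using bij_betw_same_card[OF bij_betw_matchings_insert[OF assms(1), of A S]] assms
  by (simp add: finite_matchings)

lemma perm_sum_eq_card_matchings:
  assumes "distinct vs" "finite S"
  shows "perm_sum (\<lambda>c s. of_bool (s \<in> A c)) vs S = real (card (matchings A (set vs) S))"
  using assms
proof (induction vs arbitrary: S)
  case Nil
  have "matchings A {} S = {\<lambda>_. undefined}" by (auto simp: matchings_def)
  then show ?case by simp
next
  case (Cons v vs)
  have "(\<Sum>i\<in>S. of_bool (i \<in> A v) * f i) = (\<Sum>i\<in>A v \<inter> S. f i)" for f :: "'b \<Rightarrow> real"
    using Cons.prems by (simp add: sum.inter_restrict[of S f "A v"] Int_commute if_distrib cong: if_cong)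
  then show ?case using Cons by (simp add: card_matchings_insert)
qed

lemma perm_sum_scale: "perm_sum (\<lambda>v i. c * a v i) vs S = c ^ length vs * perm_sum a vs S"
  by (induction vs arbitrary: S) (simp_all add: sum_distrib_left mult_ac)

lemma tendsto_perm_sum:
  assumes "\<And>v i. ((\<lambda>t. b t v i) \<longlongrightarrow> a v i) F"
  shows "((\<lambda>t. perm_sum (b t) vs S) \<longlongrightarrow> perm_sum a vs S) F"
  by (induction vs arbitrary: S) (auto intro!: tendsto_intros assms)

text \<open>The adjacency matrix divided by \<open>r\<close> is doubly stochastic. Its zeros are
  removed by mixing in the constant matrix \<open>1 / n\<close> with weight \<open>t\<close>, and
  \<open>t\<close> tends to 0 at the end.\<close>

lemma regular_matchings_lower:
  assumes fin: "finite C" "finite S" and n: "card C = card S" and r: "0 < r"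
    and row: "\<And>c. c \<in> C \<Longrightarrow> A c \<subseteq> S \<and> card (A c) = r"
    and col: "\<And>s. s \<in> S \<Longrightarrow> card {c \<in> C. s \<in> A c} = r"
  shows "(real r / exp 1) ^ card C \<le> real (card (matchings A C S))"
proof -
  obtain us where us: "set us = C" "distinct us" using fin finite_distinct_list by blast
  define n where "n = card C"
  have lus: "length us = n" using us by (simp add: n_def flip: distinct_card)
  show ?thesis
  proof (cases "n = 0")
    case True
    then have "us = []" using lus by simp
    then show ?thesis using perm_sum_eq_card_matchings[OF us(2) fin(2), of A] us by simp
  next
    case False
    define b where "b t c s = (1 - t) * (1 / real r * of_bool (s \<in> A c)) + t / real n" for t c s
    have cs: "(\<Sum>s\<in>S. of_bool (s \<in> A c)) = real r" if "c \<in> C" for c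
      using row[OF that] fin by (simp add: Int_absorb1)
    have rs: "(\<Sum>c\<in>C. of_bool (s \<in> A c)) = real r" if "s \<in> S" for s
      using col[OF that] fin by (simp add: Int_def)
    have ge: "exp (- real n) \<le> perm_sum (b t) us S" if "0 < t" "t < 1" for t
    proof -
      have "exp (- real (card S)) \<le> perm_sum (b t) us S"
      proof (rule perm_sum_ge_pos)
        show "0 < b t v i" for v i
          using that False unfolding b_def by (intro add_nonneg_pos mult_nonneg_nonneg) auto
        show "(\<Sum>v\<in>set us. b t v i) = 1" if "i \<in> S" for i
          using rs[OF that] r False
          by (simp add: b_def sum.distrib us n_def[symmetric] flip: sum_distrib_left sum_divide_distrib)
        show "(\<Sum>i\<in>S. b t v i) = 1" if "v \<in> set us" for v
          using cs[of v] that r False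
          by (simp add: b_def sum.distrib us n[symmetric] n_def[symmetric] flip: sum_distrib_left sum_divide_distrib)
      qed (use fin us lus n n_def in auto)
      then show ?thesis by (simp add: n n_def)
    qed
    have "((\<lambda>t. perm_sum (b t) us S) \<longlongrightarrow> perm_sum (\<lambda>c s. 1 / real r * of_bool (s \<in> A c)) us S) (at_right 0)"
    proof (rule tendsto_perm_sum)
      fix v i
      have "((\<lambda>t. b t v i) \<longlongrightarrow> (1 - 0) * (1 / real r * of_bool (i \<in> A v)) + 0 / real n) (at_right 0)"
        unfolding b_def using False by (intro tendsto_intros) auto
      then show "((\<lambda>t. b t v i) \<longlongrightarrow> 1 / real r * of_bool (i \<in> A v)) (at_right 0)" by simp
    qed
    moreover have "eventually (\<lambda>t. exp (- real n) \<le> perm_sum (b t) us S) (at_right 0)"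
      using ge by (auto simp: eventually_at_right_field intro: exI[of _ 1])
    ultimately have "exp (- real n) \<le> perm_sum (\<lambda>c s. 1 / real r * of_bool (s \<in> A c)) us S"
      by (intro tendsto_lowerbound) auto
    also have "\<dots> = (1 / real r) ^ n * real (card (matchings A C S))"
      unfolding perm_sum_scale lus perm_sum_eq_card_matchings[OF us(2) fin(2)] us(1) ..
    finally have "exp (- real n) * real r ^ n \<le> real (card (matchings A C S))"
      using r by (simp add: power_one_over field_simps)
    moreover have "exp (- real n) = (1 / exp 1) ^ n"
      by (simp add: power_one_over exp_minus inverse_eq_divide flip: exp_of_nat_mult)
    ultimately show ?thesis
      by (simp add: n_def power_divide power_one_over)
  qed
qed


text \<open>Bregman's factor, the \<open>d\<close>-th root of \<open>fact d\<close>, grows with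
  \<open>d\<close>, because \<open>fact r\<close> is at most \<open>Suc r ^ r\<close>. So degrees
  may be replaced by an upper bound.\<close>

lemma ln_fact_mono_avg: "d \<le> r \<Longrightarrow> 1 \<le> d \<Longrightarrow> ln (fact d) / real d \<le> ln (fact r :: real) / real r"
proof (induction r rule: dec_induct)
  case (step r)
  have "ln (fact r :: real) \<le> real r * ln (real (Suc r))"
  proof -
    have "(fact r :: real) \<le> real (Suc r) ^ r"
      using fact_le_power[of r, where 'a=real] power_mono[of "real r" "real (Suc r)" r] by simp
    then have "ln (fact r :: real) \<le> ln (real (Suc r) ^ r)" by (subst ln_le_cancel_iff) auto
    then show ?thesis by (simp add: ln_realpow)
  qed
  moreover have "ln (fact (Suc r) :: real) = ln (real (Suc r)) + ln (fact r)" by (simp add: ln_mult)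
  ultimately have "ln (fact r) * real (Suc r) \<le> ln (fact (Suc r) :: real) * real r"
    by (simp add: algebra_simps)
  then have "ln (fact r) / real r \<le> ln (fact (Suc r) :: real) / real (Suc r)"
    using step by (simp add: field_simps)
  then show ?case using step by linarith
qed simp

lemma inverse_Suc_le_ln_diff: "1 \<le> d \<Longrightarrow> 1 / real (Suc d) \<le> ln (real (Suc d)) - ln (real d)"
  using ln_le_minus_one[of "real d / real (Suc d)"] by (simp add: ln_div field_simps)

text \<open>Stirling up to a factor linear in \<open>d\<close>; the induction step is
  \<open>1 \<le> Suc d * (ln (Suc d) - ln d)\<close>.\<close>

lemma ln_fact_upper: "1 \<le> d \<Longrightarrow> ln (fact d :: real) \<le> real d * ln (real d) - real d + ln (real d) + 1"
proof (induction d rule: dec_induct)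
  case (step d)
  have "1 \<le> real (Suc d) * (ln (real (Suc d)) - ln (real d))"
    using inverse_Suc_le_ln_diff[of d] step by (simp add: field_simps)
  moreover have "ln (fact (Suc d) :: real) = ln (real (Suc d)) + ln (fact d)" by (simp add: ln_mult)
  ultimately show ?case using step by (simp add: algebra_simps)
qed simp

section \<open>Bregman's inequality\<close>

lemma sum_matchings:
  fixes g :: "'s \<Rightarrow> real"
  assumes "c \<in> C" "finite C" "finite S"
  shows "(\<Sum>f\<in>matchings A C S. g (f c)) =
    (\<Sum>s\<in>A c \<inter> S. real (card (matchings A (C - {c}) (S - {s}))) * g s)"
proof -
  have "(\<Sum>f\<in>matchings A C S. g (f c)) = (\<Sum>f\<in>matchings A (insert c (C - {c})) S. g (f c))"
    using assms by (simp add: insert_absorb)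
  also have "\<dots> = (\<Sum>(s, f)\<in>(SIGMA s:A c \<inter> S. matchings A (C - {c}) (S - {s})). g s)"
    by (subst sum.reindex_bij_betw[OF bij_betw_matchings_insert[of c "C - {c}" A S], symmetric])
       (auto intro!: sum.cong)
  also have "\<dots> = (\<Sum>s\<in>A c \<inter> S. real (card (matchings A (C - {c}) (S - {s}))) * g s)"
    using assms by (subst sum.Sigma[symmetric]) (auto simp: finite_matchings)
  finally show ?thesis .
qed

text \<open>Jensen for the convex function \<open>p * ln p\<close>, through its tangent at the mean.
  Terms with \<open>p s = 0\<close> vanish because of the factor in front of the logarithm.\<close>

lemma sum_mult_ln_ge:
  fixes p :: "'s \<Rightarrow> real"
  assumes "finite D" "\<And>s. s \<in> D \<Longrightarrow> 0 \<le> p s" "0 < sum p D"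
  shows "sum p D * ln (sum p D) \<le> sum p D * ln (real (card D)) + (\<Sum>s\<in>D. p s * ln (p s))"
proof -
  define P where "P = sum p D"
  define d where "d = real (card D)"
  have "D \<noteq> {}" using assms by auto
  then have d: "0 < d" using assms by (simp add: d_def card_gt_0_iff)
  have P: "0 < P" using assms by (simp add: P_def)
  have "(\<Sum>s\<in>D. p s * (ln (P / d) - ln (p s))) \<le> (\<Sum>s\<in>D. P / d - p s)"
  proof (rule sum_mono)
    fix s assume s: "s \<in> D"
    show "p s * (ln (P / d) - ln (p s)) \<le> P / d - p s"
    proof (cases "p s = 0")
      case False
      then have ps: "0 < p s" using assms s by (simp add: order_less_le)
      have "ln (P / d) - ln (p s) \<le> P / d / p s - 1"
        using ln_le_minus_one[of "P / d / p s"] ln_div[of "P / d" "p s"] P d ps by simp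
      then have "p s * (ln (P / d) - ln (p s)) \<le> p s * (P / d / p s - 1)"
        using ps by (intro mult_left_mono) auto
      then show ?thesis using ps by (simp add: right_diff_distrib)
    qed (use P d in simp)
  qed
  also have "\<dots> = 0" using d by (simp add: sum_subtractf d_def[symmetric] P_def[symmetric])
  finally have "(\<Sum>s\<in>D. p s * ln (P / d)) \<le> (\<Sum>s\<in>D. p s * ln (p s))"
    by (simp add: right_diff_distrib sum_subtractf)
  then have "P * ln (P / d) \<le> (\<Sum>s\<in>D. p s * ln (p s))"
    by (simp add: P_def sum_distrib_right)
  then show ?thesis using P d by (simp add: ln_div right_diff_distrib P_def d_def)
qed

text \<open>Schrijver's proof: apply convexity of \<open>p ln p\<close> to the expansion along each vertex, rewrite the sums of \<open>p ln p\<close> as sums over matchings, and use induction for each matching.\<close>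

theorem bregman:
  fixes A :: "'c \<Rightarrow> 's set"
  assumes "finite C" "finite S" "card C = card S" "matchings A C S \<noteq> {}"
  shows "ln (real (card (matchings A C S))) \<le>
    (\<Sum>c\<in>C. ln (fact (card (A c \<inter> S))) / real (card (A c \<inter> S)))"
  using assms
proof (induction "card C" arbitrary: C S)
  case 0
  then have "matchings A C S = {\<lambda>_. undefined}" by (auto simp: matchings_def)
  then show ?case using 0 by simp
next
  case (Suc m)
  define n where "n = real (card C)"
  define h :: "nat \<Rightarrow> real" where "h d = ln (fact d) / real d" for d
  define M where "M = matchings A C S"
  define P where "P = real (card M)"
  define d where "d c = card (A c \<inter> S)" for c
  define p where "p c s = real (card (matchings A (C - {c}) (S - {s})))" for c s
  have fM: "finite M" using Suc.prems by (simp add: M_def finite_matchings)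
  then have P: "0 < P" using Suc.prems by (simp add: P_def M_def card_gt_0_iff)
  have n: "0 < n" using Suc.hyps unfolding n_def by linarith
  have fAS: "finite (A c \<inter> S)" for c using Suc.prems by simp
  have bij: "bij_betw f C S" if "f \<in> M" for f
  proof -
    have "inj_on f C" "f ` C \<subseteq> S" using that by (auto simp: M_def matchings_def PiE_iff)
    then show ?thesis using Suc.prems
      by (simp add: bij_betw_def card_image card_subset_eq)
  qed
  have step: "P * ln P \<le> (\<Sum>f\<in>M. ln (real (d c)) + ln (p c (f c)))" if c: "c \<in> C" for c
  proof -
    have Ps: "(\<Sum>s\<in>A c \<inter> S. p c s) = P"
      using sum_matchings[OF c Suc.prems(1,2), where A = A and g = "\<lambda>_. 1"] by (simp add: p_def P_def M_def)
    have "P * ln P \<le> P * ln (real (d c)) + (\<Sum>s\<in>A c \<inter> S. p c s * ln (p c s))"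
      using sum_mult_ln_ge[OF fAS, of c "p c"] P unfolding Ps d_def by (simp add: p_def)
    also have "(\<Sum>s\<in>A c \<inter> S. p c s * ln (p c s)) = (\<Sum>f\<in>M. ln (p c (f c)))"
      using sum_matchings[OF c Suc.prems(1,2), where A = A and g = "\<lambda>s. ln (p c s)"]
      by (simp add: p_def M_def)
    also have "P * ln (real (d c)) + \<dots> = (\<Sum>f\<in>M. ln (real (d c)) + ln (p c (f c)))"
      by (simp add: sum.distrib P_def)
    finally show ?thesis .
  qed
  have per_matching: "(\<Sum>c\<in>C. ln (real (d c)) + ln (p c (f c))) \<le> n * (\<Sum>c\<in>C. h (d c))" if f: "f \<in> M" for f
  proof -
    have f': "f c \<in> A c" "f c \<in> S" if "c \<in> C" for c
      using f that by (auto simp: M_def matchings_def PiE_iff)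
    have "ln (p c (f c)) \<le> (\<Sum>c'\<in>C - {c}. h (card (A c' \<inter> (S - {f c}))))" if c: "c \<in> C" for c
    proof -
      have "restrict f (C - {c}) \<in> matchings A (C - {c}) (S - {f c})"
        using f c unfolding M_def matchings_def
        by (auto simp: PiE_iff inj_on_def)
      then have ne: "matchings A (C - {c}) (S - {f c}) \<noteq> {}" by auto
      have m: "m = card (C - {c})" "card (C - {c}) = card (S - {f c})"
        using Suc.hyps(2) Suc.prems f'[OF c] c by auto
      show ?thesis
        using Suc.hyps(1)[OF m(1) _ _ m(2) ne] Suc.prems by (simp add: p_def h_def)
    qed
    then have "(\<Sum>c\<in>C. ln (real (d c)) + ln (p c (f c))) \<le>
       (\<Sum>c\<in>C. ln (real (d c))) + (\<Sum>c\<in>C. \<Sum>c'\<in>C - {c}. h (card (A c' \<inter> (S - {f c}))))"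
      by (simp add: sum.distrib sum_mono)
    also have "(\<Sum>c\<in>C. \<Sum>c'\<in>C - {c}. h (card (A c' \<inter> (S - {f c})))) =
        (\<Sum>c'\<in>C. \<Sum>c\<in>C - {c'}. h (card (A c' \<inter> (S - {f c}))))"
      using Suc.prems sum.swap_restrict[of C C "\<lambda>c c'. h (card (A c' \<inter> (S - {f c})))" "\<lambda>c c'. c' \<noteq> c"]
      by (simp add: set_diff_eq eq_commute)
    also have "(\<Sum>c\<in>C. ln (real (d c))) + \<dots> =
        (\<Sum>c\<in>C. ln (real (d c)) + (\<Sum>b\<in>C - {c}. h (card (A c \<inter> (S - {f b})))))"
      by (simp add: sum.distrib)
    also have "\<dots> = (\<Sum>c\<in>C. n * h (d c))"
    proof (intro sum.cong refl)
      fix c assume c: "c \<in> C"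
      define F where "F s = h (card (A c \<inter> (S - {s})))" for s
      have dpos: "0 < d c" using f'[OF c] fAS by (auto simp: d_def card_gt_0_iff)
      have dn: "d c \<le> card S" using Suc.prems by (simp add: d_def card_mono)
      have F1: "F s = h (d c - 1)" if "s \<in> A c \<inter> S" for s
      proof -
        have "A c \<inter> (S - {s}) = A c \<inter> S - {s}" by auto
        then show ?thesis using that fAS by (simp add: F_def d_def)
      qed
      have F2: "F s = h (d c)" if "s \<in> S - A c" for s
      proof -
        have "A c \<inter> (S - {s}) = A c \<inter> S" using that by auto
        then show ?thesis by (simp add: F_def d_def)
      qed
      \<comment> \<open>Deleting the symbol \<open>f b\<close> lowers the degree of \<open>c\<close>
        exactly if it lies in \<open>A c\<close>. As \<open>f\<close> is a bijection this happens
        for \<open>d c\<close> vertices \<open>b\<close>, one of them being \<open>c\<close> itself,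
        which is then left out.\<close>
      have "(\<Sum>b\<in>C. F (f b)) = (\<Sum>s\<in>S. F s)"
        by (rule sum.reindex_bij_betw[OF bij[OF f]])
      also have "\<dots> = (\<Sum>s\<in>A c \<inter> S. F s) + (\<Sum>s\<in>S - A c. F s)"
        using Suc.prems by (subst sum.union_disjoint[symmetric]) (auto intro!: sum.cong)
      also have "\<dots> = real (d c) * h (d c - 1) + (real (card S) - real (d c)) * h (d c)"
      proof -
        have "S - A c = S - (A c \<inter> S)" by auto
        then have "card (S - A c) = card S - d c"
          using Suc.prems by (simp add: card_Diff_subset d_def)
        then show ?thesis using F1 F2 dn by (simp add: d_def of_nat_diff)
      qed
      finally have "(\<Sum>b\<in>C - {c}. F (f b)) =
          (real (d c) - 1) * h (d c - 1) + (n - real (d c)) * h (d c)"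
        using Suc.prems c F1[of "f c"] f'[OF c]
        by (simp add: sum_diff1 n_def algebra_simps)
      \<comment> \<open>For \<open>d c = 1\<close> the value \<open>h 0\<close> is multiplied by 0,
        and \<open>ln (fact 0)\<close> is 0 as well.\<close>
      also have "(real (d c) - 1) * h (d c - 1) = ln (fact (d c - 1))"
        using dpos by (cases "d c = 1") (auto simp: h_def of_nat_diff)
      finally have "ln (real (d c)) + (\<Sum>b\<in>C - {c}. F (f b)) =
          ln (real (d c)) + ln (fact (d c - 1)) + (n - real (d c)) * h (d c)" by simp
      also have "ln (real (d c)) + ln (fact (d c - 1)) = ln (fact (d c))"
        using dpos by (subst fact_reduce[of "d c"]) (auto simp: ln_mult)
      also have "ln (fact (d c)) + (n - real (d c)) * h (d c) = n * h (d c)"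
        using dpos by (simp add: h_def field_simps)
      finally show "ln (real (d c)) + (\<Sum>b\<in>C - {c}. h (card (A c \<inter> (S - {f b})))) = n * h (d c)"
        by (simp add: F_def)
    qed
    finally show ?thesis by (simp add: sum_distrib_left)
  qed
  have "n * (P * ln P) = (\<Sum>c\<in>C. P * ln P)" by (simp add: n_def)
  also have "\<dots> \<le> (\<Sum>c\<in>C. \<Sum>f\<in>M. ln (real (d c)) + ln (p c (f c)))" by (intro sum_mono step)
  also have "\<dots> = (\<Sum>f\<in>M. \<Sum>c\<in>C. ln (real (d c)) + ln (p c (f c)))" by (rule sum.swap)
  also have "\<dots> \<le> (\<Sum>f\<in>M. n * (\<Sum>c\<in>C. h (d c)))" by (intro sum_mono per_matching)
  also have "\<dots> = n * (P * (\<Sum>c\<in>C. h (d c)))" by (simp add: P_def)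
  finally have "ln P \<le> (\<Sum>c\<in>C. h (d c))" using n P by simp
  then show ?case by (simp add: P_def M_def h_def d_def)
qed

text \<open>Delete the endpoints of \<open>Q\<close> and apply Bregman to the rest. Bounding the
  degrees by \<open>r\<close> leaves \<open>n - t\<close> factors of about \<open>r / exp 1\<close>,
  which is \<open>exp t\<close> more than the desired \<open>r\<close> to the power
  \<open>- t\<close> times the full count. The second bound replaces this by
  \<open>exp (t\<^sup>2 / r)\<close>: the degrees drop by at least \<open>t * (r - t)\<close> in
  total, since each deleted symbol had \<open>r\<close> neighbours, at most \<open>t\<close> of them
  deleted. Its hypothesis keeps all remaining degrees above \<open>n / 2\<close>, so that the
  Stirling errors add up to \<open>O(ln n)\<close> only.\<close>

lemma regular_matchings_upper:
  fixes A :: "'c \<Rightarrow> 's set"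
  assumes fin: "finite C" "finite S" and n: "card C = n" "card S = n" and n0: "0 < n" and r: "0 < r"
    and row: "\<And>c. c \<in> C \<Longrightarrow> A c \<subseteq> S \<and> card (A c) = r"
    and col: "\<And>s. s \<in> S \<Longrightarrow> card {c \<in> C. s \<in> A c} = r"
    and Q: "Q \<subseteq> C \<times> S" and t: "card Q = t"
    and E: "E = {f \<in> matchings A C S. \<forall>(x, a)\<in>Q. f x = a}" "E \<noteq> {}"
  shows "ln (real (card E)) \<le> real n * (ln (real r) - 1) - real t * ln (real r) + real t
           + real n * (1 + ln (real r)) / real r"
    and "n \<le> 2 * (r - t) \<Longrightarrow> ln (real (card E)) \<le> real n * (ln (real r) - 1) - real t * ln (real r)
           + (real t)\<^sup>2 / real r + 2 * (1 + ln (real n))"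
proof -
  obtain g where g: "g \<in> E" using E by auto
  have gQ: "g x = a" "x \<in> C" "a \<in> S" if "(x, a) \<in> Q" for x a using g that Q E by auto
  have ginj: "inj_on g C" using g by (auto simp: E matchings_def)
  define X where "X = fst ` Q"
  define Y where "Y = snd ` Q"
  have X: "X \<subseteq> C" and Y: "Y \<subseteq> S" using Q by (auto simp: X_def Y_def)
  have fQ: "finite Q" using Q fin by (meson finite_SigmaI finite_subset)
  have "inj_on fst Q" by (rule inj_onI) (metis gQ(1) prod.collapse)
  then have cX: "card X = t" using t by (simp add: X_def card_image)
  have "inj_on snd Q" by (rule inj_onI) (metis gQ(1,2) ginj inj_onD prod.collapse)
  then have cY: "card Y = t" using t by (simp add: Y_def card_image)
  have fX: "finite X" "finite Y" using fQ by (auto simp: X_def Y_def)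
  have tn: "t \<le> n" using cX X fin n by (metis card_mono)
  define N where "N = matchings A (C - X) (S - Y)"
  define d where "d c = card (A c \<inter> (S - Y))" for c
  have res: "restrict f (C - X) \<in> N" if f: "f \<in> E" for f
  proof -
    have inj: "inj_on f C" and fC: "f c \<in> S" "f c \<in> A c" if "c \<in> C" for c
      using f that by (auto simp: E matchings_def PiE_iff)
    have "f c \<notin> Y" if "c \<in> C - X" for c
    proof
      assume "f c \<in> Y"
      then obtain x where x: "(x, f c) \<in> Q" by (auto simp: Y_def)
      then have "f x = f c" using f by (auto simp: E)
      moreover have "x \<in> C" "x \<in> X" using x Q by (auto simp: X_def image_iff intro!: bexI[of _ "(x, f c)"])
      ultimately show False using inj_onD[of f C x c] f that by (auto simp: E matchings_def)
    qed
    moreover have "f \<in> C \<rightarrow>\<^sub>E S" "inj_on f C" using f by (auto simp: E matchings_def)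
    ultimately show ?thesis unfolding N_def matchings_def using fC
      by (auto simp: PiE_iff inj_on_def)
  qed
  have "inj_on (\<lambda>f. restrict f (C - X)) E"
  proof (rule inj_onI)
    fix f f' assume f: "f \<in> E" "f' \<in> E" and eq: "restrict f (C - X) = restrict f' (C - X)"
    show "f = f'"
    proof
      fix c
      consider "c \<in> C - X" | "c \<in> X" | "c \<notin> C" by auto
      then show "f c = f' c"
      proof cases
        case 1
        then show ?thesis using fun_cong[OF eq, of c] by simp
      next
        case 2
        then show ?thesis using f by (fastforce simp: X_def E)
      next
        case 3
        then show ?thesis using f by (auto simp: E matchings_def PiE_iff extensional_def)
      qed
    qed
  qed
  moreover have fN: "finite N" using fin by (simp add: N_def finite_matchings)
  ultimately have EN: "card E \<le> card N" using res by (intro card_inj_on_le) auto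
  have N0: "N \<noteq> {}" using res g by auto
  have fE: "finite E" using finite_matchings[OF fin, of A] E by auto
  have "ln (real (card E)) \<le> ln (real (card N))"
  proof -
    have "0 < card E" using E(2) fE by (simp add: card_gt_0_iff)
    then show ?thesis using EN by simp
  qed
  also have "\<dots> \<le> (\<Sum>c\<in>C - X. ln (fact (d c)) / real (d c))"
    using bregman[of "C - X" "S - Y" A] N0 fin X Y cX cY n fX
    by (simp add: N_def d_def card_Diff_subset)
  finally have main: "ln (real (card E)) \<le> (\<Sum>c\<in>C - X. ln (fact (d c)) / real (d c))" .
  have d: "1 \<le> d c" "d c \<le> r" "r - t \<le> d c" "real (d c) = real r - real (card (A c \<inter> Y))" if c: "c \<in> C - X" for c
  proof -
    have fA: "finite (A c)" using row[of c] c fin finite_subset by auto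
    have "restrict g (C - X) c \<in> A c \<inter> (S - Y)"
      using res[OF g] c by (auto simp: N_def matchings_def PiE_iff)
    then show "1 \<le> d c" unfolding d_def using fA by (metis Suc_le_eq card_gt_0_iff empty_iff finite_Int One_nat_def)
    have e: "A c \<inter> (S - Y) = A c - A c \<inter> Y" using row[of c] c by auto
    have "card (A c \<inter> Y) \<le> t" using fX cY by (metis card_mono inf_le2)
    moreover have "card (A c \<inter> Y) \<le> r" using row[of c] c fA by (metis DiffD1 card_mono inf_le1)
    moreover have "d c = r - card (A c \<inter> Y)"
      unfolding d_def e using row[of c] c fA by (subst card_Diff_subset) auto
    ultimately show "d c \<le> r" "r - t \<le> d c" "real (d c) = real r - real (card (A c \<inter> Y))" by auto
  qed
  have cCX: "real (card (C - X)) = real n - real t"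
    using X fX cX n fin tn by (simp add: card_Diff_subset of_nat_diff)
  note main
  also have "(\<Sum>c\<in>C - X. ln (fact (d c)) / real (d c)) \<le> (\<Sum>c\<in>C - X. ln (real r) - 1 + (1 + ln (real r)) / real r)"
  proof (rule sum_mono)
    fix c assume c: "c \<in> C - X"
    have "ln (fact (d c)) / real (d c) \<le> ln (fact r) / real r"
      using ln_fact_mono_avg d(1,2)[OF c] by blast
    also have "\<dots> \<le> (real r * ln (real r) - real r + ln (real r) + 1) / real r"
      using ln_fact_upper[of r] r by (intro divide_right_mono) auto
    also have "\<dots> = ln (real r) - 1 + (1 + ln (real r)) / real r"
      using r by (simp add: field_simps)
    finally show "ln (fact (d c)) / real (d c) \<le> \<dots>" .
  qed
  also have "\<dots> = (real n - real t) * (ln (real r) - 1) + (real n - real t) * ((1 + ln (real r)) / real r)"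
    by (simp add: cCX[simplified] distrib_left)
  also have "\<dots> \<le> (real n - real t) * (ln (real r) - 1) + real n * ((1 + ln (real r)) / real r)"
    using r by (intro add_left_mono mult_right_mono) auto
  finally show "ln (real (card E)) \<le> real n * (ln (real r) - 1) - real t * ln (real r) + real t
           + real n * (1 + ln (real r)) / real r"
    by (simp add: algebra_simps)
  assume half: "n \<le> 2 * (r - t)"
  have tr: "t \<le> r" using half n0 by linarith
  have rn: "r \<le> n"
  proof -
    obtain c where "c \<in> C" using n0 n by fastforce
    then show ?thesis using row n fin by (metis card_mono)
  qed
  note main
  also have "(\<Sum>c\<in>C - X. ln (fact (d c)) / real (d c)) \<le>
     (\<Sum>c\<in>C - X. ln (real r) + (real (d c) - real r) / real r - 1 + 2 * (1 + ln (real n)) / real n)"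
  proof (rule sum_mono)
    fix c assume c: "c \<in> C - X"
    note dc = d[OF c]
    have dn: "real n \<le> 2 * real (d c)" using half dc(3) by linarith
    have "ln (fact (d c)) / real (d c) \<le>
        (real (d c) * ln (real (d c)) - real (d c) + ln (real (d c)) + 1) / real (d c)"
      using ln_fact_upper[of "d c"] dc by (intro divide_right_mono) auto
    also have "\<dots> = ln (real (d c)) - 1 + (1 + ln (real (d c))) / real (d c)"
      using dc by (simp add: field_simps)
    also have "(1 + ln (real (d c))) / real (d c) \<le> (1 + ln (real n)) / (real n / 2)"
      using dc dn n0 rn by (intro frac_le) auto
    also have "ln (real (d c)) \<le> ln (real r) + (real (d c) - real r) / real r"
      using ln_le_minus_one[of "real (d c) / real r"] dc(1) r by (simp add: ln_div field_simps)
    finally show "ln (fact (d c)) / real (d c) \<le>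
       ln (real r) + (real (d c) - real r) / real r - 1 + 2 * (1 + ln (real n)) / real n"
      by (simp add: mult.commute)
  qed
  also have "\<dots> = (real n - real t) * (ln (real r) - 1) + (\<Sum>c\<in>C - X. real (d c) - real r) / real r
      + (real n - real t) * (2 * (1 + ln (real n)) / real n)"
  proof -
    have "(\<Sum>c\<in>C - X. ln (real r) + (real (d c) - real r) / real r - 1 + 2 * (1 + ln (real n)) / real n) =
        (\<Sum>c\<in>C - X. ln (real r) - 1) + (\<Sum>c\<in>C - X. (real (d c) - real r) / real r) +
        (\<Sum>c\<in>C - X. 2 * (1 + ln (real n)) / real n)"
      unfolding sum.distrib[symmetric] by (intro sum.cong) auto
    then show ?thesis by (simp only: sum_constant cCX sum_divide_distrib)
  qed
  also have "(\<Sum>c\<in>C - X. real (d c) - real r) \<le> - (real t * (real r - real t))"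
  proof -
    have "(\<Sum>c\<in>C - X. real (d c) - real r) = - (\<Sum>c\<in>C - X. real (card (A c \<inter> Y)))"
      unfolding sum_negf[symmetric] by (intro sum.cong refl) (simp add: d(4))
    also have "(\<Sum>c\<in>C - X. real (card (A c \<inter> Y))) = real (\<Sum>c\<in>C - X. card (A c \<inter> Y))" by simp
    also have "(\<Sum>c\<in>C - X. card (A c \<inter> Y)) = (\<Sum>c\<in>C - X. \<Sum>s | s \<in> Y \<and> s \<in> A c. 1)"
      using fX by (simp add: Int_def conj_commute)
    also have "\<dots> = (\<Sum>s\<in>Y. \<Sum>c | c \<in> C - X \<and> s \<in> A c. 1)"
      using fin fX by (intro sum.swap_restrict) auto
    finally have eq: "(\<Sum>c\<in>C - X. real (d c) - real r) = - real (\<Sum>s\<in>Y. card {c \<in> C - X. s \<in> A c})"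
      by simp
    have "t * (r - t) \<le> (\<Sum>s\<in>Y. card {c \<in> C - X. s \<in> A c})"
    proof -
      have "r - t \<le> card {c \<in> C - X. s \<in> A c}" if "s \<in> Y" for s
      proof -
        have "r = card {c \<in> C. s \<in> A c}" using col that Y by auto
        also have "\<dots> \<le> card ({c \<in> C - X. s \<in> A c} \<union> X)"
          using fin fX by (intro card_mono) auto
        also have "\<dots> \<le> card {c \<in> C - X. s \<in> A c} + t"
          using card_Un_le[of "{c \<in> C - X. s \<in> A c}" X] cX by simp
        finally show ?thesis by simp
      qed
      then show ?thesis using sum_bounded_below[of Y "r - t"] cY by simp
    qed
    then have "real (t * (r - t)) \<le> real (\<Sum>s\<in>Y. card {c \<in> C - X. s \<in> A c})" by (rule of_nat_mono)
    then show ?thesis using eq tr by (simp add: of_nat_diff)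
  qed
  also have "(real n - real t) * (2 * (1 + ln (real n)) / real n) \<le> real n * (2 * (1 + ln (real n)) / real n)"
    using n0 by (intro mult_right_mono) auto
  finally have "ln (real (card E)) \<le> (real n - real t) * (ln (real r) - 1) + - (real t * (real r - real t)) / real r
      + real n * (2 * (1 + ln (real n)) / real n)"
    using r n0 by (simp add: divide_right_mono)
  also have "- (real t * (real r - real t)) / real r = (real t)\<^sup>2 / real r - real t"
    using r by (simp add: field_simps power2_eq_square)
  also have "real n * (2 * (1 + ln (real n)) / real n) = 2 * (1 + ln (real n))"
    using n0 by simp
  finally show "ln (real (card E)) \<le> real n * (ln (real r) - 1) - real t * ln (real r)
           + (real t)\<^sup>2 / real r + 2 * (1 + ln (real n))"
    by (simp add: algebra_simps)
qed

section \<open>Latin rectangles\<close>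

text \<open>The rows form an arbitrary set of indices, so that the rows carrying prescribed entries
  can be exposed first.\<close>

definition latin_rects :: "nat \<Rightarrow> nat set \<Rightarrow> (nat \<times> nat \<Rightarrow> nat) set" where
  "latin_rects n R = {F \<in> R \<times> {1..n} \<rightarrow>\<^sub>E {1..n}.
     (\<forall>i\<in>R. inj_on (\<lambda>x. F (i, x)) {1..n}) \<and> (\<forall>x\<in>{1..n}. inj_on (\<lambda>i. F (i, x)) R)}"

definition rects_with :: "nat \<Rightarrow> nat set \<Rightarrow> ((nat \<times> nat) \<times> nat) set \<Rightarrow> (nat \<times> nat \<Rightarrow> nat) set" where
  "rects_with n R P = {F \<in> latin_rects n R. \<forall>(p, a)\<in>P. fst p \<in> R \<longrightarrow> F p = a}"

definition avail :: "nat \<Rightarrow> nat set \<Rightarrow> (nat \<times> nat \<Rightarrow> nat) \<Rightarrow> nat \<Rightarrow> nat set" where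
  "avail n R F x = {1..n} - (\<lambda>i. F (i, x)) ` R"

definition row_part :: "((nat \<times> nat) \<times> nat) set \<Rightarrow> nat \<Rightarrow> (nat \<times> nat) set" where
  "row_part P i = {(x, a). ((i, x), a) \<in> P}"

lemma ex1_iff_inj_on:
  assumes "finite A" "f ` A \<subseteq> A"
  shows "(\<forall>s\<in>A. \<exists>!x. x \<in> A \<and> f x = s) \<longleftrightarrow> inj_on f A"
proof
  assume "\<forall>s\<in>A. \<exists>!x. x \<in> A \<and> f x = s"
  then show "inj_on f A" using assms(2) unfolding inj_on_def by (metis image_subset_iff)
next
  assume inj: "inj_on f A"
  then have "f ` A = A" using endo_inj_surj assms by blast
  then show "\<forall>s\<in>A. \<exists>!x. x \<in> A \<and> f x = s" using inj by (metis imageE inj_onD)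
qed

lemma ball_comm: "(\<forall>x\<in>A. \<forall>y\<in>B. P x y) \<longleftrightarrow> (\<forall>y\<in>B. \<forall>x\<in>A. P x y)" by blast

lemma latin_rects_full: "latin_rects n {1..n} = latin_squares n"
proof -
  have "(\<forall>s\<in>{1..n}. \<forall>i\<in>{1..n}. \<exists>!x. x \<in> {1..n} \<and> L (i, x) = s) \<longleftrightarrow>
        (\<forall>i\<in>{1..n}. inj_on (\<lambda>x. L (i, x)) {1..n})"
    "(\<forall>s\<in>{1..n}. \<forall>x\<in>{1..n}. \<exists>!i. i \<in> {1..n} \<and> L (i, x) = s) \<longleftrightarrow>
        (\<forall>x\<in>{1..n}. inj_on (\<lambda>i. L (i, x)) {1..n})"
    if L: "L \<in> {1..n} \<times> {1..n} \<rightarrow>\<^sub>E {1..n}" for L :: "nat \<times> nat \<Rightarrow> nat"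
  proof -
    have row_col: "(\<forall>s\<in>{1..n}. \<exists>!x. x \<in> {1..n} \<and> L (i, x) = s) \<longleftrightarrow> inj_on (\<lambda>x. L (i, x)) {1..n}"
      "(\<forall>s\<in>{1..n}. \<exists>!x. x \<in> {1..n} \<and> L (x, i) = s) \<longleftrightarrow> inj_on (\<lambda>x. L (x, i)) {1..n}"
      if i: "i \<in> {1..n}" for i
    proof -
      have I: "(\<lambda>x. L (i, x)) ` {1..n} \<subseteq> {1..n}" "(\<lambda>x. L (x, i)) ` {1..n} \<subseteq> {1..n}"
        by (intro image_subsetI PiE_mem[OF L] SigmaI i, assumption)+
      show "(\<forall>s\<in>{1..n}. \<exists>!x. x \<in> {1..n} \<and> L (i, x) = s) \<longleftrightarrow> inj_on (\<lambda>x. L (i, x)) {1..n}"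
      "(\<forall>s\<in>{1..n}. \<exists>!x. x \<in> {1..n} \<and> L (x, i) = s) \<longleftrightarrow> inj_on (\<lambda>x. L (x, i)) {1..n}"
        by (rule ex1_iff_inj_on[OF finite_atLeastAtMost I(1)] ex1_iff_inj_on[OF finite_atLeastAtMost I(2)])+
    qed
    show "(\<forall>s\<in>{1..n}. \<forall>i\<in>{1..n}. \<exists>!x. x \<in> {1..n} \<and> L (i, x) = s) \<longleftrightarrow>
        (\<forall>i\<in>{1..n}. inj_on (\<lambda>x. L (i, x)) {1..n})"
      by (subst ball_comm) (rule ball_cong[OF refl row_col(1)])
    show "(\<forall>s\<in>{1..n}. \<forall>x\<in>{1..n}. \<exists>!i. i \<in> {1..n} \<and> L (i, x) = s) \<longleftrightarrow>
        (\<forall>x\<in>{1..n}. inj_on (\<lambda>i. L (i, x)) {1..n})"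
      by (subst ball_comm) (rule ball_cong[OF refl row_col(2)])
  qed
  note eqs = this
  show ?thesis
    unfolding latin_rects_def latin_squares_def
    by (rule Collect_cong, rule conj_cong[OF refl], rule arg_cong2[where f = conj];
        (rule eqs[symmetric], assumption))
qed

lemma latin_rects_values:
  assumes "F \<in> latin_rects n R" "i \<in> R" "x \<in> {1..n}"
  shows "F (i, x) \<in> {1..n}"
  using assms PiE_mem[of F "R \<times> {1..n}" "\<lambda>_. {1..n}" "(i, x)"] unfolding latin_rects_def by blast

text \<open>Regularity of the graph of columns against available symbols. On the symbol side, the
  cells \<open>Z\<close> carrying \<open>s\<close> project bijectively to the rows in
  \<open>R\<close> and injectively to the columns, so \<open>s\<close> is used up in exactly
  \<open>card R\<close> columns.\<close>

lemma card_avail: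
  assumes F: "F \<in> latin_rects n R" and R: "R \<subseteq> {1..n}"
  shows "x \<in> {1..n} \<Longrightarrow> card (avail n R F x) = n - card R"
    and "s \<in> {1..n} \<Longrightarrow> card {x \<in> {1..n}. s \<in> avail n R F x} = n - card R"
proof -
  have fR: "finite R" using R finite_subset by blast
  have row: "inj_on (\<lambda>x. F (i, x)) {1..n}" if "i \<in> R" for i
    using F that by (simp add: latin_rects_def)
  have col: "inj_on (\<lambda>i. F (i, x)) R" if "x \<in> {1..n}" for x
    using F that by (simp add: latin_rects_def)
  show "card (avail n R F x) = n - card R" if x: "x \<in> {1..n}" for x
  proof -
    have "(\<lambda>i. F (i, x)) ` R \<subseteq> {1..n}" using latin_rects_values[OF F] x by blast
    then show ?thesis
      unfolding avail_def using fR card_image[OF col[OF x]] by (simp add: card_Diff_subset)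
  qed
  show "card {x \<in> {1..n}. s \<in> avail n R F x} = n - card R" if s: "s \<in> {1..n}" for s
  proof -
    define Z where "Z = {p. fst p \<in> R \<and> snd p \<in> {1..n} \<and> F p = s}"
    have "inj_on fst Z"
    proof (rule inj_onI)
      fix p q assume pq: "p \<in> Z" "q \<in> Z" "fst p = fst q"
      then have "snd p = snd q"
        using inj_onD[OF row[of "fst p"], of "snd p" "snd q"] unfolding Z_def
        by (metis (mono_tags, lifting) mem_Collect_eq prod.collapse)
      then show "p = q" using pq(3) by (simp add: prod_eq_iff)
    qed
    moreover have "fst ` Z = R"
    proof
      show "R \<subseteq> fst ` Z"
      proof
        fix i assume i: "i \<in> R"
        have "(\<lambda>x. F (i, x)) ` {1..n} = {1..n}"
          using row[OF i] latin_rects_values[OF F i] by (intro endo_inj_surj) auto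
        then obtain x where "x \<in> {1..n}" "F (i, x) = s" using s by (metis imageE)
        then have "(i, x) \<in> Z" using i by (simp add: Z_def)
        then show "i \<in> fst ` Z" by (rule image_eqI[rotated]) simp
      qed
    qed (auto simp: Z_def)
    ultimately have cZ: "card Z = card R" using card_image by metis
    have "inj_on snd Z"
    proof (rule inj_onI)
      fix p q assume pq: "p \<in> Z" "q \<in> Z" "snd p = snd q"
      then have "fst p = fst q"
        using inj_onD[OF col[of "snd p"], of "fst p" "fst q"] unfolding Z_def
        by (metis (mono_tags, lifting) mem_Collect_eq prod.collapse)
      then show "p = q" using pq(3) by (simp add: prod_eq_iff)
    qed
    moreover have "snd ` Z = {x \<in> {1..n}. s \<in> (\<lambda>i. F (i, x)) ` R}" unfolding Z_def by force
    ultimately have "card {x \<in> {1..n}. s \<in> (\<lambda>i. F (i, x)) ` R} = card R" using cZ card_image by metis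
    moreover have "{x \<in> {1..n}. s \<in> avail n R F x} = {1..n} - {x \<in> {1..n}. s \<in> (\<lambda>i. F (i, x)) ` R}"
      using s unfolding avail_def by blast
    moreover have "card ({1..n} - {x \<in> {1..n}. s \<in> (\<lambda>i. F (i, x)) ` R}) =
        card {1..n} - card {x \<in> {1..n}. s \<in> (\<lambda>i. F (i, x)) ` R}"
      by (rule card_Diff_subset) auto
    ultimately show ?thesis by (simp only: card_atLeastAtMost diff_Suc_1)
  qed
qed

abbreviation row_extensions ::
  "nat \<Rightarrow> nat set \<Rightarrow> (nat \<times> nat \<Rightarrow> nat) \<Rightarrow> (nat \<times> nat) set \<Rightarrow> (nat \<Rightarrow> nat) set" where
  "row_extensions n R F Q \<equiv> {f \<in> matchings (avail n R F) {1..n} {1..n}. \<forall>(x, a)\<in>Q. f x = a}"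

lemma card_rects_with_insert:
  assumes R: "R \<subseteq> {1..n}" and i: "i \<in> {1..n}" "i \<notin> R"
    and P: "P \<subseteq> ({1..n} \<times> {1..n}) \<times> {1..n}"
  shows "card (rects_with n (insert i R) P) = (\<Sum>F\<in>rects_with n R P.
     card (row_extensions n R F (row_part P i)))"
proof -
  define E where "E F = (row_extensions n R F (row_part P i))" for F
  define \<phi> where "\<phi> = (\<lambda>(F, f) (p :: nat \<times> nat). if fst p = i then f (snd p) else F p :: nat)"
  define \<psi> where "\<psi> = (\<lambda>G :: nat \<times> nat \<Rightarrow> nat. (restrict G (R \<times> {1..n}), restrict (\<lambda>x. G (i, x)) {1..n}))"
  have "bij_betw \<phi> (SIGMA F:rects_with n R P. E F) (rects_with n (insert i R) P)"
  proof (rule bij_betw_byWitness[where f' = \<psi>])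
    show "\<forall>z\<in>SIGMA F:rects_with n R P. E F. \<psi> (\<phi> z) = z"
    proof (safe)
      fix F f assume F: "F \<in> rects_with n R P" and f: "f \<in> E F"
      have "F \<in> extensional (R \<times> {1..n})" "f \<in> extensional {1..n}"
        using F f by (auto simp: rects_with_def latin_rects_def E_def matchings_def PiE_def)
      moreover have "restrict (\<phi> (F, f)) (R \<times> {1..n}) p = F p" if "p \<in> R \<times> {1..n}" for p
        using that i by (cases p) (auto simp: \<phi>_def)
      moreover have "restrict (\<lambda>x. \<phi> (F, f) (i, x)) {1..n} x = f x" if "x \<in> {1..n}" for x
        using that by (simp add: \<phi>_def)
      ultimately have "restrict (\<phi> (F, f)) (R \<times> {1..n}) = F" "restrict (\<lambda>x. \<phi> (F, f) (i, x)) {1..n} = f"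
        by (meson extensionalityI restrict_extensional)+
      then show "\<psi> (\<phi> (F, f)) = (F, f)" unfolding \<psi>_def by blast
    qed
    show "\<forall>G\<in>rects_with n (insert i R) P. \<phi> (\<psi> G) = G"
    proof
      fix G assume "G \<in> rects_with n (insert i R) P"
      then have "G \<in> extensional (insert i R \<times> {1..n})"
        by (auto simp: rects_with_def latin_rects_def PiE_def)
      moreover have "\<phi> (\<psi> G) \<in> extensional (insert i R \<times> {1..n})"
        unfolding extensional_def \<phi>_def \<psi>_def by simp
      moreover have "\<phi> (\<psi> G) p = G p" if "p \<in> insert i R \<times> {1..n}" for p
        using that by (cases p) (auto simp: \<phi>_def \<psi>_def)
      ultimately show "\<phi> (\<psi> G) = G" by (meson extensionalityI)
    qed
    show "\<phi> ` (SIGMA F:rects_with n R P. E F) \<subseteq> rects_with n (insert i R) P"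
    proof safe
      fix F f assume F: "F \<in> rects_with n R P" and f: "f \<in> E F"
      have F': "F \<in> R \<times> {1..n} \<rightarrow>\<^sub>E {1..n}" "\<And>i. i \<in> R \<Longrightarrow> inj_on (\<lambda>x. F (i, x)) {1..n}"
        "\<And>x. x \<in> {1..n} \<Longrightarrow> inj_on (\<lambda>i. F (i, x)) R"
        "\<And>p a. (p, a) \<in> P \<Longrightarrow> fst p \<in> R \<Longrightarrow> F p = a"
        using F by (auto simp: rects_with_def latin_rects_def)
      have f': "f \<in> {1..n} \<rightarrow>\<^sub>E {1..n}" "inj_on f {1..n}" "\<And>x. x \<in> {1..n} \<Longrightarrow> f x \<in> avail n R F x"
        "\<And>x a. ((i, x), a) \<in> P \<Longrightarrow> f x = a"
        using f by (auto simp: E_def matchings_def row_part_def)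
      have "\<phi> (F, f) \<in> insert i R \<times> {1..n} \<rightarrow>\<^sub>E {1..n}"
        using F'(1) f'(1) i by (auto simp: \<phi>_def PiE_iff extensional_def)
      moreover have "inj_on (\<lambda>x. \<phi> (F, f) (i', x)) {1..n}" if "i' \<in> insert i R" for i'
        using that F'(2) f'(2) by (cases "i' = i") (auto simp: \<phi>_def)
      moreover have "inj_on (\<lambda>i'. \<phi> (F, f) (i', x)) (insert i R)" if x: "x \<in> {1..n}" for x
      proof -
        have "inj_on (\<lambda>i'. \<phi> (F, f) (i', x)) R"
          using F'(3)[OF x] i by (auto simp: \<phi>_def inj_on_def)
        moreover have "f x \<notin> (\<lambda>i'. F (i', x)) ` R" using f'(3)[OF x] by (simp add: avail_def)
        ultimately show ?thesis using i by (auto simp: \<phi>_def image_iff)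
      qed
      moreover have "\<phi> (F, f) p = a" if "(p, a) \<in> P" "fst p \<in> insert i R" for p a
        using that F'(4) f'(4) i by (cases p) (auto simp: \<phi>_def)
      ultimately show "\<phi> (F, f) \<in> rects_with n (insert i R) P"
        unfolding rects_with_def latin_rects_def by blast
    qed
    show "\<psi> ` rects_with n (insert i R) P \<subseteq> (SIGMA F:rects_with n R P. E F)"
    proof (rule image_subsetI)
      fix G assume G: "G \<in> rects_with n (insert i R) P"
      have G': "G \<in> insert i R \<times> {1..n} \<rightarrow>\<^sub>E {1..n}" "\<And>i'. i' \<in> insert i R \<Longrightarrow> inj_on (\<lambda>x. G (i', x)) {1..n}"
        "\<And>x. x \<in> {1..n} \<Longrightarrow> inj_on (\<lambda>i. G (i, x)) (insert i R)"
        "\<And>p a. (p, a) \<in> P \<Longrightarrow> fst p \<in> insert i R \<Longrightarrow> G p = a"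
        using G by (auto simp: rects_with_def latin_rects_def)
      have PG: "x \<in> {1..n} \<Longrightarrow> i' \<in> insert i R \<Longrightarrow> G (i', x) \<in> {1..n}" for i' x
        using PiE_mem[OF G'(1)] by blast
      define F where "F = restrict G (R \<times> {1..n})"
      define f where "f = restrict (\<lambda>x. G (i, x)) {1..n}"
      have FG: "F (i', x) = G (i', x)" if "i' \<in> R" "x \<in> {1..n}" for i' x
        using that by (simp add: F_def)
      have fG: "f x = G (i, x)" if "x \<in> {1..n}" for x using that by (simp add: f_def)
      have "F \<in> R \<times> {1..n} \<rightarrow>\<^sub>E {1..n}"
        unfolding F_def restrict_PiE_iff using PG by blast
      moreover have "inj_on (\<lambda>x. F (i', x)) {1..n}" if "i' \<in> R" for i'
        using inj_on_cong[of "{1..n}" "\<lambda>x. F (i', x)" "\<lambda>x. G (i', x)"] FG[OF that] G'(2)[of i'] that by blast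
      moreover have "inj_on (\<lambda>i. F (i, x)) R" if "x \<in> {1..n}" for x
        using inj_on_cong[of R "\<lambda>i. F (i, x)" "\<lambda>i. G (i, x)"] FG[OF _ that]
          inj_on_subset[OF G'(3)[OF that], of R] by blast
      moreover have "F p = a" if "(p, a) \<in> P" "fst p \<in> R" for p a
        using G'(4)[of p a] that FG[of "fst p" "snd p"] P by auto
      ultimately have "F \<in> rects_with n R P"
        unfolding rects_with_def latin_rects_def by blast
      moreover have "f \<in> E F"
      proof -
        have "f \<in> {1..n} \<rightarrow>\<^sub>E {1..n}"
          unfolding f_def restrict_PiE_iff using PG by blast
        moreover have "inj_on f {1..n}" using inj_on_cong[of "{1..n}" f "\<lambda>x. G (i, x)"] G'(2)[of i] fG by blast
        moreover have "f x \<in> avail n R F x" if x: "x \<in> {1..n}" for x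
        proof -
          have "G (i, x) \<noteq> G (i', x)" if "i' \<in> R" for i'
            using inj_onD[OF G'(3)[OF x], of i i'] i that by auto
          then show ?thesis using PG[OF x, of i] x FG fG by (auto simp: avail_def)
        qed
        moreover have "f x = a" if "(x, a) \<in> row_part P i" for x a
        proof -
          have "((i, x), a) \<in> P" using that by (simp add: row_part_def)
          then show ?thesis using G'(4)[of "(i, x)" a] fG[of x] P by auto
        qed
        ultimately show ?thesis unfolding E_def matchings_def by blast
      qed
      ultimately show "\<psi> G \<in> (SIGMA F:rects_with n R P. E F)"
        by (simp add: \<psi>_def F_def f_def)
    qed
  qed
  then have card_eq: "card (rects_with n (insert i R) P) = card (SIGMA F:rects_with n R P. E F)"
    by (metis bij_betw_same_card)
  moreover have "finite (rects_with n R P)"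
    using R finite_subset[OF R] unfolding rects_with_def latin_rects_def
    by (intro finite_subset[OF _ finite_PiE[of "R \<times> {1..n}" "\<lambda>_. {1..n}"]]) auto
  moreover have "finite (E F)" for F
    unfolding E_def using finite_matchings[of "{1..n}" "{1..n}"] by simp
  ultimately have "card (rects_with n (insert i R) P) = (\<Sum>F\<in>rects_with n R P. card (E F))" by simp
  then show ?thesis unfolding E_def .
qed

section \<open>The cost of prescribed entries, row by row\<close>

text \<open>The van der Waerden count for a row following \<open>j\<close> rows is \<open>base_count n j\<close>, and \<open>err_factor n j\<close> is the loss in Bregman's inequality, which is polynomial in \<open>n\<close> while \<open>n - j\<close> is of order \<open>n\<close>. Fixing \<open>t\<close> entries of the row costs a factor of about \<open>n ^ - t\<close>, up to \<open>exp (t\<^sup>2 / n)\<close>, or up to \<open>exp t\<close> if \<open>t\<close> is large; the piecewise linear \<open>row_weight\<close> dominates both exponents and has small slope for short rows.\<close>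

definition base_count :: "nat \<Rightarrow> nat \<Rightarrow> real" where
  "base_count n j = exp (real n * (ln (real (n - j)) - 1))"

definition err_factor :: "nat \<Rightarrow> nat \<Rightarrow> real" where
  "err_factor n j = exp (real n * (1 + ln (real (n - j))) / real (n - j) + 2 * (1 + ln (real n)))"

definition row_weight :: "nat \<Rightarrow> real \<Rightarrow> nat \<Rightarrow> real" where
  "row_weight n \<epsilon> t = 2 * \<epsilon> * real t + 2 * max 0 (real t - \<epsilon> * real n)"

lemma le_exp_of_ln_le:
  fixes x y :: real
  assumes "0 < x" "ln x \<le> y"
  shows "x \<le> exp y"
  using exp_le_cancel_iff[of "ln x" y] assms by simp

lemma card_row_extensions_le:
  assumes F: "F \<in> latin_rects n R" and R: "R \<subseteq> {1..n}" "card R < n"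
    and Q: "Q \<subseteq> {1..n} \<times> {1..n}"
  defines "E \<equiv> (row_extensions n R F Q)"
  shows "Q = {} \<Longrightarrow> real (card E) \<le> base_count n (card R) * err_factor n (card R)"
    and "0 < \<epsilon> \<Longrightarrow> \<epsilon> \<le> 1 / 8 \<Longrightarrow> real (card R) \<le> \<epsilon> * real n \<Longrightarrow>
      real (card E) \<le> base_count n (card R) * err_factor n (card R) *
        ((1 / ((1 - \<epsilon>) * real n)) ^ card Q * exp (row_weight n \<epsilon> (card Q)))"
proof -
  define r where "r = n - card R"
  define t where "t = card Q"
  have r: "0 < r" "r \<le> n" using R by (auto simp: r_def)
  have n: "0 < n" using R by simp
  have Esub: "E = {} \<or> (E \<noteq> {} \<and> 0 < real (card E))"
    using finite_matchings[of "{1..n}" "{1..n}" "avail n R F"] by (auto simp: E_def card_gt_0_iff)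
  have row: "avail n R F c \<subseteq> {1..n} \<and> card (avail n R F c) = r" if "c \<in> {1..n}" for c
    using card_avail(1)[OF F R(1) that] by (auto simp: avail_def r_def)
  have col: "card {c \<in> {1..n}. s \<in> avail n R F c} = r" if "s \<in> {1..n}" for s
    using card_avail(2)[OF F R(1) that] by (simp add: r_def)
  note upper = regular_matchings_upper[OF _ _ _ _ n r(1) row col Q t_def[symmetric] E_def[THEN meta_eq_to_obj_eq], simplified]
  have crude: "E \<noteq> {} \<Longrightarrow> ln (real (card E)) \<le> real n * (ln (real r) - 1) - real t * ln (real r) + real t
           + real n * (1 + ln (real r)) / real r"
    using upper(1) by simp
  have fine: "E \<noteq> {} \<Longrightarrow> n \<le> 2 * (r - t) \<Longrightarrow> ln (real (card E)) \<le> real n * (ln (real r) - 1) - real t * ln (real r)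
           + (real t)\<^sup>2 / real r + 2 * (1 + ln (real n))"
    using upper(2) by simp
  have ln0: "0 \<le> ln (real n)" "0 \<le> ln (real r)" using n r by auto
  show "real (card E) \<le> base_count n (card R) * err_factor n (card R)" if "Q = {}"
  proof (cases "E = {}")
    case False
    have "ln (real (card E)) \<le> real n * (ln (real r) - 1) + (real n * (1 + ln (real r)) / real r + 2 * (1 + ln (real n)))"
      using crude[OF False] that ln0 by (simp add: t_def)
    then have "real (card E) \<le> exp (real n * (ln (real r) - 1) + (real n * (1 + ln (real r)) / real r + 2 * (1 + ln (real n))))"
      using Esub False by (intro le_exp_of_ln_le) blast+
    then show ?thesis by (simp add: base_count_def err_factor_def r_def exp_add)
  next
    case True
    have "0 \<le> base_count n (card R) * err_factor n (card R)"
      unfolding base_count_def err_factor_def by (intro mult_nonneg_nonneg exp_ge_zero)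
    then show ?thesis unfolding True by (simp only: card.empty of_nat_0)
  qed
  show "real (card E) \<le> base_count n (card R) * err_factor n (card R) *
        ((1 / ((1 - \<epsilon>) * real n)) ^ card Q * exp (row_weight n \<epsilon> (card Q)))"
    if \<epsilon>: "0 < \<epsilon>" "\<epsilon> \<le> 1 / 8" and k: "real (card R) \<le> \<epsilon> * real n"
  proof (cases "E = {}")
    case False
    have rr: "(1 - \<epsilon>) * real n \<le> real r" using k R by (simp add: r_def of_nat_diff algebra_simps)
    have "\<epsilon> * real n \<le> 1 / 8 * real n" using \<epsilon> by (intro mult_right_mono) auto
    then have en: "\<epsilon> * real n \<le> real n / 8" by simp
    have rn: "7 / 8 * real n \<le> real r" using rr en by (simp add: algebra_simps)
    define e where "e = real n * (1 + ln (real r)) / real r + 2 * (1 + ln (real n))"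
    define w where "w = row_weight n \<epsilon> t"
    define u v X where "u = real n * (ln (real r) - 1)" and "v = real t * ln (real r)"
      and "X = real n * (1 + ln (real r)) / real r"
    have e: "e = X + 2 * (1 + ln (real n))" by (simp add: e_def X_def)
    have X: "0 \<le> X" using ln0 by (simp add: X_def)
    have "ln (real (card E)) \<le> u - v + w + e"
    \<comment> \<open>Up to \<open>n / 4\<close> the finer bound applies because \<open>r\<close> is
      at least \<open>7 / 8 * n\<close>. Beyond it
      \<open>\<epsilon> * n \<le> n / 8 < t / 2\<close>, so the second part of
      \<open>row_weight\<close> already exceeds \<open>t\<close> and the crude bound
      suffices.\<close>
    proof (cases "real t \<le> real n / 4")
      case True
      have n': "0 < real n" using n by simp
      have "t \<le> r" using True rn n' by linarith
      moreover have "real n \<le> 2 * (real r - real t)" using True rn n' by argo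
      ultimately have "real n \<le> real (2 * (r - t))" by (simp add: of_nat_diff)
      then have half: "n \<le> 2 * (r - t)" by linarith
      have "(real t)\<^sup>2 / real r \<le> (real t)\<^sup>2 / (real n / 2)"
        using rn n by (intro divide_left_mono) (auto intro!: mult_pos_pos)
      also have "\<dots> = 2 * real t * (real t / real n)" by (simp add: power2_eq_square)
      also have "\<dots> \<le> w"
      proof (cases "real t \<le> \<epsilon> * real n")
        case True
        then have "real t / real n \<le> \<epsilon>" using n by (simp add: field_simps)
        then have "2 * real t * (real t / real n) \<le> 2 * real t * \<epsilon>" by (intro mult_left_mono) auto
        then show ?thesis using True by (simp add: w_def row_weight_def mult_ac)
      next
        case False
        have "2 * real t * (real t / real n) = 2 * \<epsilon> * real t + 2 * (real t / real n) * (real t - \<epsilon> * real n)"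
          using n by (simp add: field_simps)
        also have "2 * (real t / real n) * (real t - \<epsilon> * real n) \<le> 2 * 1 * (real t - \<epsilon> * real n)"
          using \<open>real t \<le> real n / 4\<close> False n by (intro mult_right_mono mult_left_mono) (auto simp: field_simps)
        finally show ?thesis using False by (simp add: w_def row_weight_def max_def)
      qed
      finally have "(real t)\<^sup>2 / real r \<le> w" .
      then show ?thesis using fine[OF False half, folded u_def v_def] X unfolding e by linarith
    next
      case False
      have "0 \<le> 2 * \<epsilon> * real t" "real t - \<epsilon> * real n \<le> max 0 (real t - \<epsilon> * real n)" using \<epsilon> by auto
      moreover define a m b where "a = 2 * \<epsilon> * real t" and "m = max 0 (real t - \<epsilon> * real n)" and "b = \<epsilon> * real n"
      ultimately have "real t \<le> a + 2 * m" using False en by linarith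
      then have "real t \<le> w" unfolding w_def row_weight_def a_def m_def .
      then show ?thesis using crude[OF \<open>E \<noteq> {}\<close>, folded u_def v_def X_def] ln0 unfolding e by argo
    qed
    moreover have "real t * ln ((1 - \<epsilon>) * real n) \<le> v"
      unfolding v_def using rr \<epsilon> n by (intro mult_left_mono ln_mono) (auto intro!: mult_pos_pos)
    ultimately have "ln (real (card E)) \<le> u + - (real t * ln ((1 - \<epsilon>) * real n)) + w + e"
      by linarith
    then have "real (card E) \<le> exp (u + - (real t * ln ((1 - \<epsilon>) * real n)) + w + e)"
      using Esub False by (intro le_exp_of_ln_le) blast+
    also have "\<dots> = exp u * exp e * (exp (- (real t * ln ((1 - \<epsilon>) * real n))) * exp w)"
      by (simp only: exp_add mult_ac)
    also have "exp (- (real t * ln ((1 - \<epsilon>) * real n))) = (1 / ((1 - \<epsilon>) * real n)) ^ t"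
    proof -
      have "exp (- (real t * ln ((1 - \<epsilon>) * real n))) = 1 / exp (ln ((1 - \<epsilon>) * real n)) ^ t"
        by (simp only: exp_minus exp_of_nat_mult inverse_eq_divide)
      also have "exp (ln ((1 - \<epsilon>) * real n)) = (1 - \<epsilon>) * real n" using \<epsilon> n by (intro exp_ln mult_pos_pos) auto
      finally show ?thesis by (simp add: power_one_over)
    qed
    finally have "real (card E) \<le> exp u * exp e * ((1 / ((1 - \<epsilon>) * real n)) ^ t * exp w)" .
    moreover have "exp u = base_count n (card R)" by (simp add: u_def base_count_def r_def)
    moreover have "exp e = err_factor n (card R)" by (simp add: e_def err_factor_def r_def)
    ultimately show ?thesis by (simp only: t_def w_def)
  next
    case True
    have "0 \<le> (1 / ((1 - \<epsilon>) * real n)) ^ card Q"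
      using \<epsilon> by (intro zero_le_power divide_nonneg_nonneg mult_nonneg_nonneg) auto
    then have "0 \<le> base_count n (card R) * err_factor n (card R) *
        ((1 / ((1 - \<epsilon>) * real n)) ^ card Q * exp (row_weight n \<epsilon> (card Q)))"
      unfolding base_count_def err_factor_def by (intro mult_nonneg_nonneg exp_ge_zero)
    then show ?thesis unfolding True by (simp only: card.empty of_nat_0)
  qed
qed

definition total_err :: "nat \<Rightarrow> real" where
  "total_err n = (\<Prod>j<n. err_factor n j)"

text \<open>Up to the factor \<open>total_err n\<close>, an upper bound for the probability that a
  random square contains \<open>P\<close>, a set of entries in the rows \<open>S\<close>.\<close>

definition entry_weight :: "nat \<Rightarrow> real \<Rightarrow> nat set \<Rightarrow> ((nat \<times> nat) \<times> nat) set \<Rightarrow> real" where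
  "entry_weight n \<epsilon> S P = (1 / ((1 - \<epsilon>) * real n)) ^ card P *
     exp (\<Sum>i\<in>S. row_weight n \<epsilon> (card (row_part P i)))"

lemma latin_rects_empty: "latin_rects n {} = {\<lambda>_. undefined}"
  by (auto simp: latin_rects_def)

lemma base_count_eq: "j < n \<Longrightarrow> base_count n j = (real (n - j) / exp 1) ^ n"
  by (simp add: base_count_def exp_of_nat_mult exp_diff power_divide)

lemma rects_with_subset: "rects_with n R P \<subseteq> latin_rects n R"
  by (auto simp: rects_with_def)

lemma total_err_nonneg: "0 \<le> total_err n"
  unfolding total_err_def err_factor_def by (intro prod_nonneg) auto

text \<open>The lower bound for one row depends only on the regularity, hence is the same for all
  rectangles and can be multiplied. For all \<open>n\<close> rows this is the denominator of every
  probability.\<close>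

lemma card_latin_rects_ge:
  assumes "R \<subseteq> {1..n}"
  shows "(\<Prod>j<card R. base_count n j) \<le> real (card (latin_rects n R))"
proof -
  have "finite R" using assms finite_subset by blast
  then show ?thesis using assms
  proof (induction R)
    case empty
    then show ?case by (simp add: latin_rects_empty)
  next
    case (insert i R)
    have R: "R \<subseteq> {1..n}" and i: "i \<in> {1..n}" "i \<notin> R" using insert by auto
    have "card R < card {1..n}"
      by (rule psubset_card_mono) (use R i in auto)
    then have cR: "card R < n" by simp
    have eq: "latin_rects n R' = rects_with n R' {}" for R' by (simp add: rects_with_def)
    have row: "base_count n (card R) \<le> real (card (row_extensions n R F (row_part {} i)))"
      if F: "F \<in> latin_rects n R" for F
    proof -
      have "(real (n - card R) / exp 1) ^ card {1..n} \<le> real (card (matchings (avail n R F) {1..n} {1..n}))"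
      proof (rule regular_matchings_lower)
        show "avail n R F c \<subseteq> {1..n} \<and> card (avail n R F c) = n - card R" if "c \<in> {1..n}" for c
          using card_avail(1)[OF F R that] by (auto simp: avail_def)
        show "card {c \<in> {1..n}. s \<in> avail n R F c} = n - card R" if "s \<in> {1..n}" for s
          using card_avail(2)[OF F R that] .
      qed (use cR in auto)
      then show ?thesis using cR by (simp add: base_count_eq row_part_def)
    qed
    have "(\<Prod>j<card (insert i R). base_count n j) = (\<Prod>j<card R. base_count n j) * base_count n (card R)"
      using insert by simp
    also have "\<dots> \<le> real (card (latin_rects n R)) * base_count n (card R)"
      using insert R by (intro mult_right_mono) (auto simp: base_count_def)
    also have "\<dots> = (\<Sum>F\<in>latin_rects n R. base_count n (card R))" by simp
    also have "\<dots> \<le> (\<Sum>F\<in>latin_rects n R. real (card (row_extensions n R F (row_part {} i))))"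
      by (intro sum_mono row)
    also have "\<dots> = real (card (latin_rects n (insert i R)))"
      unfolding eq card_rects_with_insert[OF R i empty_subsetI] by simp
    finally show ?case .
  qed
qed

type_synonym cell_entry = "(nat \<times> nat) \<times> nat"

abbreviation entry_space :: "nat \<Rightarrow> nat set \<Rightarrow> cell_entry set" where
  "entry_space n S \<equiv> (S \<times> {1..n}) \<times> {1..n}"

lemma card_rects_with_step:
  assumes R: "R \<subseteq> {1..n}" and i: "i \<in> {1..n}" "i \<notin> R"
    and P: "P \<subseteq> entry_space n {1..n}"
    and IH: "real (card (rects_with n R P)) \<le> B"
    and row: "\<And>F. F \<in> latin_rects n R \<Longrightarrow>
      real (card (row_extensions n R F (row_part P i))) \<le> u"
    and u: "0 \<le> u"
  shows "real (card (rects_with n (insert i R) P)) \<le> B * u"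
proof -
  have "real (card (rects_with n (insert i R) P)) = (\<Sum>F\<in>rects_with n R P.
     real (card (row_extensions n R F (row_part P i))))"
    unfolding card_rects_with_insert[OF R i P] by simp
  also have "\<dots> \<le> (\<Sum>F\<in>rects_with n R P. u)"
    using rects_with_subset by (intro sum_mono row) blast
  also have "\<dots> \<le> B * u" using mult_right_mono[OF IH u] by simp
  finally show ?thesis .
qed

lemma row_part_subset: "P \<subseteq> (S \<times> B) \<times> C \<Longrightarrow> row_part P i \<subseteq> B \<times> C"
  by (auto simp: row_part_def)

lemma sum_card_row_part:
  assumes "finite S" "finite P" "P \<subseteq> (S \<times> B) \<times> C"
  shows "(\<Sum>i\<in>S. card (row_part P i)) = card P"
proof -
  have "bij_betw (\<lambda>(i, x, a). ((i, x), a)) (SIGMA i:S. row_part P i) P"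
    by (rule bij_betw_byWitness[where f' = "\<lambda>((i, x), a). (i, x, a)"])
       (use assms(3) in \<open>auto simp: row_part_def\<close>)
  then have "card (SIGMA i:S. row_part P i) = card P" by (rule bij_betw_same_card)
  moreover have "finite (row_part P i)" for i
  proof -
    have "row_part P i \<subseteq> (\<lambda>((i, x), a). (x, a)) ` P" by (force simp: row_part_def)
    then show ?thesis using assms(2) finite_surj by blast
  qed
  ultimately show ?thesis using assms(1) by simp
qed

text \<open>While the rows of \<open>S\<close> are exposed first, each column still has at least
  \<open>(1 - \<epsilon>) * n\<close> available symbols. The later rows contain nothing prescribed
  and contribute only their error factors. The base counts cancel against the lower bound for the
  number of all squares.\<close>

theorem card_latin_squares_with_le:
  assumes n: "0 < n" and \<epsilon>: "0 < \<epsilon>" "\<epsilon> \<le> 1 / 8"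
    and S: "S \<subseteq> {1..n}" "real (card S) \<le> \<epsilon> * real n"
    and P: "P \<subseteq> entry_space n S"
  shows "real (card {L \<in> latin_squares n. \<forall>(p, a)\<in>P. L p = a}) \<le>
    real (card (latin_squares n)) * (total_err n * entry_weight n \<epsilon> S P)"
proof -
  define q where "q = 1 / ((1 - \<epsilon>) * real n)"
  define g where "g i = q ^ card (row_part P i) * exp (row_weight n \<epsilon> (card (row_part P i)))" for i
  define B where "B j = base_count n j * err_factor n j" for j
  have q: "0 \<le> q" using \<epsilon> by (simp add: q_def)
  have g: "0 \<le> g i" for i using q by (simp add: g_def)
  have B: "0 \<le> B j" for j by (simp add: B_def base_count_def err_factor_def)
  have fS: "finite S" using S finite_subset by blast
  have P': "P \<subseteq> entry_space n {1..n}" using P S by blast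
  have fP: "finite P" by (rule finite_subset[OF P']) auto
  note Q = row_part_subset[OF P]
  have phase1: "real (card (rects_with n R P)) \<le> (\<Prod>j<card R. B j) * (\<Prod>i\<in>R. g i)" if "R \<subseteq> S" for R
  proof -
    have "finite R" using fS that finite_subset by blast
    then show ?thesis using that
    proof (induction R)
      case empty
      have "rects_with n {} P \<subseteq> {\<lambda>_. undefined}"
        using rects_with_subset[of n "{}" P] by (simp only: latin_rects_empty)
      from card_mono[OF _ this] have "card (rects_with n {} P) \<le> 1" by simp
      then show ?case by simp
    next
      case (insert i R)
      have R: "R \<subseteq> {1..n}" and i: "i \<in> {1..n}" "i \<notin> R" using insert S by auto
      have "card R < card S"
        by (rule psubset_card_mono) (use insert fS in auto)
      then have cS: "real (card R) \<le> \<epsilon> * real n" using S by linarith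
      have "card R < card {1..n}"
        by (rule psubset_card_mono) (use R i in auto)
      then have cR: "card R < n" by simp
      have "real (card (rects_with n (insert i R) P)) \<le> (\<Prod>j<card R. B j) * (\<Prod>i\<in>R. g i) * (B (card R) * g i)"
      proof (rule card_rects_with_step[OF R i P'])
        show "real (card (rects_with n R P)) \<le> (\<Prod>j<card R. B j) * (\<Prod>i\<in>R. g i)"
          using insert by simp
        show "0 \<le> B (card R) * g i" using B g by simp
        show "real (card (row_extensions n R F (row_part P i)))
            \<le> B (card R) * g i" if F: "F \<in> latin_rects n R" for F
          using card_row_extensions_le(2)[OF F R cR Q \<epsilon> cS] unfolding B_def g_def q_def .
      qed
      then show ?case using insert by (simp add: mult_ac)
    qed
  qed
  have phase2: "real (card (rects_with n (S \<union> T) P)) \<le> (\<Prod>j<card (S \<union> T). B j) * (\<Prod>i\<in>S. g i)"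
    if "T \<subseteq> {1..n} - S" for T
  proof -
    have "finite T" using that finite_subset by blast
    then show ?thesis using that
    proof (induction T)
      case empty
      then show ?case using phase1[of S] by simp
    next
      case (insert i T)
      have R: "S \<union> T \<subseteq> {1..n}" and i: "i \<in> {1..n}" "i \<notin> S \<union> T" using insert S by auto
      have "card (S \<union> T) < card {1..n}"
        by (rule psubset_card_mono) (use R i in auto)
      then have cR: "card (S \<union> T) < n" by simp
      have "row_part P i = {}" using i P by (auto simp: row_part_def)
      then have "real (card (rects_with n (insert i (S \<union> T)) P)) \<le>
          (\<Prod>j<card (S \<union> T). B j) * (\<Prod>i\<in>S. g i) * B (card (S \<union> T))"
        using insert B card_row_extensions_le(1)[OF _ R cR Q]
        by (intro card_rects_with_step[OF R i P']) (simp_all add: B_def)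
      then show ?case using insert i fS by (simp add: mult_ac)
    qed
  qed
  have ST: "S \<union> ({1..n} - S) = {1..n}" using S by blast
  have "rects_with n {1..n} P = {L \<in> latin_squares n. \<forall>(p, a)\<in>P. L p = a}"
    unfolding rects_with_def latin_rects_full using P' by (intro Collect_cong conj_cong refl ball_cong) auto
  then have "real (card {L \<in> latin_squares n. \<forall>(p, a)\<in>P. L p = a}) \<le> (\<Prod>j<n. B j) * (\<Prod>i\<in>S. g i)"
    using phase2[of "{1..n} - S"] unfolding ST by simp
  also have "(\<Prod>j<n. B j) = (\<Prod>j<n. base_count n j) * total_err n"
    by (simp add: B_def total_err_def prod.distrib)
  also have "(\<Prod>i\<in>S. g i) = entry_weight n \<epsilon> S P"
    using sum_card_row_part[OF fS fP P]
    by (simp add: g_def entry_weight_def prod.distrib exp_sum fS q_def flip: power_sum)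
  also have "(\<Prod>j<n. base_count n j) * total_err n * entry_weight n \<epsilon> S P \<le>
      real (card (latin_squares n)) * total_err n * entry_weight n \<epsilon> S P"
  proof (intro mult_right_mono)
    show "(\<Prod>j<n. base_count n j) \<le> real (card (latin_squares n))"
      using card_latin_rects_ge[OF subset_refl] unfolding latin_rects_full by simp
    show "0 \<le> total_err n" by (rule total_err_nonneg)
    show "0 \<le> entry_weight n \<epsilon> S P"
      unfolding entry_weight_def q_def[symmetric] using q by simp
  qed
  finally show ?thesis by (simp only: mult.assoc)
qed

lemma sum_inverse_le_ln:
  assumes "0 < n"
  shows "(\<Sum>i<n. 1 / real (Suc i)) \<le> 1 + ln (real n)"
  using assms
proof (induction n)
  case (Suc n)
  show ?case
  proof (cases "n = 0")
    case False
    then show ?thesis using Suc.IH inverse_Suc_le_ln_diff[of n] by simp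
  qed simp
qed simp

text \<open>A row's error is about \<open>n * ln (n - j) / (n - j)\<close>, so the sum is harmonic.
  Even the last rows, where Bregman and van der Waerden are furthest apart, remain affordable
  against \<open>n powr (4/3) * ln n\<close>.\<close>

lemma total_err_le:
  assumes n: "0 < n"
  shows "total_err n \<le> exp (3 * real n * (1 + ln (real n))\<^sup>2)"
proof -
  define l where "l = ln (real n)"
  have l: "0 \<le> l" using n by (simp add: l_def)
  have "(\<Sum>j<n. real n * (1 + ln (real (n - j))) / real (n - j)) \<le> (\<Sum>j<n. real n * (1 + l) * (1 / real (n - j)))"
  proof (rule sum_mono)
    fix j assume j: "j \<in> {..<n}"
    have "ln (real (n - j)) \<le> l" unfolding l_def using j by (intro ln_mono) auto
    then have "real n * (1 + ln (real (n - j))) * (1 / real (n - j)) \<le> real n * (1 + l) * (1 / real (n - j))"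
      by (intro mult_right_mono mult_left_mono) auto
    then show "real n * (1 + ln (real (n - j))) / real (n - j) \<le> real n * (1 + l) * (1 / real (n - j))"
      by simp
  qed
  also have "\<dots> = real n * (1 + l) * (\<Sum>j<n. 1 / real (n - j))" by (rule sum_distrib_left[symmetric])
  also have "(\<Sum>j<n. 1 / real (n - j)) = (\<Sum>j<n. 1 / real (Suc (n - Suc j)))"
    by (intro sum.cong refl) (simp add: Suc_diff_Suc)
  also have "\<dots> = (\<Sum>i<n. 1 / real (Suc i))" by (rule sum.nat_diff_reindex)
  also have "real n * (1 + l) * \<dots> \<le> real n * (1 + l) * (1 + l)"
    using sum_inverse_le_ln[OF n] l unfolding l_def by (intro mult_left_mono) auto
  finally have "(\<Sum>j<n. real n * (1 + ln (real (n - j))) / real (n - j)) \<le> real n * (1 + l)\<^sup>2"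
    by (simp add: power2_eq_square mult_ac)
  moreover have "2 * (1 + l) * real n \<le> 2 * real n * (1 + l)\<^sup>2"
    using mult_left_mono[of 1 "1 + l" "2 * (1 + l) * real n"] l by (simp add: power2_eq_square mult_ac)
  ultimately have "(\<Sum>j<n. real n * (1 + ln (real (n - j))) / real (n - j)) + 2 * (1 + l) * real n \<le> 3 * real n * (1 + l)\<^sup>2"
    by argo
  moreover have "total_err n = exp ((\<Sum>j<n. real n * (1 + ln (real (n - j))) / real (n - j)) + 2 * (1 + l) * real n)"
    by (simp add: total_err_def err_factor_def exp_sum[symmetric] sum.distrib l_def mult_ac)
  ultimately show ?thesis by (simp add: l_def)
qed

text \<open>The two slopes of the piecewise linear \<open>row_weight\<close>:
  \<open>2 * \<epsilon>\<close> up to \<open>\<epsilon> * n\<close>, and at most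
  \<open>2 + 2 * \<epsilon> \<le> 3\<close> everywhere. They become the factors
  \<open>exp (2 * \<epsilon>)\<close> and \<open>exp 3\<close> per entry.\<close>

lemma row_weight_add_le:
  assumes "0 < \<epsilon>" "\<epsilon> \<le> 1 / 8"
  shows "row_weight n \<epsilon> (t + u) \<le> row_weight n \<epsilon> t + 3 * real u"
    and "real (t + u) \<le> \<epsilon> * real n \<Longrightarrow> row_weight n \<epsilon> (t + u) \<le> row_weight n \<epsilon> t + 2 * \<epsilon> * real u"
proof -
  have "\<epsilon> * real u \<le> 1 / 8 * real u" using assms by (intro mult_right_mono) auto
  then show "row_weight n \<epsilon> (t + u) \<le> row_weight n \<epsilon> t + 3 * real u"
    unfolding row_weight_def by (simp add: algebra_simps max_def)
  show "real (t + u) \<le> \<epsilon> * real n \<Longrightarrow> row_weight n \<epsilon> (t + u) \<le> row_weight n \<epsilon> t + 2 * \<epsilon> * real u"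
    unfolding row_weight_def by (simp add: algebra_simps max_def)
qed

text \<open>Here \<open>c\<close> bounds the slope of \<open>row_weight\<close> in every row that
  receives entries of \<open>D\<close>, so each new entry costs one factor \<open>exp c\<close>
  besides the power of \<open>n\<close>.\<close>

lemma entry_weight_Un_le:
  assumes fin: "finite S" "finite P" "finite D" and D: "D \<inter> P = {}" "D \<subseteq> (S \<times> B) \<times> C"
    and \<epsilon>: "0 < \<epsilon>" "\<epsilon> \<le> 1 / 8"
    and c: "\<And>i. i \<in> S \<Longrightarrow> row_weight n \<epsilon> (card (row_part P i) + card (row_part D i)) \<le>
        row_weight n \<epsilon> (card (row_part P i)) + c * real (card (row_part D i))"
  shows "entry_weight n \<epsilon> S (P \<union> D) \<le> entry_weight n \<epsilon> S P * (1 / ((1 - \<epsilon>) * real n) * exp c) ^ card D"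
proof -
  define q where "q = 1 / ((1 - \<epsilon>) * real n)"
  have q: "0 \<le> q" using \<epsilon> by (simp add: q_def)
  have fr: "finite (row_part P i)" if "finite P" for P i
  proof -
    have "row_part P i \<subseteq> (\<lambda>((i, x), a). (x, a)) ` P" by (force simp: row_part_def)
    then show ?thesis using that finite_surj by blast
  qed
  have card: "card (row_part (P \<union> D) i) = card (row_part P i) + card (row_part D i)" for i
  proof -
    have "row_part (P \<union> D) i = row_part P i \<union> row_part D i" "row_part P i \<inter> row_part D i = {}"
      using D(1) by (auto simp: row_part_def)
    then show ?thesis using fr fin by (simp add: card_Un_disjoint)
  qed
  have "(\<Sum>i\<in>S. row_weight n \<epsilon> (card (row_part (P \<union> D) i))) \<le>
      (\<Sum>i\<in>S. row_weight n \<epsilon> (card (row_part P i)) + c * real (card (row_part D i)))"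
    unfolding card by (intro sum_mono c)
  also have "\<dots> = (\<Sum>i\<in>S. row_weight n \<epsilon> (card (row_part P i))) + c * real (card D)"
    using sum_card_row_part[OF fin(1,3) D(2)]
    by (simp add: sum.distrib flip: sum_distrib_left of_nat_sum)
  finally have "exp (\<Sum>i\<in>S. row_weight n \<epsilon> (card (row_part (P \<union> D) i))) \<le>
      exp (\<Sum>i\<in>S. row_weight n \<epsilon> (card (row_part P i))) * exp c ^ card D"
    by (simp flip: exp_add exp_of_nat2_mult)
  then have "q ^ (card P + card D) * exp (\<Sum>i\<in>S. row_weight n \<epsilon> (card (row_part (P \<union> D) i))) \<le>
      q ^ (card P + card D) * (exp (\<Sum>i\<in>S. row_weight n \<epsilon> (card (row_part P i))) * exp c ^ card D)"
    using q by (intro mult_left_mono) auto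
  moreover have "card (P \<union> D) = card P + card D" using fin D(1) by (intro card_Un_disjoint) auto
  ultimately show ?thesis
    unfolding entry_weight_def q_def[symmetric] power_mult_distrib by (simp only: power_add mult_ac)
qed

section \<open>Intercalates as sets of entries\<close>

type_synonym quad = "(nat \<times> nat) \<times> (nat \<times> nat) \<times> (nat \<times> nat)"

text \<open>The quadruple \<open>((i, j), (x, y), (a, b))\<close> stands for the intercalate with symbol \<open>a\<close> at \<open>(i, x)\<close>, \<open>(j, y)\<close> and symbol \<open>b\<close> at \<open>(i, y)\<close>, \<open>(j, x)\<close>.\<close>

fun ents :: "quad \<Rightarrow> cell_entry set" where
  "ents ((i, j), (x, y), (a, b)) = {((i, x), a), ((j, y), a), ((i, y), b), ((j, x), b)}"

definition quads :: "nat set \<Rightarrow> nat set \<Rightarrow> quad set" where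
  "quads N S = {((i, j), (x, y), (a, b)) | i j x y a b.
     i \<in> S \<and> j \<in> S \<and> i < j \<and> x \<in> N \<and> y \<in> N \<and> x < y \<and> a \<in> N \<and> b \<in> N}"

definition quads_in :: "nat set \<Rightarrow> nat set \<Rightarrow> cell_entry set \<Rightarrow> quad set" where
  "quads_in N S P = {I \<in> quads N S. ents I \<subseteq> P}"

definition functional :: "cell_entry set \<Rightarrow> bool" where
  "functional P \<longleftrightarrow> (\<forall>p a b. (p, a) \<in> P \<longrightarrow> (p, b) \<in> P \<longrightarrow> a = b)"

lemma finite_quads: "finite N \<Longrightarrow> finite S \<Longrightarrow> finite (quads N S)"
  by (rule finite_subset[of _ "(S \<times> S) \<times> (N \<times> N) \<times> (N \<times> N)"]) (auto simp: quads_def)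

lemma card_pairs_less:
  fixes S :: "nat set"
  assumes "finite S"
  shows "2 * card {(i, j). i \<in> S \<and> j \<in> S \<and> i < j} \<le> card S ^ 2"
proof -
  define U V where "U = {(i, j). i \<in> S \<and> j \<in> S \<and> i < j}" and "V = {(i, j). i \<in> S \<and> j \<in> S \<and> j < i}"
  have "U \<subseteq> S \<times> S" "V \<subseteq> S \<times> S" by (auto simp: U_def V_def)
  then have fin: "finite U" "finite V" using assms by (meson finite_SigmaI finite_subset)+
  have "bij_betw prod.swap U V"
    by (rule bij_betw_byWitness[where f' = prod.swap]) (auto simp: U_def V_def)
  then have "card U = card V" by (rule bij_betw_same_card)
  then have "2 * card U = card (U \<union> V)"
    using fin by (subst card_Un_disjoint) (auto simp: U_def V_def)
  also have "\<dots> \<le> card (S \<times> S)"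
    using assms by (intro card_mono) (auto simp: U_def V_def)
  finally show ?thesis by (simp add: U_def card_cartesian_product power2_eq_square)
qed

text \<open>The ordering of the two rows and of the two columns gives the 4. Multiplied by about
  \<open>n\<close> to the power \<open>- 4\<close> for four entries, this is the expected number
  \<open>k\<^sup>2 / 4\<close>, hence \<open>n\<^sup>2 / 4\<close> in the whole square.\<close>

lemma card_quads_le:
  assumes "finite N" "finite S"
  shows "real (card (quads N S)) \<le> real (card S) ^ 2 * real (card N) ^ 4 / 4"
proof -
  have "quads N S = {(i, j). i \<in> S \<and> j \<in> S \<and> i < j} \<times> {(x, y). x \<in> N \<and> y \<in> N \<and> x < y} \<times> (N \<times> N)"
    by (auto simp: quads_def)
  then have "4 * card (quads N S) = (2 * card {(i, j). i \<in> S \<and> j \<in> S \<and> i < j}) *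
      (2 * card {(x, y). x \<in> N \<and> y \<in> N \<and> x < y}) * (card N * card N)"
    by (simp add: card_cartesian_product)
  also have "\<dots> \<le> card S ^ 2 * card N ^ 2 * (card N * card N)"
    using card_pairs_less[OF assms(1)] card_pairs_less[OF assms(2)] by (intro mult_mono) auto
  also have "\<dots> = card S ^ 2 * card N ^ 4" by (simp add: power2_eq_square power4_eq_xxxx)
  finally have "real (4 * card (quads N S)) \<le> real (card S ^ 2 * card N ^ 4)" by (rule of_nat_mono)
  then show ?thesis by simp
qed

lemma card_Collect_quads_le:
  assumes "finite B" "inj_on f {I \<in> quads N S. \<phi> I}" "f ` {I \<in> quads N S. \<phi> I} \<subseteq> B"
  shows "card {I \<in> quads N S. \<phi> I} \<le> card B"
  using assms card_inj_on_le by blast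

definition q1 :: "quad \<Rightarrow> cell_entry" where "q1 = (\<lambda>((i, j), (x, y), (a, b)). ((i, x), a))"
definition q2 :: "quad \<Rightarrow> cell_entry" where "q2 = (\<lambda>((i, j), (x, y), (a, b)). ((j, y), a))"
definition q3 :: "quad \<Rightarrow> cell_entry" where "q3 = (\<lambda>((i, j), (x, y), (a, b)). ((i, y), b))"
definition q4 :: "quad \<Rightarrow> cell_entry" where "q4 = (\<lambda>((i, j), (x, y), (a, b)). ((j, x), b))"

lemmas q_defs = q1_def q2_def q3_def q4_def

lemma ents_eq: "ents I = {q1 I, q2 I, q3 I, q4 I}"
  by (cases I rule: ents.cases) (simp add: q_defs)

lemma ents_subset: "I \<in> quads N S \<Longrightarrow> ents I \<subseteq> (S \<times> N) \<times> N"
  by (auto simp: quads_def)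

lemma q_distinct:
  assumes "I \<in> quads N S"
  shows "q1 I \<noteq> q2 I" "q1 I \<noteq> q3 I" "q1 I \<noteq> q4 I" "q2 I \<noteq> q3 I" "q2 I \<noteq> q4 I" "q3 I \<noteq> q4 I"
  using assms by (auto simp: quads_def q_defs)

abbreviation hits1 where "hits1 N S P q \<equiv> {I \<in> quads N S. q I \<in> P}"
abbreviation hits2 where "hits2 N S P q q' \<equiv> {I \<in> quads N S. q I \<in> P \<and> q' I \<in> P}"
abbreviation hits3 where "hits3 N S P q q' q'' \<equiv> {I \<in> quads N S. q I \<in> P \<and> q' I \<in> P \<and> q'' I \<in> P}"

context
  fixes N S :: "nat set" and P :: "cell_entry set"
  assumes fin: "finite N" "finite S" "finite P" and SN: "S \<subseteq> N"
begin

lemma card_one_in: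
  "card (hits1 N S P q1) \<le> card P * card N ^ 3"
  "card (hits1 N S P q2) \<le> card P * card N ^ 3"
  "card (hits1 N S P q3) \<le> card P * card N ^ 3"
  "card (hits1 N S P q4) \<le> card P * card N ^ 3"
proof -
  have c: "card P * card N ^ 3 = card (P \<times> N \<times> N \<times> N)"
    by (simp add: card_cartesian_product power3_eq_cube)
  have f: "finite (P \<times> N \<times> N \<times> N)" using fin by simp
  show "card (hits1 N S P q1) \<le> card P * card N ^ 3" unfolding c
    by (rule card_Collect_quads_le[OF f, where f = "\<lambda>((i, j), (x, y), (a, b)). (((i, x), a), j, y, b)"])
       (use SN in \<open>auto simp: inj_on_def quads_def q_defs\<close>)
  show "card (hits1 N S P q2) \<le> card P * card N ^ 3" unfolding c
    by (rule card_Collect_quads_le[OF f, where f = "\<lambda>((i, j), (x, y), (a, b)). (((j, y), a), i, x, b)"])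
       (use SN in \<open>auto simp: inj_on_def quads_def q_defs\<close>)
  show "card (hits1 N S P q3) \<le> card P * card N ^ 3" unfolding c
    by (rule card_Collect_quads_le[OF f, where f = "\<lambda>((i, j), (x, y), (a, b)). (((i, y), b), j, x, a)"])
       (use SN in \<open>auto simp: inj_on_def quads_def q_defs\<close>)
  show "card (hits1 N S P q4) \<le> card P * card N ^ 3" unfolding c
    by (rule card_Collect_quads_le[OF f, where f = "\<lambda>((i, j), (x, y), (a, b)). (((j, x), b), i, y, a)"])
       (use SN in \<open>auto simp: inj_on_def quads_def q_defs\<close>)
qed

text \<open>Any two entries of a quad share exactly one of row, column and symbol, so they fix five
  of its six coordinates; the third component of the injection is the free one.\<close>

lemma card_two_in:
  "card (hits2 N S P q1 q2) \<le> card P ^ 2 * card N"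
  "card (hits2 N S P q1 q3) \<le> card P ^ 2 * card N"
  "card (hits2 N S P q1 q4) \<le> card P ^ 2 * card N"
  "card (hits2 N S P q2 q3) \<le> card P ^ 2 * card N"
  "card (hits2 N S P q2 q4) \<le> card P ^ 2 * card N"
  "card (hits2 N S P q3 q4) \<le> card P ^ 2 * card N"
proof -
  have c: "card P ^ 2 * card N = card (P \<times> P \<times> N)"
    by (simp add: card_cartesian_product power2_eq_square)
  have f: "finite (P \<times> P \<times> N)" using fin by simp
  show "card (hits2 N S P q1 q2) \<le> card P ^ 2 * card N" unfolding c
    by (rule card_Collect_quads_le[OF f, where f = "\<lambda>I. (q1 I, q2 I, snd (snd (snd I)))"])
       (use SN in \<open>auto simp: inj_on_def quads_def q_defs\<close>)
  show "card (hits2 N S P q1 q3) \<le> card P ^ 2 * card N" unfolding c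
    by (rule card_Collect_quads_le[OF f, where f = "\<lambda>I. (q1 I, q3 I, snd (fst I))"])
       (use SN in \<open>auto simp: inj_on_def quads_def q_defs\<close>)
  show "card (hits2 N S P q1 q4) \<le> card P ^ 2 * card N" unfolding c
    by (rule card_Collect_quads_le[OF f, where f = "\<lambda>I. (q1 I, q4 I, snd (fst (snd I)))"])
       (use SN in \<open>auto simp: inj_on_def quads_def q_defs\<close>)
  show "card (hits2 N S P q2 q3) \<le> card P ^ 2 * card N" unfolding c
    by (rule card_Collect_quads_le[OF f, where f = "\<lambda>I. (q2 I, q3 I, fst (fst (snd I)))"])
       (use SN in \<open>auto simp: inj_on_def quads_def q_defs\<close>)
  show "card (hits2 N S P q2 q4) \<le> card P ^ 2 * card N" unfolding c
    by (rule card_Collect_quads_le[OF f, where f = "\<lambda>I. (q2 I, q4 I, fst (fst I))"])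
       (use SN in \<open>auto simp: inj_on_def quads_def q_defs\<close>)
  show "card (hits2 N S P q3 q4) \<le> card P ^ 2 * card N" unfolding c
    by (rule card_Collect_quads_le[OF f, where f = "\<lambda>I. (q3 I, q4 I, fst (snd (snd I)))"])
       (use SN in \<open>auto simp: inj_on_def quads_def q_defs\<close>)
qed

text \<open>Among three entries there are two with the same symbol; these fix everything but the
  other symbol, which the third entry determines because \<open>P\<close> is functional.\<close>

lemma card_three_in:
  assumes "functional P"
  shows
  "card (hits3 N S P q1 q2 q3) \<le> card P ^ 2"
  "card (hits3 N S P q1 q2 q4) \<le> card P ^ 2"
  "card (hits3 N S P q1 q3 q4) \<le> card P ^ 2"
  "card (hits3 N S P q2 q3 q4) \<le> card P ^ 2"
proof -
  have P: "\<And>p a b. (p, a) \<in> P \<Longrightarrow> (p, b) \<in> P \<Longrightarrow> a = b"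
    using assms by (auto simp: functional_def)
  have c: "card P ^ 2 = card (P \<times> P)"
    by (simp add: card_cartesian_product power2_eq_square)
  have f: "finite (P \<times> P)" using fin by simp
  show "card (hits3 N S P q1 q2 q3) \<le> card P ^ 2" unfolding c
    by (rule card_Collect_quads_le[OF f, where f = "\<lambda>I. (q1 I, q2 I)"])
       (auto simp: inj_on_def quads_def q_defs dest: P)
  show "card (hits3 N S P q1 q2 q4) \<le> card P ^ 2" unfolding c
    by (rule card_Collect_quads_le[OF f, where f = "\<lambda>I. (q1 I, q2 I)"])
       (auto simp: inj_on_def quads_def q_defs dest: P)
  show "card (hits3 N S P q1 q3 q4) \<le> card P ^ 2" unfolding c
    by (rule card_Collect_quads_le[OF f, where f = "\<lambda>I. (q3 I, q4 I)"])
       (auto simp: inj_on_def quads_def q_defs dest: P)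
  show "card (hits3 N S P q2 q3 q4) \<le> card P ^ 2" unfolding c
    by (rule card_Collect_quads_le[OF f, where f = "\<lambda>I. (q3 I, q4 I)"])
       (auto simp: inj_on_def quads_def q_defs dest: P)
qed

lemma card_row_in:
  assumes "H \<subseteq> S"
  shows "card {I \<in> quads N S. fst (fst I) \<in> H \<or> snd (fst I) \<in> H} \<le> 2 * (card H * card N ^ 5)"
proof -
  have c: "card H * card N ^ 5 = card (H \<times> N \<times> N \<times> N \<times> N \<times> N)"
    by (simp add: card_cartesian_product numeral_eq_Suc)
  have f: "finite (H \<times> N \<times> N \<times> N \<times> N \<times> N)" using fin finite_subset[OF assms] by (intro finite_SigmaI)
  have "card {I \<in> quads N S. fst (fst I) \<in> H} \<le> card H * card N ^ 5" unfolding c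
    by (rule card_Collect_quads_le[OF f, where f = "\<lambda>((i, j), (x, y), (a, b)). (i, j, x, y, a, b)"])
       (use SN in \<open>auto simp: inj_on_def quads_def\<close>)
  moreover have "card {I \<in> quads N S. snd (fst I) \<in> H} \<le> card H * card N ^ 5" unfolding c
    by (rule card_Collect_quads_le[OF f, where f = "\<lambda>((i, j), (x, y), (a, b)). (j, i, x, y, a, b)"])
       (use SN in \<open>auto simp: inj_on_def quads_def\<close>)
  moreover have "card {I \<in> quads N S. fst (fst I) \<in> H \<or> snd (fst I) \<in> H} \<le>
      card {I \<in> quads N S. fst (fst I) \<in> H} + card {I \<in> quads N S. snd (fst I) \<in> H}"
    unfolding conj_disj_distribL Collect_disj_eq by (rule card_Un_le)
  ultimately show ?thesis by linarith
qed

end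

lemma row_part_ents_empty:
  "i \<noteq> fst (fst I) \<Longrightarrow> i \<noteq> snd (fst I) \<Longrightarrow> row_part (ents I) i = {}"
  by (cases I rule: ents.cases) (auto simp: row_part_def)

lemma card_row_part_ents_le:
  assumes "I \<in> quads N S"
  shows "card (row_part (ents I) i) \<le> 2"
proof -
  obtain i' j x y a b where I: "I = ((i', j), (x, y), (a, b))" by (metis surj_pair)
  have "i' \<noteq> j" using assms by (auto simp: I quads_def)
  then have "row_part (ents I) i \<subseteq> {(x, a), (y, b)} \<or> row_part (ents I) i \<subseteq> {(y, a), (x, b)}"
    by (auto simp: row_part_def I)
  then obtain u v where "row_part (ents I) i \<subseteq> {u, v}" by blast
  then have "card (row_part (ents I) i) \<le> card {u, v}" by (intro card_mono) auto
  also have "\<dots> \<le> 2" by (simp add: card_insert_if)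
  finally show ?thesis .
qed

lemma card_ents_minus:
  assumes "I \<in> quads N S"
  shows "card (ents I - P) = of_bool (q1 I \<notin> P) + of_bool (q2 I \<notin> P) + of_bool (q3 I \<notin> P) + of_bool (q4 I \<notin> P)"
  using q_distinct[OF assms] by (simp add: ents_eq insert_Diff_if)

text \<open>Replaces events of the form "exactly these entries lie in \<open>P\<close>" by "at least
  these", for which the counts are available. The term \<open>z\<close> covers the case in which all
  four entries are new.\<close>

lemma power_le_indicator_sum:
  fixes Q :: real
  assumes "0 \<le> Q" "0 \<le> z" "b1 \<or> b2 \<or> b3 \<or> b4 \<or> Q ^ 4 \<le> z"
  shows "Q ^ (of_bool (\<not> b1) + of_bool (\<not> b2) + of_bool (\<not> b3) + of_bool (\<not> b4)) \<le> z +
    Q ^ 3 * (of_bool b1 + of_bool b2 + of_bool b3 + of_bool b4) +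
    Q ^ 2 * (of_bool (b1 \<and> b2) + of_bool (b1 \<and> b3) + of_bool (b1 \<and> b4) +
      of_bool (b2 \<and> b3) + of_bool (b2 \<and> b4) + of_bool (b3 \<and> b4)) +
    Q * (of_bool (b1 \<and> b2 \<and> b3) + of_bool (b1 \<and> b2 \<and> b4) + of_bool (b1 \<and> b3 \<and> b4) + of_bool (b2 \<and> b3 \<and> b4)) +
    of_bool (b1 \<and> b2 \<and> b3 \<and> b4)"
proof -
  have p: "0 \<le> Q ^ 3" "0 \<le> Q ^ 2" using assms by auto
  show ?thesis
    using assms p
    by (cases b1; cases b2; cases b3; cases b4) (simp_all add: numeral_eq_Suc)
qed

text \<open>The terms in order: all four entries new and in short rows (the main term), all four new
  but meeting a crowded row, then one, two, three and four entries already present. \<open>m\<close>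
  bounds the number of fixed entries, \<open>b\<close> the number of quads completed by
  them.\<close>

abbreviation step_factor :: "nat \<Rightarrow> real \<Rightarrow> nat \<Rightarrow> real \<Rightarrow> real \<Rightarrow> real \<Rightarrow> real \<Rightarrow> real" where
  "step_factor n \<epsilon> k A Q m b \<equiv> A ^ 4 * (real k ^ 2 * real n ^ 4 / 4) + Q ^ 4 * (4 * m / \<epsilon> * real n ^ 4) +
     Q ^ 3 * (4 * m * real n ^ 3) + Q ^ 2 * (6 * m ^ 2 * real n) + Q * (4 * m ^ 2) + b"

lemma sum_entry_weight_quads_le:
  fixes S :: "nat set"
  assumes n: "0 < n" and \<epsilon>: "0 < \<epsilon>" "\<epsilon> \<le> 1 / 8" "4 \<le> \<epsilon> * real n"
    and S: "S \<subseteq> {1..n}" and P: "P \<subseteq> entry_space n S" "functional P"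
    and defs: "A = 1 / ((1 - \<epsilon>) * real n) * exp (2 * \<epsilon>)" "Q = 1 / ((1 - \<epsilon>) * real n) * exp 3"
    and m: "m = real (card P)"
  shows "(\<Sum>I\<in>quads {1..n} S. entry_weight n \<epsilon> S (P \<union> ents I)) \<le> entry_weight n \<epsilon> S P *
    (step_factor n \<epsilon> (card S) A Q m (real (card (quads_in {1..n} S P))))"
proof -
  define N where "N = {1..n}"
  define c where "c = quads N S"
  \<comment> \<open>A quad puts two entries into each of its rows, so these are the rows it could
    push beyond the kink of \<open>row_weight\<close>. By \<open>4 \<le> \<epsilon> * n\<close> each
    already holds \<open>\<epsilon> * n / 2\<close> entries, so there are few of them.\<close>
  define H where "H = {i \<in> S. \<epsilon> * real n < real (card (row_part P i) + 2)}"
  have fN: "finite N" "card N = n" by (auto simp: N_def)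
  have fS: "finite S" using S finite_subset by blast
  have fP: "finite P" by (rule finite_subset[OF P(1)]) (use fS in auto)
  have SN: "S \<subseteq> N" using S by (simp add: N_def)
  have P': "P \<subseteq> (S \<times> N) \<times> N" using P by (simp add: N_def)
  have fc: "finite c" unfolding c_def by (rule finite_quads[OF fN(1) fS])
  note fin = fN(1) fS fP SN
  have AQ: "0 \<le> A" "0 \<le> Q" using \<epsilon> by (auto simp: defs)
  have W0: "0 \<le> entry_weight n \<epsilon> S P" using \<epsilon> by (simp add: entry_weight_def)
  define heavy where "heavy I \<longleftrightarrow> fst (fst I) \<in> H \<or> snd (fst I) \<in> H" for I :: quad
  define t where "t I = A ^ 4 + Q ^ 4 * of_bool (heavy I) +
    Q ^ 3 * (of_bool (q1 I \<in> P) + of_bool (q2 I \<in> P) + of_bool (q3 I \<in> P) + of_bool (q4 I \<in> P)) +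
    Q ^ 2 * (of_bool (q1 I \<in> P \<and> q2 I \<in> P) + of_bool (q1 I \<in> P \<and> q3 I \<in> P) + of_bool (q1 I \<in> P \<and> q4 I \<in> P) +
      of_bool (q2 I \<in> P \<and> q3 I \<in> P) + of_bool (q2 I \<in> P \<and> q4 I \<in> P) + of_bool (q3 I \<in> P \<and> q4 I \<in> P)) +
    Q * (of_bool (q1 I \<in> P \<and> q2 I \<in> P \<and> q3 I \<in> P) + of_bool (q1 I \<in> P \<and> q2 I \<in> P \<and> q4 I \<in> P) +
      of_bool (q1 I \<in> P \<and> q3 I \<in> P \<and> q4 I \<in> P) + of_bool (q2 I \<in> P \<and> q3 I \<in> P \<and> q4 I \<in> P)) +
    of_bool (q1 I \<in> P \<and> q2 I \<in> P \<and> q3 I \<in> P \<and> q4 I \<in> P)" for I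
  have point: "entry_weight n \<epsilon> S (P \<union> ents I) \<le> entry_weight n \<epsilon> S P * t I" if I: "I \<in> c" for I
  proof -
    have Ic: "I \<in> quads N S" using I by (simp add: c_def)
    have U: "P \<union> ents I = P \<union> (ents I - P)" by auto
    have D: "finite (ents I - P)" "(ents I - P) \<inter> P = {}" "ents I - P \<subseteq> (S \<times> N) \<times> N"
      using ents_subset[OF Ic] by (auto simp: ents_eq)
    have Qm: "entry_weight n \<epsilon> S (P \<union> ents I) \<le> entry_weight n \<epsilon> S P * Q ^ card (ents I - P)"
      unfolding U defs
      by (rule entry_weight_Un_le[OF fS fP D \<epsilon>(1,2)]) (rule row_weight_add_le(1)[OF \<epsilon>(1,2)])
    show ?thesis
    proof (cases "q1 I \<in> P \<or> q2 I \<in> P \<or> q3 I \<in> P \<or> q4 I \<in> P \<or> heavy I")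
      case True
      have "Q ^ card (ents I - P) \<le> t I"
        unfolding card_ents_minus[OF Ic] t_def
        using True AQ by (intro power_le_indicator_sum) auto
      then show ?thesis using Qm W0 by (meson mult_left_mono order_trans)
    next
      case False
      then have D0: "ents I - P = ents I" by (auto simp: ents_eq)
      have c4: "card (ents I) = 4" using card_ents_minus[OF Ic, of "{}"] by simp
      have "entry_weight n \<epsilon> S (P \<union> (ents I - P)) \<le> entry_weight n \<epsilon> S P * A ^ card (ents I - P)"
        unfolding defs
      proof (rule entry_weight_Un_le[OF fS fP D \<epsilon>(1,2)])
        fix i assume i: "i \<in> S"
        show "row_weight n \<epsilon> (card (row_part P i) + card (row_part (ents I - P) i)) \<le>
          row_weight n \<epsilon> (card (row_part P i)) + 2 * \<epsilon> * real (card (row_part (ents I - P) i))"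
        proof (cases "i = fst (fst I) \<or> i = snd (fst I)")
          case True
          then have "i \<notin> H" using False by (auto simp: heavy_def)
          then have "real (card (row_part P i) + 2) \<le> \<epsilon> * real n" using i by (auto simp: H_def)
          then have "real (card (row_part P i) + card (row_part (ents I - P) i)) \<le> \<epsilon> * real n"
            using card_row_part_ents_le[OF Ic, of i] unfolding D0 by linarith
          then show ?thesis by (rule row_weight_add_le(2)[OF \<epsilon>(1,2)])
        next
          case False
          then have "row_part (ents I) i = {}" by (intro row_part_ents_empty) auto
          then show ?thesis unfolding D0 by simp
        qed
      qed
      then have "entry_weight n \<epsilon> S (P \<union> ents I) \<le> entry_weight n \<epsilon> S P * A ^ 4"
        unfolding D0 c4 .
      also have "A ^ 4 = t I" using False unfolding t_def by simp
      finally show ?thesis .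
    qed
  qed
  have cnt: "(\<Sum>I\<in>c. of_bool (\<phi> I)) = real (card {I \<in> quads N S. \<phi> I})" for \<phi>
    using fc by (simp add: c_def Int_def)
  have hm: "real (card H) * real n \<le> 2 * m / \<epsilon>"
  proof -
    have "real (card H) * (\<epsilon> * real n / 2) = (\<Sum>i\<in>H. \<epsilon> * real n / 2)" by simp
    also have "\<dots> \<le> (\<Sum>i\<in>H. real (card (row_part P i)))"
    proof (rule sum_mono)
      fix i assume "i \<in> H"
      then have "\<epsilon> * real n < real (card (row_part P i)) + 2" by (simp add: H_def)
      then show "\<epsilon> * real n / 2 \<le> real (card (row_part P i))" using \<epsilon>(3) by linarith
    qed
    also have "\<dots> \<le> (\<Sum>i\<in>S. real (card (row_part P i)))"
      using fS by (intro sum_mono2) (auto simp: H_def)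
    also have "\<dots> = m"
      using sum_card_row_part[OF fS fP P(1)] by (simp add: m flip: of_nat_sum)
    finally show ?thesis using \<epsilon> by (simp add: field_simps)
  qed
  have heavy: "real (card {I \<in> quads N S. heavy I}) \<le> 4 * m / \<epsilon> * real n ^ 4"
  proof -
    have "card {I \<in> quads N S. heavy I} \<le> 2 * (card H * n ^ 5)"
      unfolding heavy_def using card_row_in[OF fin, of H] fN by (auto simp: H_def)
    then have "real (card {I \<in> quads N S. heavy I}) \<le> real (2 * (card H * n ^ 5))" by (rule of_nat_mono)
    also have "\<dots> = 2 * (real (card H) * real n) * real n ^ 4" by (simp add: power_numeral_reduce)
    also have "\<dots> \<le> 2 * (2 * m / \<epsilon>) * real n ^ 4"
      using hm by (intro mult_right_mono mult_left_mono) auto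
    finally show ?thesis by simp
  qed
  have one: "real (card (hits1 N S P q1)) \<le> m * real n ^ 3"
    "real (card (hits1 N S P q2)) \<le> m * real n ^ 3"
    "real (card (hits1 N S P q3)) \<le> m * real n ^ 3"
    "real (card (hits1 N S P q4)) \<le> m * real n ^ 3"
    using card_one_in[OF fin, THEN of_nat_mono[where 'a = real]] by (simp_all add: m fN)
  have two: "real (card (hits2 N S P q1 q2)) \<le> m ^ 2 * real n"
    "real (card (hits2 N S P q1 q3)) \<le> m ^ 2 * real n"
    "real (card (hits2 N S P q1 q4)) \<le> m ^ 2 * real n"
    "real (card (hits2 N S P q2 q3)) \<le> m ^ 2 * real n"
    "real (card (hits2 N S P q2 q4)) \<le> m ^ 2 * real n"
    "real (card (hits2 N S P q3 q4)) \<le> m ^ 2 * real n"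
    using card_two_in[OF fin, THEN of_nat_mono[where 'a = real]] by (simp_all add: m fN)
  have three: "real (card (hits3 N S P q1 q2 q3)) \<le> m ^ 2"
    "real (card (hits3 N S P q1 q2 q4)) \<le> m ^ 2"
    "real (card (hits3 N S P q1 q3 q4)) \<le> m ^ 2"
    "real (card (hits3 N S P q2 q3 q4)) \<le> m ^ 2"
    using card_three_in[OF fin P(2), THEN of_nat_mono[where 'a = real]] by (simp_all add: m)
  have all: "{I \<in> quads N S. q1 I \<in> P \<and> q2 I \<in> P \<and> q3 I \<in> P \<and> q4 I \<in> P} = quads_in N S P"
    by (auto simp: quads_in_def ents_eq)
  have "(\<Sum>I\<in>c. t I) = A ^ 4 * real (card c) + Q ^ 4 * real (card {I \<in> quads N S. heavy I}) +
    Q ^ 3 * (real (card (hits1 N S P q1)) + real (card (hits1 N S P q2)) +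
       real (card (hits1 N S P q3)) + real (card (hits1 N S P q4))) +
    Q ^ 2 * (real (card (hits2 N S P q1 q2)) + real (card (hits2 N S P q1 q3)) +
      real (card (hits2 N S P q1 q4)) + real (card (hits2 N S P q2 q3)) +
      real (card (hits2 N S P q2 q4)) + real (card (hits2 N S P q3 q4))) +
    Q * (real (card (hits3 N S P q1 q2 q3)) +
      real (card (hits3 N S P q1 q2 q4)) +
      real (card (hits3 N S P q1 q3 q4)) +
      real (card (hits3 N S P q2 q3 q4))) +
    real (card (quads_in N S P))"
    unfolding t_def sum.distrib sum_distrib_left[symmetric] cnt all by (simp add: mult.commute)
  also have "\<dots> \<le> A ^ 4 * (real (card S) ^ 2 * real n ^ 4 / 4) + Q ^ 4 * (4 * m / \<epsilon> * real n ^ 4) +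
     Q ^ 3 * (m * real n ^ 3 + m * real n ^ 3 + m * real n ^ 3 + m * real n ^ 3) +
     Q ^ 2 * (m ^ 2 * real n + m ^ 2 * real n + m ^ 2 * real n + m ^ 2 * real n + m ^ 2 * real n + m ^ 2 * real n) +
     Q * (m ^ 2 + m ^ 2 + m ^ 2 + m ^ 2) + real (card (quads_in N S P))"
    using card_quads_le[OF fN(1) fS] fN AQ
    by (intro add_mono mult_left_mono one two three heavy order_refl zero_le_power AQ) (simp_all add: c_def)
  finally have tb: "(\<Sum>I\<in>c. t I) \<le> step_factor n \<epsilon> (card S) A Q m (real (card (quads_in N S P)))"
    by (simp add: mult_ac)
  have "(\<Sum>I\<in>c. entry_weight n \<epsilon> S (P \<union> ents I)) \<le> entry_weight n \<epsilon> S P * (\<Sum>I\<in>c. t I)"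
    unfolding sum_distrib_left by (intro sum_mono point)
  also have "\<dots> \<le> entry_weight n \<epsilon> S P * (step_factor n \<epsilon> (card S) A Q m (real (card (quads_in N S P))))"
    using tb W0 by (rule mult_left_mono)
  finally show ?thesis unfolding c_def N_def .
qed

section \<open>Moments in the absence of seeds\<close>

definition square_graph :: "nat \<Rightarrow> (nat \<times> nat \<Rightarrow> nat) \<Rightarrow> cell_entry set" where
  "square_graph n L = (\<lambda>p. (p, L p)) ` ({1..n} \<times> {1..n})"

definition seeded :: "nat \<Rightarrow> nat set \<Rightarrow> nat \<Rightarrow> real \<Rightarrow> (nat \<times> nat \<Rightarrow> nat) \<Rightarrow> bool" where
  "seeded n S M b L \<longleftrightarrow> (\<exists>P. P \<subseteq> square_graph n L \<and> P \<subseteq> entry_space n S \<and> card P \<le> M \<and>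
     b < real (card (quads_in {1..n} S P)))"

lemma functional_subset_square_graph: "P \<subseteq> square_graph n L \<Longrightarrow> functional P"
  unfolding functional_def square_graph_def by blast

lemma subset_square_graph_iff:
  assumes "P \<subseteq> ({1..n} \<times> {1..n}) \<times> B"
  shows "P \<subseteq> square_graph n L \<longleftrightarrow> (\<forall>(p, a)\<in>P. L p = a)"
  using assms unfolding square_graph_def by fast

lemma entry_weight_empty: "0 < \<epsilon> \<Longrightarrow> entry_weight n \<epsilon> S {} = 1"
  by (simp add: entry_weight_def row_part_def row_weight_def)

abbreviation quad_count :: "nat \<Rightarrow> nat set \<Rightarrow> (nat \<times> nat \<Rightarrow> nat) \<Rightarrow> real" where
  "quad_count n S L \<equiv> real (card (quads_in {1..n} S (square_graph n L)))"

text \<open>Expand one factor of the power and add the entries of its quad to \<open>P\<close>. Only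
  sets \<open>P\<close> inside some unseeded square contribute; they contain at most
  \<open>b\<close> quads, so \<open>step\<close> applies to them. The counting bound, and with it
  \<open>total_err\<close>, enters only at \<open>l = 0\<close>.\<close>

lemma moment_bound:
  fixes n :: nat
  assumes n: "0 < n" and \<epsilon>: "0 < \<epsilon>" "\<epsilon> \<le> 1 / 8"
    and S: "S \<subseteq> {1..n}" "real (card S) \<le> \<epsilon> * real n"
    and step: "\<And>P. P \<subseteq> entry_space n S \<Longrightarrow> functional P \<Longrightarrow> card P \<le> M \<Longrightarrow>
      real (card (quads_in {1..n} S P)) \<le> b \<Longrightarrow>
      (\<Sum>I\<in>quads {1..n} S. entry_weight n \<epsilon> S (P \<union> ents I)) \<le> \<mu> * entry_weight n \<epsilon> S P"
    and \<mu>: "0 \<le> \<mu>"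
    and B: "B \<subseteq> {L \<in> latin_squares n. \<not> seeded n S M b L}"
    and P: "P \<subseteq> entry_space n S" "card P + 4 * l \<le> M"
  shows "(\<Sum>L | L \<in> B \<and> P \<subseteq> square_graph n L. quad_count n S L ^ l) \<le>
    real (card (latin_squares n)) * total_err n * \<mu> ^ l * entry_weight n \<epsilon> S P"
  using P
proof (induction l arbitrary: P)
  case 0
  have fB: "finite {L \<in> latin_squares n. \<forall>(p, a)\<in>P. L p = a}"
    using finite_latin_squares by simp
  have P': "P \<subseteq> entry_space n {1..n}" using 0 S by blast
  have "card {L. L \<in> B \<and> P \<subseteq> square_graph n L} \<le> card {L \<in> latin_squares n. \<forall>(p, a)\<in>P. L p = a}"
  proof (intro card_mono[OF fB] subsetI)
    fix L assume "L \<in> {L. L \<in> B \<and> P \<subseteq> square_graph n L}"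
    then have L: "L \<in> B" "P \<subseteq> square_graph n L" by auto
    have "L \<in> latin_squares n" using L(1) B by auto
    then show "L \<in> {L \<in> latin_squares n. \<forall>(p, a)\<in>P. L p = a}"
      using subset_square_graph_iff[OF P', THEN iffD1, OF L(2)] by (intro CollectI conjI)
  qed
  then have "real (card {L. L \<in> B \<and> P \<subseteq> square_graph n L}) \<le> real (card {L \<in> latin_squares n. \<forall>(p, a)\<in>P. L p = a})"
    by simp
  also have "\<dots> \<le> real (card (latin_squares n)) * (total_err n * entry_weight n \<epsilon> S P)"
    by (rule card_latin_squares_with_le[OF n \<epsilon> S 0(1)])
  finally show ?case by (simp add: mult.assoc)
next
  case (Suc l)
  define c where "c = quads {1..n} S"
  define J where "J L = quad_count n S L" for L
  define K where "K = real (card (latin_squares n)) * total_err n * \<mu> ^ l"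
  have fS: "finite S" using S finite_subset by blast
  have fP: "finite P" by (rule finite_subset[OF Suc.prems(1)]) (use fS in auto)
  have fc: "finite c" unfolding c_def by (rule finite_quads[OF finite_atLeastAtMost fS])
  have fB: "finite B" by (rule finite_subset[OF B]) (use finite_latin_squares in simp)
  have K: "0 \<le> K" using \<mu> unfolding K_def total_err_def err_factor_def
    by (intro mult_nonneg_nonneg zero_le_power prod_nonneg) auto
  show ?case
  proof (cases "\<exists>L\<in>B. P \<subseteq> square_graph n L")
    case False
    then have e: "{L. L \<in> B \<and> P \<subseteq> square_graph n L} = {}" by blast
    have "0 \<le> K * \<mu> * entry_weight n \<epsilon> S P" using K \<mu> \<epsilon>
      by (intro mult_nonneg_nonneg) (auto simp: entry_weight_def)
    then show ?thesis unfolding e K_def by (simp add: mult_ac)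
  next
    case True
    then obtain L where L: "L \<in> B" "P \<subseteq> square_graph n L" by blast
    then have "functional P" using functional_subset_square_graph by blast
    moreover have "card P \<le> M" using Suc.prems(2) by simp
    moreover have "real (card (quads_in {1..n} S P)) \<le> b"
    proof -
      have "\<not> seeded n S M b L" using L(1) B by auto
      then show ?thesis
        using L(2) \<open>card P \<le> M\<close> Suc.prems(1) unfolding seeded_def by (meson not_le)
    qed
    ultimately have st: "(\<Sum>I\<in>c. entry_weight n \<epsilon> S (P \<union> ents I)) \<le> \<mu> * entry_weight n \<epsilon> S P"
      unfolding c_def using step Suc.prems(1) by blast
    have Jsum: "J L = (\<Sum>I\<in>c. of_bool (ents I \<subseteq> square_graph n L))" for L
      using fc by (simp add: J_def quads_in_def c_def Int_def)
    have "(\<Sum>L | L \<in> B \<and> P \<subseteq> square_graph n L. J L ^ Suc l) =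
        (\<Sum>L | L \<in> B \<and> P \<subseteq> square_graph n L. \<Sum>I\<in>c. of_bool (ents I \<subseteq> square_graph n L) * J L ^ l)"
      by (simp only: power_Suc sum_distrib_right[symmetric] Jsum[symmetric])
    also have "\<dots> = (\<Sum>I\<in>c. \<Sum>L | L \<in> B \<and> P \<subseteq> square_graph n L. of_bool (ents I \<subseteq> square_graph n L) * J L ^ l)"
      by (rule sum.swap)
    also have "\<dots> = (\<Sum>I\<in>c. \<Sum>L | L \<in> B \<and> P \<union> ents I \<subseteq> square_graph n L. J L ^ l)"
    proof (rule sum.cong[OF refl])
      fix I assume "I \<in> c"
      show "(\<Sum>L | L \<in> B \<and> P \<subseteq> square_graph n L. of_bool (ents I \<subseteq> square_graph n L) * J L ^ l) =
          (\<Sum>L | L \<in> B \<and> P \<union> ents I \<subseteq> square_graph n L. J L ^ l)"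
        using fB by (intro sum.mono_neutral_cong_right) auto
    qed
    also have "\<dots> \<le> (\<Sum>I\<in>c. K * entry_weight n \<epsilon> S (P \<union> ents I))"
    proof (rule sum_mono)
      fix I assume I: "I \<in> c"
      have e: "ents I \<subseteq> entry_space n S" using I ents_subset unfolding c_def by blast
      have "card (ents I) = 4" using card_ents_minus[of I "{1..n}" S "{}"] I by (simp add: c_def)
      then have "card (P \<union> ents I) + 4 * l \<le> M"
        using card_Un_le[of P "ents I"] Suc.prems(2) by simp
      then show "(\<Sum>L | L \<in> B \<and> P \<union> ents I \<subseteq> square_graph n L. J L ^ l) \<le> K * entry_weight n \<epsilon> S (P \<union> ents I)"
        unfolding J_def K_def using e Suc.prems(1) by (intro Suc.IH) blast+
    qed
    also have "\<dots> \<le> K * (\<mu> * entry_weight n \<epsilon> S P)"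
      unfolding sum_distrib_left[symmetric] using st K by (rule mult_left_mono)
    finally show ?thesis unfolding J_def K_def by (simp add: mult_ac)
  qed
qed

text \<open>Markov's inequality for the \<open>l\<close>-th moment, started with no prescribed
  entries.\<close>

corollary card_unseeded_le:
  fixes n :: nat
  assumes n: "0 < n" and \<epsilon>: "0 < \<epsilon>" "\<epsilon> \<le> 1 / 8"
    and S: "S \<subseteq> {1..n}" "real (card S) \<le> \<epsilon> * real n"
    and step: "\<And>P. P \<subseteq> entry_space n S \<Longrightarrow> functional P \<Longrightarrow> card P \<le> 4 * l \<Longrightarrow>
      real (card (quads_in {1..n} S P)) \<le> b \<Longrightarrow>
      (\<Sum>I\<in>quads {1..n} S. entry_weight n \<epsilon> S (P \<union> ents I)) \<le> \<mu> * entry_weight n \<epsilon> S P"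
    and \<mu>: "0 \<le> \<mu>" and \<theta>: "0 \<le> \<theta>"
  shows "real (card {L \<in> latin_squares n. \<theta> \<le> quad_count n S L \<and>
      \<not> seeded n S (4 * l) b L}) * \<theta> ^ l \<le> real (card (latin_squares n)) * total_err n * \<mu> ^ l"
proof -
  define B where "B = {L \<in> latin_squares n. \<theta> \<le> quad_count n S L \<and>
      \<not> seeded n S (4 * l) b L}"
  have "real (card B) * \<theta> ^ l = (\<Sum>L\<in>B. \<theta> ^ l)" by simp
  also have "\<dots> \<le> (\<Sum>L\<in>B. quad_count n S L ^ l)"
    using \<theta> by (intro sum_mono power_mono) (auto simp: B_def)
  also have "\<dots> \<le> real (card (latin_squares n)) * total_err n * \<mu> ^ l"
  proof -
    have "B \<subseteq> {L \<in> latin_squares n. \<not> seeded n S (4 * l) b L}" by (auto simp: B_def)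
    from moment_bound[OF n \<epsilon> S step \<mu> this, where P = "{}" and l = l]
    show ?thesis using \<epsilon> by (simp add: entry_weight_empty)
  qed
  finally show ?thesis unfolding B_def .
qed

section \<open>Cores\<close>

definition partial_latin :: "cell_entry set \<Rightarrow> bool" where
  "partial_latin P \<longleftrightarrow> (\<forall>i x a b. ((i, x), a) \<in> P \<longrightarrow> ((i, x), b) \<in> P \<longrightarrow> a = b) \<and>
     (\<forall>i x y a. ((i, x), a) \<in> P \<longrightarrow> ((i, y), a) \<in> P \<longrightarrow> x = y) \<and>
     (\<forall>i j x a. ((i, x), a) \<in> P \<longrightarrow> ((j, x), a) \<in> P \<longrightarrow> i = j)"

lemma partial_latinD:
  assumes "partial_latin P"
  shows "((i, x), a) \<in> P \<Longrightarrow> ((i, x), b) \<in> P \<Longrightarrow> a = b"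
    and "((i, x), a) \<in> P \<Longrightarrow> ((i, y), a) \<in> P \<Longrightarrow> x = y"
    and "((i, x), a) \<in> P \<Longrightarrow> ((j, x), a) \<in> P \<Longrightarrow> i = j"
  using assms unfolding partial_latin_def by blast+

lemma partial_latin_square_graph:
  assumes "L \<in> latin_squares n" "P \<subseteq> square_graph n L"
  shows "partial_latin P"
proof -
  have e: "L (i, x) = a" "i \<in> {1..n}" "x \<in> {1..n}" if "((i, x), a) \<in> P" for i x a
    using assms(2) that by (auto simp: square_graph_def)
  have L: "L \<in> latin_rects n {1..n}" using assms(1) unfolding latin_rects_full .
  have row: "inj_on (\<lambda>x. L (i, x)) {1..n}" and col: "inj_on (\<lambda>j. L (j, i)) {1..n}" if "i \<in> {1..n}" for i
    using L that unfolding latin_rects_def by blast+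
  have "x = y" if "((i, x), a) \<in> P" "((i, y), a) \<in> P" for i x y a
    using e[OF that(1)] e[OF that(2)] inj_onD[OF row, of i x y] by simp
  moreover have "i = j" if "((i, x), a) \<in> P" "((j, x), a) \<in> P" for i j x a
    using e[OF that(1)] e[OF that(2)] inj_onD[OF col, of x i j] by simp
  moreover have "a = b" if "((i, x), a) \<in> P" "((i, x), b) \<in> P" for i x a b
    using e(1)[OF that(1)] e(1)[OF that(2)] by (rule trans[OF sym])
  ultimately show ?thesis unfolding partial_latin_def by blast
qed

lemma quads_in_eq: "quads_in N S P = {I \<in> quads N S. q1 I \<in> P \<and> q2 I \<in> P \<and> q3 I \<in> P \<and> q4 I \<in> P}"
  by (auto simp: quads_in_def ents_eq)

text \<open>At most \<open>sqrt s\<close> rows contain more than \<open>sqrt s\<close> of the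
  \<open>s\<close> entries. If the first row of a quad is among them, that row and the entry
  \<open>q2\<close> determine the quad. Otherwise \<open>q1\<close> and its row-mate
  \<open>q3\<close> do, with at most \<open>sqrt s\<close> choices for the latter. This is the
  source of the lower bound of order \<open>n powr (4/3)\<close> for cores.\<close>

lemma card_quads_in_le:
  assumes fin: "finite S" "finite P" and P: "P \<subseteq> (S \<times> N) \<times> N" and pl: "partial_latin P"
  shows "real (card (quads_in N S P)) \<le> 2 * real (card P) * sqrt (real (card P))"
proof (cases "card P = 0")
  case True
  then have "P = {}" using fin by simp
  then show ?thesis by (simp add: quads_in_eq)
next
  case False
  define s where "s = real (card P)"
  have s: "0 < s" using False by (simp add: s_def)
  define H where "H = {i \<in> S. sqrt s < real (card (row_part P i))}"
  have fH: "finite H" using fin by (simp add: H_def)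
  have fr: "finite (row_part P i)" for i
  proof -
    have "row_part P i \<subseteq> (\<lambda>((i, x), a). (x, a)) ` P" by (force simp: row_part_def)
    then show ?thesis using fin finite_surj by blast
  qed
  note D = partial_latinD[OF pl]
  have "real (card H) * sqrt s = (\<Sum>i\<in>H. sqrt s)" by simp
  also have "\<dots> \<le> (\<Sum>i\<in>H. real (card (row_part P i)))" by (intro sum_mono) (simp add: H_def less_imp_le)
  also have "\<dots> \<le> (\<Sum>i\<in>S. real (card (row_part P i)))"
    using fin by (intro sum_mono2) (auto simp: H_def)
  also have "\<dots> = sqrt s * sqrt s"
    using sum_card_row_part[OF fin P] s by (simp add: s_def flip: of_nat_sum)
  finally have H: "real (card H) \<le> sqrt s" using s by (meson mult_right_le_imp_le real_sqrt_gt_zero)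
  define U where "U = {I \<in> quads N S. q1 I \<in> P \<and> q2 I \<in> P \<and> q3 I \<in> P \<and> q4 I \<in> P \<and> fst (fst I) \<in> H}"
  define V where "V = {I \<in> quads N S. q1 I \<in> P \<and> q2 I \<in> P \<and> q3 I \<in> P \<and> q4 I \<in> P \<and> fst (fst I) \<notin> H}"
  have "card U \<le> card (P \<times> H)"
  proof (rule card_inj_on_le[where f = "\<lambda>I. (q2 I, fst (fst I))"])
    show "inj_on (\<lambda>I. (q2 I, fst (fst I))) U"
      by (auto simp: inj_on_def U_def quads_def q_defs dest: D)
  qed (use fin fH in \<open>auto simp: U_def\<close>)
  then have "real (card U) \<le> s * real (card H)"
    unfolding card_cartesian_product s_def by (metis of_nat_le_iff of_nat_mult)
  also have "\<dots> \<le> s * sqrt s" using H s by (intro mult_left_mono) auto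
  finally have U: "real (card U) \<le> s * sqrt s" .
  define Z where "Z = (SIGMA e:{e \<in> P. fst (fst e) \<notin> H}. row_part P (fst (fst e)))"
  have "card V \<le> card Z"
  proof (rule card_inj_on_le[where f = "\<lambda>I. (q1 I, snd (fst (q3 I)), snd (q3 I))"])
    show "inj_on (\<lambda>I. (q1 I, snd (fst (q3 I)), snd (q3 I))) V"
      by (auto simp: inj_on_def V_def quads_def q_defs dest: D)
    show "(\<lambda>I. (q1 I, snd (fst (q3 I)), snd (q3 I))) ` V \<subseteq> Z"
      by (auto simp: V_def Z_def quads_def q_defs row_part_def)
    show "finite Z" unfolding Z_def using fin fr by (intro finite_SigmaI) auto
  qed
  also have "card Z = (\<Sum>e | e \<in> P \<and> fst (fst e) \<notin> H. card (row_part P (fst (fst e))))"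
    unfolding Z_def using fin fr by simp
  finally have "real (card V) \<le> real (\<Sum>e | e \<in> P \<and> fst (fst e) \<notin> H. card (row_part P (fst (fst e))))"
    by (rule of_nat_mono)
  also have "\<dots> = (\<Sum>e | e \<in> P \<and> fst (fst e) \<notin> H. real (card (row_part P (fst (fst e)))))"
    by (rule of_nat_sum)
  also have "\<dots> \<le> (\<Sum>e | e \<in> P \<and> fst (fst e) \<notin> H. sqrt s)"
    using P by (intro sum_mono) (auto simp: H_def not_less)
  also have "\<dots> = real (card {e \<in> P. fst (fst e) \<notin> H}) * sqrt s" by simp
  also have "\<dots> \<le> s * sqrt s"
    using fin unfolding s_def by (intro mult_right_mono of_nat_mono card_mono) auto
  finally have V: "real (card V) \<le> s * sqrt s" .
  have "quads_in N S P = U \<union> V" by (auto simp: quads_in_eq U_def V_def)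
  then have "card (quads_in N S P) \<le> card U + card V" by (simp add: card_Un_le)
  then have "real (card (quads_in N S P)) \<le> real (card U) + real (card V)" by linarith
  then have "real (card (quads_in N S P)) \<le> s * sqrt s + s * sqrt s" using U V by linarith
  then show ?thesis by (simp add: s_def)
qed

abbreviation quads_through where
  "quads_through N S P e \<equiv> {I \<in> quads_in N S P. e \<in> ents I}"

text \<open>\<open>\<kappa>\<close> is row, column or symbol, and \<open>m1\<close> to
  \<open>m4\<close> send each entry of a quad to the other entry with the same
  \<open>\<kappa>\<close>. An entry together with this partner determines the quad; the 4 is the
  number of positions that \<open>e\<close> may take.\<close>

lemma card_quads_through_le_aux:
  assumes fin: "finite P"
    and m: "\<And>I. I \<in> quads_in N S P \<Longrightarrow> \<kappa> (m1 I) = \<kappa> (q1 I) \<and> \<kappa> (m2 I) = \<kappa> (q2 I) \<and>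
      \<kappa> (m3 I) = \<kappa> (q3 I) \<and> \<kappa> (m4 I) = \<kappa> (q4 I) \<and> m1 I \<in> P \<and> m2 I \<in> P \<and> m3 I \<in> P \<and> m4 I \<in> P"
    and inj: "inj_on m1 {I \<in> quads_in N S P. q1 I = e}" "inj_on m2 {I \<in> quads_in N S P. q2 I = e}"
      "inj_on m3 {I \<in> quads_in N S P. q3 I = e}" "inj_on m4 {I \<in> quads_in N S P. q4 I = e}"
  shows "card (quads_through N S P e) \<le> 4 * card {e' \<in> P. \<kappa> e' = \<kappa> e}"
proof -
  have f: "finite {e' \<in> P. \<kappa> e' = \<kappa> e}" using fin by simp
  have "card {I \<in> quads_in N S P. q1 I = e} \<le> card {e' \<in> P. \<kappa> e' = \<kappa> e}"
    by (rule card_inj_on_le[OF inj(1) _ f]) (use m in auto)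
  moreover have "card {I \<in> quads_in N S P. q2 I = e} \<le> card {e' \<in> P. \<kappa> e' = \<kappa> e}"
    by (rule card_inj_on_le[OF inj(2) _ f]) (use m in auto)
  moreover have "card {I \<in> quads_in N S P. q3 I = e} \<le> card {e' \<in> P. \<kappa> e' = \<kappa> e}"
    by (rule card_inj_on_le[OF inj(3) _ f]) (use m in auto)
  moreover have "card {I \<in> quads_in N S P. q4 I = e} \<le> card {e' \<in> P. \<kappa> e' = \<kappa> e}"
    by (rule card_inj_on_le[OF inj(4) _ f]) (use m in auto)
  moreover have "(quads_through N S P e) = ({I \<in> quads_in N S P. q1 I = e} \<union> {I \<in> quads_in N S P. q2 I = e}) \<union>
     ({I \<in> quads_in N S P. q3 I = e} \<union> {I \<in> quads_in N S P. q4 I = e})" by (auto simp: ents_eq)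
  then have "card (quads_through N S P e) \<le> (card {I \<in> quads_in N S P. q1 I = e} +
     card {I \<in> quads_in N S P. q2 I = e}) + (card {I \<in> quads_in N S P. q3 I = e} + card {I \<in> quads_in N S P. q4 I = e})"
    by (simp only:) (rule order_trans[OF card_Un_le add_mono[OF card_Un_le card_Un_le]])
  ultimately show ?thesis by linarith
qed

lemma card_quads_through_le:
  assumes fin: "finite P" and pl: "partial_latin P"
  shows "card (quads_through N S P e) \<le> 4 * card {e' \<in> P. fst (fst e') = fst (fst e)}"
    and "card (quads_through N S P e) \<le> 4 * card {e' \<in> P. snd (fst e') = snd (fst e)}"
    and "card (quads_through N S P e) \<le> 4 * card {e' \<in> P. snd e' = snd e}"
proof -
  note D = partial_latinD[OF pl]
  show "card (quads_through N S P e) \<le> 4 * card {e' \<in> P. fst (fst e') = fst (fst e)}"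
    by (rule card_quads_through_le_aux[OF fin, where ?m1.0 = q3 and ?m2.0 = q4 and ?m3.0 = q1 and ?m4.0 = q2])
       (auto simp: inj_on_def quads_in_eq quads_def q_defs dest: D)
  show "card (quads_through N S P e) \<le> 4 * card {e' \<in> P. snd (fst e') = snd (fst e)}"
    by (rule card_quads_through_le_aux[OF fin, where ?m1.0 = q4 and ?m2.0 = q3 and ?m3.0 = q2 and ?m4.0 = q1])
       (auto simp: inj_on_def quads_in_eq quads_def q_defs dest: D)
  show "card (quads_through N S P e) \<le> 4 * card {e' \<in> P. snd e' = snd e}"
    by (rule card_quads_through_le_aux[OF fin, where ?m1.0 = q2 and ?m2.0 = q1 and ?m3.0 = q4 and ?m4.0 = q3])
       (auto simp: inj_on_def quads_in_eq quads_def q_defs dest: D)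
qed

text \<open>A subset maximising the number of quads minus \<open>D\<close> times the number of entries works, since deleting an entry cannot increase this quantity.\<close>

lemma exists_core:
  assumes fin: "finite P" "finite (quads N S)" and D: "0 \<le> D" "D * real (card P) \<le> b / 2"
    and b: "b \<le> real (card (quads_in N S P))"
  obtains P' where "P' \<subseteq> P" "b / 2 \<le> real (card (quads_in N S P'))"
    "\<And>e. e \<in> P' \<Longrightarrow> D \<le> real (card (quads_through N S P' e))"
proof -
  define f where "f Z = real (card (quads_in N S Z)) - D * real (card Z)" for Z
  have fin': "finite (f ` Pow P)" "f ` Pow P \<noteq> {}" using fin by auto
  obtain P' where P': "P' \<subseteq> P" "f P' = Max (f ` Pow P)"
    using Max_in[OF fin'] by (metis PowD imageE)
  have max: "f Z \<le> f P'" if "Z \<subseteq> P" for Z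
    unfolding P'(2) using that fin' by (intro Max_ge) auto
  have fP': "finite P'" using P' fin finite_subset by blast
  show ?thesis
  proof (rule that)
    have "b / 2 \<le> f P" using D b unfolding f_def by linarith
    also have "\<dots> \<le> f P'" by (rule max) simp
    also have "\<dots> \<le> real (card (quads_in N S P'))" using D by (simp add: f_def)
    finally show "b / 2 \<le> real (card (quads_in N S P'))" .
    fix e assume e: "e \<in> P'"
    define T where "T = (quads_through N S P' e)"
    have fq: "finite (quads_in N S P')" using fin by (simp add: quads_in_def)
    have "quads_in N S (P' - {e}) = quads_in N S P' - T" by (auto simp: quads_in_def T_def)
    then have "card (quads_in N S (P' - {e})) = card (quads_in N S P') - card T"
      using fq by (simp add: card_Diff_subset T_def)
    moreover have "card T \<le> card (quads_in N S P')" using fq by (intro card_mono) (auto simp: T_def)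
    ultimately have c1: "real (card (quads_in N S (P' - {e}))) = real (card (quads_in N S P')) - real (card T)"
      by (simp add: of_nat_diff)
    have "Suc (card (P' - {e})) = card P'" using card_Suc_Diff1[OF fP' e] .
    then have c2: "real (card P') = real (card (P' - {e})) + 1" by linarith
    have "f (P' - {e}) \<le> f P'" using P' by (intro max) auto
    then show "D \<le> real (card (quads_through N S P' e))"
      unfolding f_def c1 c2 T_def[symmetric] by (simp add: algebra_simps)
  qed (use P' in simp)
qed

lemma card_image_mult_le:
  fixes D :: real
  assumes fin: "finite P" and D: "\<And>e. e \<in> P \<Longrightarrow> D \<le> real (card {e' \<in> P. \<kappa> e' = \<kappa> e})"
  shows "real (card (\<kappa> ` P)) * D \<le> real (card P)"
proof -
  have "real (card (\<kappa> ` P)) * D = (\<Sum>y\<in>\<kappa> ` P. D)" by simp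
  also have "\<dots> \<le> (\<Sum>y\<in>\<kappa> ` P. real (card {e' \<in> P. \<kappa> e' = y}))"
    using D by (intro sum_mono) auto
  also have "\<dots> = real (card P)"
    using sum.image_gen[OF fin, of "\<lambda>_. 1::real" \<kappa>] by simp
  finally show ?thesis .
qed

section \<open>Union bound over boxes that may contain a core\<close>

lemma sum_Pow_power_card:
  fixes y :: real
  assumes "finite A"
  shows "(\<Sum>X\<in>Pow A. y ^ card X) = (1 + y) ^ card A"
  using prod_add[OF assms, of "\<lambda>_. y" "\<lambda>_. 1"] by (simp add: add.commute)

text \<open>Exponential Markov inequality: insert \<open>z powr (card X - s) \<ge> 1\<close> and
  drop the size condition. The gain \<open>z powr (- s)\<close>, with \<open>z\<close> a power of
  \<open>n\<close>, is what produces the factor \<open>ln n\<close> in the exponent.\<close>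

lemma sum_Pow_card_ge_le:
  fixes p z s :: real
  assumes A: "finite A" and p: "0 \<le> p" and z: "1 \<le> z"
  shows "(\<Sum>X | X \<subseteq> A \<and> s \<le> real (card X). p ^ card X) \<le> z powr (- s) * exp (p * z * real (card A))"
proof -
  have "(\<Sum>X | X \<subseteq> A \<and> s \<le> real (card X). p ^ card X) \<le>
      (\<Sum>X | X \<subseteq> A \<and> s \<le> real (card X). z powr (- s) * (p * z) ^ card X)"
  proof (rule sum_mono)
    fix X assume X: "X \<in> {X. X \<subseteq> A \<and> s \<le> real (card X)}"
    have "1 \<le> z powr (real (card X) - s)" using X z by (intro ge_one_powr_ge_zero) auto
    then have "p ^ card X * 1 \<le> p ^ card X * z powr (real (card X) - s)" using p by (intro mult_left_mono) auto
    also have "z powr (real (card X) - s) = z ^ card X * z powr (- s)"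
      using z by (simp add: powr_diff powr_minus powr_realpow divide_inverse)
    finally show "p ^ card X \<le> z powr (- s) * (p * z) ^ card X" by (simp add: power_mult_distrib mult_ac)
  qed
  also have "\<dots> \<le> (\<Sum>X\<in>Pow A. z powr (- s) * (p * z) ^ card X)"
    using A p z by (intro sum_mono2) auto
  also have "\<dots> = z powr (- s) * (1 + p * z) ^ card A"
    using sum_Pow_power_card[OF A, of "p * z"] by (simp flip: sum_distrib_left)
  also have "(1 + p * z) ^ card A \<le> exp (p * z) ^ card A"
    using p z by (intro power_mono exp_ge_add_one_self add_nonneg_nonneg mult_nonneg_nonneg) auto
  also have "exp (p * z) ^ card A = exp (p * z * real (card A))"
    by (simp add: exp_of_nat2_mult)
  finally show ?thesis by (simp add: mult_left_mono)
qed

lemma entry_weight_le_power: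
  assumes "finite S" "finite P" "P \<subseteq> (S \<times> B) \<times> C" and \<epsilon>: "0 < \<epsilon>" "\<epsilon> \<le> 1 / 8"
  shows "entry_weight n \<epsilon> S P \<le> (1 / ((1 - \<epsilon>) * real n) * exp 3) ^ card P"
proof -
  have "entry_weight n \<epsilon> S ({} \<union> P) \<le> entry_weight n \<epsilon> S {} * (1 / ((1 - \<epsilon>) * real n) * exp 3) ^ card P"
    by (rule entry_weight_Un_le[OF assms(1) _ assms(2) _ assms(3) \<epsilon>])
       (auto intro: row_weight_add_le(1)[OF \<epsilon>])
  then show ?thesis using \<epsilon> by (simp add: entry_weight_empty)
qed

text \<open>Each entry of the core lies in \<open>D\<close> of its quads, so its row, its column and
  its symbol each contain at least \<open>D / 4\<close> core entries. As there are at most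
  \<open>M\<close> entries, at most \<open>4 * M / D\<close> rows, columns and symbols occur. The
  size of the core comes from comparing \<open>b / 2\<close> with
  \<open>2 * s * sqrt s\<close>.\<close>

lemma core_of_seeded:
  assumes L: "L \<in> latin_squares n" "seeded n S M b L" and S: "S \<subseteq> {1..n}" and b: "0 < b" and M: "0 < M"
  obtains P R X Y where "P \<subseteq> square_graph n L" "P \<subseteq> entry_space n S" "P \<subseteq> (R \<times> X) \<times> Y"
    "R \<subseteq> {1..n}" "X \<subseteq> {1..n}" "Y \<subseteq> {1..n}" "(b / 4) powr (2 / 3) \<le> real (card P)"
    "real (card R) \<le> 8 * (real M)\<^sup>2 / b" "real (card X) \<le> 8 * (real M)\<^sup>2 / b" "real (card Y) \<le> 8 * (real M)\<^sup>2 / b"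
proof -
  obtain Z where Z: "Z \<subseteq> square_graph n L" "Z \<subseteq> entry_space n S" "card Z \<le> M"
     "b < real (card (quads_in {1..n} S Z))"
    using L(2) unfolding seeded_def by blast
  \<comment> \<open>The largest degree for which pruning up to \<open>M\<close> entries loses at
    most half of the \<open>b\<close> quads.\<close>
  define D where "D = b / (2 * real M)"
  have D: "0 < D" using b M by (simp add: D_def)
  have fS: "finite S" using S finite_subset by blast
  have fZ: "finite Z" by (rule finite_subset[OF Z(2)]) (use fS in auto)
  have fq: "finite (quads {1..n} S)" by (rule finite_quads[OF finite_atLeastAtMost fS])
  have "D * real (card Z) \<le> D * real M" using D Z(3) by (intro mult_left_mono) auto
  also have "\<dots> = b / 2" using M by (simp add: D_def)
  finally have DZ: "D * real (card Z) \<le> b / 2" .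
  obtain P where P: "P \<subseteq> Z" "b / 2 \<le> real (card (quads_in {1..n} S P))"
    "\<And>e. e \<in> P \<Longrightarrow> D \<le> real (card (quads_through {1..n} S P e))"
    using exists_core[OF fZ fq less_imp_le[OF D] DZ less_imp_le[OF Z(4)]] by blast
  have fP: "finite P" using P(1) fZ finite_subset by blast
  have Pg: "P \<subseteq> square_graph n L" and PS: "P \<subseteq> entry_space n S" using P(1) Z by auto
  have pl: "partial_latin P" by (rule partial_latin_square_graph[OF L(1) Pg])
  have cP: "real (card P) \<le> real M" using card_mono[OF fZ P(1)] Z(3) by simp
  have img: "real (card (\<kappa> ` P)) \<le> 8 * (real M)\<^sup>2 / b"
    if \<kappa>: "\<And>e. card (quads_through {1..n} S P e) \<le> 4 * card {e' \<in> P. \<kappa> e' = \<kappa> e}"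
    for \<kappa> :: "cell_entry \<Rightarrow> nat"
  proof -
    have "D / 4 \<le> real (card {e' \<in> P. \<kappa> e' = \<kappa> e})" if "e \<in> P" for e
      using P(3)[OF that] of_nat_mono[OF \<kappa>[of e], where 'a = real] by simp
    then have "real (card (\<kappa> ` P)) * (D / 4) \<le> real (card P)" by (rule card_image_mult_le[OF fP])
    then have "real (card (\<kappa> ` P)) * (D / 4) \<le> real M" using cP by linarith
    then have "real (card (\<kappa> ` P)) \<le> real M / (D / 4)" using D by (simp add: pos_le_divide_eq)
    also have "\<dots> = 8 * (real M)\<^sup>2 / b" using b M by (simp add: D_def power2_eq_square field_simps)
    finally show ?thesis .
  qed
  show ?thesis
  proof (rule that[OF Pg PS, of "(\<lambda>e. fst (fst e)) ` P" "(\<lambda>e. snd (fst e)) ` P" "snd ` P"])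
    show "P \<subseteq> ((\<lambda>e. fst (fst e)) ` P \<times> (\<lambda>e. snd (fst e)) ` P) \<times> snd ` P" by force
    show "(\<lambda>e. fst (fst e)) ` P \<subseteq> {1..n}" "(\<lambda>e. snd (fst e)) ` P \<subseteq> {1..n}" "snd ` P \<subseteq> {1..n}"
      using PS S by fastforce+
    show "real (card ((\<lambda>e. fst (fst e)) ` P)) \<le> 8 * (real M)\<^sup>2 / b"
      "real (card ((\<lambda>e. snd (fst e)) ` P)) \<le> 8 * (real M)\<^sup>2 / b"
      "real (card (snd ` P)) \<le> 8 * (real M)\<^sup>2 / b"
      by (rule img card_quads_through_le[OF fP pl])+
    define s where "s = real (card P)"
    have "b / 2 \<le> 2 * s * sqrt s"
      using P(2) card_quads_in_le[OF fS fP PS pl] unfolding s_def by linarith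
    then have bs: "b / 4 \<le> s * sqrt s" by simp
    have "s \<noteq> 0" using bs b by auto
    then have s: "0 < s" by (simp add: s_def)
    have "s * sqrt s = s powr (3 / 2)"
      using s powr_add[of s 1 "1 / 2"] by (simp add: powr_half_sqrt)
    then have "(b / 4) powr (2 / 3) \<le> (s powr (3 / 2)) powr (2 / 3)"
      using bs b by (intro powr_mono2) auto
    also have "\<dots> = s" using s by (simp add: powr_powr)
    finally show "(b / 4) powr (2 / 3) \<le> real (card P)" by (simp add: s_def)
  qed
qed

abbreviation seed_bound :: "nat \<Rightarrow> real \<Rightarrow> real \<Rightarrow> real \<Rightarrow> real \<Rightarrow> real" where
  "seed_bound n b z Q V \<equiv> 8 ^ n * (z powr (- ((b / 4) powr (2 / 3))) * exp (Q * z * V ^ 3))"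

text \<open>The union runs first over the boxes spanned by the rows, columns and symbols of a core,
  then over large subsets of the box. Counting boxes crudely by \<open>8 ^ n\<close> is affordable.
  A box has at most \<open>V ^ 3\<close> entries, each of weight at most \<open>Q\<close>.\<close>

lemma card_seeded_le:
  fixes n M :: nat and b z :: real
  assumes n: "0 < n" and \<epsilon>: "0 < \<epsilon>" "\<epsilon> \<le> 1 / 8"
    and S: "S \<subseteq> {1..n}" "real (card S) \<le> \<epsilon> * real n"
    and b: "0 < b" and M: "0 < M" and z: "1 \<le> z"
    and Q: "Q = 1 / ((1 - \<epsilon>) * real n) * exp 3" and V: "V = 8 * (real M)\<^sup>2 / b"
  shows "real (card {L \<in> latin_squares n. seeded n S M b L}) \<le> real (card (latin_squares n)) *
    (total_err n * (seed_bound n b z Q V))"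
proof -
  define s where "s = (b / 4) powr (2 / 3)"
  define T where "T = {(R, X, Y) | R X Y. R \<subseteq> {1..n} \<and> X \<subseteq> {1..n} \<and> Y \<subseteq> {1..n} \<and>
     real (card R) \<le> V \<and> real (card X) \<le> V \<and> real (card Y) \<le> V}"
  define C where "C = (\<lambda>(R, X, Y). {P. P \<subseteq> ((R \<times> X) \<times> Y) \<inter> (entry_space n S) \<and> s \<le> real (card P)})"
  define K where "K = real (card (latin_squares n)) * total_err n"
  define ext where "ext P = {L \<in> latin_squares n. \<forall>(p, a)\<in>P. L p = a}" for P :: "cell_entry set"
  have K: "0 \<le> K" unfolding K_def by (simp add: total_err_nonneg)
  have Q0: "0 \<le> Q" using \<epsilon> by (simp add: Q)
  have fS: "finite S" using S finite_subset by blast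
  have Tsub: "T \<subseteq> Pow {1..n} \<times> Pow {1..n} \<times> Pow {1..n}" by (auto simp: T_def)
  have fT: "finite T" by (rule finite_subset[OF Tsub]) auto
  have cT: "real (card T) \<le> 8 ^ n"
  proof -
    have "card T \<le> card (Pow {1..n} \<times> Pow {1..n} \<times> Pow {1..n})" by (rule card_mono[OF _ Tsub]) auto
    also have "\<dots> = 8 ^ n" by (simp add: card_cartesian_product card_Pow flip: power_mult_distrib)
    finally have "real (card T) \<le> real (8 ^ n)" by (rule of_nat_mono)
    then show ?thesis by simp
  qed
  have fC: "finite (C t)" for t
  proof -
    have "C t \<subseteq> Pow (entry_space n S)" by (cases t) (auto simp: C_def)
    then show ?thesis by (rule finite_subset) (use fS in auto)
  qed
  have extf: "finite (ext P)" for P using finite_latin_squares by (simp add: ext_def)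
  have cover: "{L \<in> latin_squares n. seeded n S M b L} \<subseteq> (\<Union>t\<in>T. \<Union>P\<in>C t. ext P)"
  proof
    fix L assume "L \<in> {L \<in> latin_squares n. seeded n S M b L}"
    then have L: "L \<in> latin_squares n" "seeded n S M b L" by auto
    obtain P R X Y where P: "P \<subseteq> square_graph n L" "P \<subseteq> entry_space n S" "P \<subseteq> (R \<times> X) \<times> Y"
      "R \<subseteq> {1..n}" "X \<subseteq> {1..n}" "Y \<subseteq> {1..n}" "(b / 4) powr (2 / 3) \<le> real (card P)"
      "real (card R) \<le> 8 * (real M)\<^sup>2 / b" "real (card X) \<le> 8 * (real M)\<^sup>2 / b" "real (card Y) \<le> 8 * (real M)\<^sup>2 / b"
      using core_of_seeded[OF L S(1) b M] .
    have "(R, X, Y) \<in> T" using P unfolding T_def V by blast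
    moreover have "P \<in> C (R, X, Y)" using P unfolding C_def s_def by blast
    moreover have "P \<subseteq> entry_space n {1..n}" using P(2) S by blast
    from subset_square_graph_iff[OF this, THEN iffD1, OF P(1)]
    have "L \<in> ext P" using L(1) unfolding ext_def by (intro CollectI conjI)
    ultimately show "L \<in> (\<Union>t\<in>T. \<Union>P\<in>C t. ext P)" by blast
  qed
  have "card {L \<in> latin_squares n. seeded n S M b L} \<le> card (\<Union>t\<in>T. \<Union>P\<in>C t. ext P)"
    using fT fC extf by (intro card_mono[OF _ cover]) blast
  also have "\<dots> \<le> (\<Sum>t\<in>T. card (\<Union>P\<in>C t. ext P))" by (rule card_UN_le[OF fT])
  also have "\<dots> \<le> (\<Sum>t\<in>T. \<Sum>P\<in>C t. card (ext P))" by (intro sum_mono card_UN_le fC)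
  finally have "real (card {L \<in> latin_squares n. seeded n S M b L}) \<le> real (\<Sum>t\<in>T. \<Sum>P\<in>C t. card (ext P))"
    by (rule of_nat_mono)
  also have "\<dots> = (\<Sum>t\<in>T. \<Sum>P\<in>C t. real (card (ext P)))" by simp
  also have "\<dots> \<le> (\<Sum>t\<in>T. K * (z powr (- s) * exp (Q * z * V ^ 3)))"
  proof (rule sum_mono)
    fix t assume t: "t \<in> T"
    then obtain R X Y where RXY: "t = (R, X, Y)" "R \<subseteq> {1..n}" "X \<subseteq> {1..n}" "Y \<subseteq> {1..n}"
      "real (card R) \<le> V" "real (card X) \<le> V" "real (card Y) \<le> V" unfolding T_def by blast
    have fin: "finite R" "finite X" "finite Y" using RXY finite_subset by blast+
    have "(\<Sum>P\<in>C t. real (card (ext P))) \<le> (\<Sum>P\<in>C t. K * Q ^ card P)"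
    proof (rule sum_mono)
      fix P assume "P \<in> C t"
      then have P: "P \<subseteq> entry_space n S" using RXY by (auto simp: C_def)
      have fP: "finite P" by (rule finite_subset[OF P]) (use fS in auto)
      have "real (card (ext P)) \<le> real (card (latin_squares n)) * (total_err n * entry_weight n \<epsilon> S P)"
        unfolding ext_def by (rule card_latin_squares_with_le[OF n \<epsilon> S P])
      also have "\<dots> = K * entry_weight n \<epsilon> S P" by (simp add: K_def)
      also have "\<dots> \<le> K * Q ^ card P"
        unfolding Q using entry_weight_le_power[OF fS fP P \<epsilon>] K by (intro mult_left_mono)
      finally show "real (card (ext P)) \<le> K * Q ^ card P" .
    qed
    also have "\<dots> = K * (\<Sum>P\<in>C t. Q ^ card P)" by (rule sum_distrib_left[symmetric])
    also have "(\<Sum>P\<in>C t. Q ^ card P) \<le> (\<Sum>P | P \<subseteq> (R \<times> X) \<times> Y \<and> s \<le> real (card P). Q ^ card P)"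
    proof (rule sum_mono2)
      have "finite ((R \<times> X) \<times> Y)" using fin by simp
      then show "finite {P. P \<subseteq> (R \<times> X) \<times> Y \<and> s \<le> real (card P)}" by simp
    qed (use Q0 RXY in \<open>auto simp: C_def\<close>)
    also have "\<dots> \<le> z powr (- s) * exp (Q * z * real (card ((R \<times> X) \<times> Y)))"
      using fin by (intro sum_Pow_card_ge_le Q0 z) auto
    also have "real (card ((R \<times> X) \<times> Y)) \<le> V ^ 3"
    proof -
      have "real (card R) * real (card X) * real (card Y) \<le> V * V * V"
        using RXY(5-7) by (intro mult_mono) (auto intro: order_trans[OF of_nat_0_le_iff])
      then show ?thesis by (simp add: card_cartesian_product power3_eq_cube)
    qed
    finally show "(\<Sum>P\<in>C t. real (card (ext P))) \<le> K * (z powr (- s) * exp (Q * z * V ^ 3))"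
      using K Q0 z by (simp add: mult_left_mono)
  qed
  also have "\<dots> = real (card T) * (K * (z powr (- s) * exp (Q * z * V ^ 3)))" by simp
  also have "\<dots> \<le> 8 ^ n * (K * (z powr (- s) * exp (Q * z * V ^ 3)))"
    using cT K by (intro mult_right_mono) auto
  finally show ?thesis by (simp add: K_def s_def mult_ac)
qed

section \<open>Averaging over sets of rows\<close>

lemma card_quads_in_square_graph:
  assumes L: "L \<in> latin_squares n" and S: "S \<subseteq> {1..n}"
  shows "card (quads_in {1..n} S (square_graph n L)) =
    card {I \<in> intercalates n L. fst (fst I) \<in> S \<and> snd (fst I) \<in> S}"
proof -
  have LE: "L \<in> {1..n} \<times> {1..n} \<rightarrow>\<^sub>E {1..n}" using L by (simp add: latin_squares_def)
  have g: "((i, x), a) \<in> square_graph n L \<longleftrightarrow> i \<in> {1..n} \<and> x \<in> {1..n} \<and> a = L (i, x)" for i x a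
    unfolding square_graph_def by blast
  have Ln: "L (i, x) \<in> {1..n}" if "i \<in> {1..n}" "x \<in> {1..n}" for i x using PiE_mem[OF LE] that by blast
  define f where "f I = (fst I, fst (snd I))" for I :: quad
  define h where "h I = (fst I, snd I, (L (fst (fst I), fst (snd I)), L (fst (fst I), snd (snd I))))"
    for I :: "(nat \<times> nat) \<times> (nat \<times> nat)"
  have mem: "((i, j), (x, y), (a, b)) \<in> quads_in {1..n} S (square_graph n L) \<longleftrightarrow>
      ((i, j), (x, y)) \<in> intercalates n L \<and> i \<in> S \<and> j \<in> S \<and> a = L (i, x) \<and> b = L (i, y)" for i j x y a b
  proof
    assume "((i, j), (x, y), (a, b)) \<in> quads_in {1..n} S (square_graph n L)"
    then have "((i, j), (x, y), (a, b)) \<in> quads {1..n} S" "ents ((i, j), (x, y), (a, b)) \<subseteq> square_graph n L"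
      unfolding quads_in_def by blast+
    then show "((i, j), (x, y)) \<in> intercalates n L \<and> i \<in> S \<and> j \<in> S \<and> a = L (i, x) \<and> b = L (i, y)"
      unfolding quads_def intercalates_def ents.simps insert_subset g by simp
  next
    assume "((i, j), (x, y)) \<in> intercalates n L \<and> i \<in> S \<and> j \<in> S \<and> a = L (i, x) \<and> b = L (i, y)"
    then have I: "i \<in> {1..n}" "j \<in> {1..n}" "i < j" "x \<in> {1..n}" "y \<in> {1..n}" "x < y"
      "L (i, x) = L (j, y)" "L (i, y) = L (j, x)" "i \<in> S" "j \<in> S" "a = L (i, x)" "b = L (i, y)"
      unfolding intercalates_def by auto
    show "((i, j), (x, y), (a, b)) \<in> quads_in {1..n} S (square_graph n L)"
      unfolding quads_in_def quads_def mem_Collect_eq ents.simps insert_subset g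
      using I Ln[of i x] Ln[of i y] by blast
  qed
  have "bij_betw f (quads_in {1..n} S (square_graph n L))
     {I \<in> intercalates n L. fst (fst I) \<in> S \<and> snd (fst I) \<in> S}"
  proof (rule bij_betw_byWitness[where f' = h])
    show "\<forall>I\<in>quads_in {1..n} S (square_graph n L). h (f I) = I"
    proof
      fix I assume "I \<in> quads_in {1..n} S (square_graph n L)"
      then show "h (f I) = I"
        by (cases I rule: ents.cases) (simp only: mem, simp add: f_def h_def)
    qed
    show "\<forall>I\<in>{I \<in> intercalates n L. fst (fst I) \<in> S \<and> snd (fst I) \<in> S}. f (h I) = I"
      by (simp add: f_def h_def)
    show "f ` quads_in {1..n} S (square_graph n L) \<subseteq> {I \<in> intercalates n L. fst (fst I) \<in> S \<and> snd (fst I) \<in> S}"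
    proof (rule image_subsetI)
      fix I assume "I \<in> quads_in {1..n} S (square_graph n L)"
      then show "f I \<in> {I \<in> intercalates n L. fst (fst I) \<in> S \<and> snd (fst I) \<in> S}"
        by (cases I rule: ents.cases) (simp only: mem, simp add: f_def)
    qed
    show "h ` {I \<in> intercalates n L. fst (fst I) \<in> S \<and> snd (fst I) \<in> S} \<subseteq> quads_in {1..n} S (square_graph n L)"
    proof (rule image_subsetI)
      fix I assume I: "I \<in> {I \<in> intercalates n L. fst (fst I) \<in> S \<and> snd (fst I) \<in> S}"
      obtain i j x y where "I = ((i, j), (x, y))" by (metis surj_pair)
      then show "h I \<in> quads_in {1..n} S (square_graph n L)" using I by (simp add: h_def mem del: One_nat_def)
    qed
  qed
  then show ?thesis by (rule bij_betw_same_card)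
qed

lemma card_supersets_of_pair:
  assumes "finite A" "i \<in> A" "j \<in> A" "i \<noteq> j" "2 \<le> k"
  shows "card {S. S \<subseteq> A \<and> card S = k \<and> i \<in> S \<and> j \<in> S} = (card A - 2) choose (k - 2)"
proof -
  have f: "finite S" if "S \<subseteq> A" for S using that assms finite_subset by blast
  have "bij_betw (\<lambda>S. S - {i, j}) {S. S \<subseteq> A \<and> card S = k \<and> i \<in> S \<and> j \<in> S}
      {T. T \<subseteq> A - {i, j} \<and> card T = k - 2}"
  proof (rule bij_betw_byWitness[where f' = "\<lambda>T. insert i (insert j T)"])
    show "(\<lambda>S. S - {i, j}) ` {S. S \<subseteq> A \<and> card S = k \<and> i \<in> S \<and> j \<in> S} \<subseteq> {T. T \<subseteq> A - {i, j} \<and> card T = k - 2}"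
      using f assms by (auto simp: card_Diff_subset)
    show "(\<lambda>T. insert i (insert j T)) ` {T. T \<subseteq> A - {i, j} \<and> card T = k - 2} \<subseteq> {S. S \<subseteq> A \<and> card S = k \<and> i \<in> S \<and> j \<in> S}"
    proof (rule image_subsetI)
      fix T assume T: "T \<in> {T. T \<subseteq> A - {i, j} \<and> card T = k - 2}"
      then have "finite T" using f[of T] by auto
      moreover have "i \<notin> T" "j \<notin> T" using T by auto
      ultimately show "insert i (insert j T) \<in> {S. S \<subseteq> A \<and> card S = k \<and> i \<in> S \<and> j \<in> S}"
        using T assms by auto
    qed
  qed auto
  then have "card {S. S \<subseteq> A \<and> card S = k \<and> i \<in> S \<and> j \<in> S} = card {T. T \<subseteq> A - {i, j} \<and> card T = k - 2}"
    by (rule bij_betw_same_card)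
  also have "\<dots> = card (A - {i, j}) choose (k - 2)" using assms by (intro n_subsets) auto
  also have "card (A - {i, j}) = card A - 2" using assms by (simp add: card_Diff_subset)
  finally show ?thesis .
qed

text \<open>A fixed pair of rows lies in the fraction \<open>k * (k - 1) / (n * (n - 1))\<close> of
  all \<open>k\<close>-sets of rows, so some \<open>k\<close>-set has at least the average number of
  intercalates. The inequality is multiplied out.\<close>

lemma exists_rows_many_quads:
  assumes L: "L \<in> latin_squares n" and k: "2 \<le> k" "k \<le> n"
  shows "\<exists>S\<subseteq>{1..n}. card S = k \<and>
    real (num_intercalates n L) * (real k * (real k - 1)) \<le>
    quad_count n S L * (real n * (real n - 1))"
proof (rule ccontr)
  assume contra: "\<not> ?thesis"
  define \<S> where "\<S> = {S. S \<subseteq> {1..n} \<and> card S = k}"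
  define N where "N = real (num_intercalates n L)"
  define J where "J S = quad_count n S L" for S
  have c\<S>: "card \<S> = n choose k" unfolding \<S>_def by (simp add: n_subsets)
  have f\<S>: "finite \<S>" unfolding \<S>_def by simp
  have "0 < card \<S>" using c\<S> k by simp
  then have ne: "\<S> \<noteq> {}" by auto
  have Jeq: "J S = (\<Sum>I\<in>intercalates n L. of_bool (fst (fst I) \<in> S \<and> snd (fst I) \<in> S))" if "S \<in> \<S>" for S
    using card_quads_in_square_graph[OF L, of S] that finite_intercalates
    by (simp add: J_def \<S>_def Int_def)
  have "(\<Sum>S\<in>\<S>. J S) = (\<Sum>I\<in>intercalates n L. \<Sum>S\<in>\<S>. of_bool (fst (fst I) \<in> S \<and> snd (fst I) \<in> S))"
    by (simp add: Jeq) (rule sum.swap)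
  also have "\<dots> = (\<Sum>I\<in>intercalates n L. real ((n - 2) choose (k - 2)))"
  proof (rule sum.cong[OF refl])
    fix I assume "I \<in> intercalates n L"
    then have I: "fst (fst I) \<in> {1..n}" "snd (fst I) \<in> {1..n}" "fst (fst I) \<noteq> snd (fst I)"
      by (auto simp: intercalates_def)
    have "(\<Sum>S\<in>\<S>. of_bool (fst (fst I) \<in> S \<and> snd (fst I) \<in> S)) =
        real (card {S. S \<subseteq> {1..n} \<and> card S = k \<and> fst (fst I) \<in> S \<and> snd (fst I) \<in> S})"
      using f\<S> by (simp add: \<S>_def Int_def conj_assoc)
    then show "(\<Sum>S\<in>\<S>. of_bool (fst (fst I) \<in> S \<and> snd (fst I) \<in> S)) = real ((n - 2) choose (k - 2))"
      using card_supersets_of_pair[OF _ I k(1)] by simp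
  qed
  finally have total: "(\<Sum>S\<in>\<S>. J S) = N * real ((n - 2) choose (k - 2))"
    by (simp add: N_def num_intercalates_def)
  have "(\<Sum>S\<in>\<S>. J S * (real n * (real n - 1))) < (\<Sum>S\<in>\<S>. N * (real k * (real k - 1)))"
    using contra f\<S> ne by (intro sum_strict_mono) (auto simp: \<S>_def J_def N_def not_le)
  then have "N * real ((n - 2) choose (k - 2)) * (real n * (real n - 1)) < real (n choose k) * (N * (real k * (real k - 1)))"
    by (simp add: sum_distrib_right[symmetric] total c\<S>)
  moreover have "real ((n - 2) choose (k - 2)) * (real n * (real n - 1)) = real (n choose k) * (real k * (real k - 1))"
  proof -
    obtain n' k' where nk: "n = Suc (Suc n')" "k = Suc (Suc k')"
      using k by (metis Suc_le_D numeral_2_eq_2 Suc_le_mono order_trans)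
    have "Suc (Suc k') * (Suc (Suc n') choose Suc (Suc k')) = Suc (Suc n') * (Suc n' choose Suc k')"
      "Suc k' * (Suc n' choose Suc k') = Suc n' * (n' choose k')"
      by (rule Suc_times_binomial_eq[symmetric] Suc_times_binomial)+
    then have "Suc k' * (Suc (Suc k') * (Suc (Suc n') choose Suc (Suc k'))) = Suc (Suc n') * (Suc n' * (n' choose k'))"
      by (metis mult.left_commute)
    then have "real (Suc k' * (Suc (Suc k') * (Suc (Suc n') choose Suc (Suc k')))) = real (Suc (Suc n') * (Suc n' * (n' choose k')))"
      by (rule arg_cong)
    then show ?thesis unfolding nk of_nat_mult by (simp add: mult_ac)
  qed
  ultimately show False by (simp add: mult_ac)
qed

section \<open>The upper tail\<close>

text \<open>All parameters stay free, which separates the combinatorics from the asymptotics.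
  \<open>2 ^ n\<close> pays for the choice of the rows \<open>S\<close>; for each \<open>S\<close>
  the square is either seeded or subject to the moment bound with ratio
  \<open>\<mu> / \<theta>\<close>.\<close>

lemma prob_many_intercalates_le:
  fixes n k l :: nat and \<epsilon> b z \<theta> \<mu> t :: real
  assumes n: "2 \<le> n" and \<epsilon>: "0 < \<epsilon>" "\<epsilon> \<le> 1 / 8" "4 \<le> \<epsilon> * real n"
    and k: "2 \<le> k" "real k \<le> \<epsilon> * real n" and l: "0 < l" and b: "0 < b" and z: "1 \<le> z"
    and \<theta>: "0 < \<theta>" "\<theta> * (real n * (real n - 1)) \<le> t * (real k * (real k - 1))"
    and A: "A = 1 / ((1 - \<epsilon>) * real n) * exp (2 * \<epsilon>)" and Q: "Q = 1 / ((1 - \<epsilon>) * real n) * exp 3"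
    and M: "M = 4 * real l"
    and \<mu>: "step_factor n \<epsilon> k A Q M b \<le> \<mu>"
  shows "measure_pmf.prob (pmf_of_set (latin_squares n)) {L. t \<le> real (num_intercalates n L)} \<le>
    2 ^ n * (total_err n * ((\<mu> / \<theta>) ^ l +
      seed_bound n b z Q (8 * M ^ 2 / b)))"
proof -
  define E where "E = {L \<in> latin_squares n. t \<le> real (num_intercalates n L)}"
  define \<S> where "\<S> = {S. S \<subseteq> {1..n} \<and> card S = k}"
  define U where "U S = {L \<in> latin_squares n. \<theta> \<le> quad_count n S L \<and>
      \<not> seeded n S (4 * l) b L}" for S
  define V where "V S = {L \<in> latin_squares n. seeded n S (4 * l) b L}" for S
  define N where "N = real (card (latin_squares n))"
  define B where "B = total_err n * ((\<mu> / \<theta>) ^ l +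
      seed_bound n b z Q (8 * M ^ 2 / b))"
  have n0: "0 < n" using n by simp
  have N: "0 < N" unfolding N_def using finite_latin_squares latin_squares_nonempty by (simp add: card_gt_0_iff)
  have AQ: "0 \<le> A" "0 \<le> Q" using \<epsilon> by (auto simp: A Q)
  have M0: "0 \<le> M" by (simp add: M)
  have "0 \<le> step_factor n \<epsilon> k A Q M b"
    using AQ M0 b \<epsilon> by (intro add_nonneg_nonneg mult_nonneg_nonneg divide_nonneg_nonneg zero_le_power) auto
  then have \<mu>0: "0 \<le> \<mu>" using \<mu> by linarith
  have "real n * \<epsilon> \<le> real n * 1" using \<epsilon> by (intro mult_left_mono) auto
  then have kn: "k \<le> n" using k by (simp add: mult.commute)
  have f\<S>: "finite \<S>" unfolding \<S>_def by simp
  have c\<S>: "real (card \<S>) \<le> 2 ^ n"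
  proof -
    have "card \<S> \<le> card (Pow {1..n})" by (intro card_mono) (auto simp: \<S>_def)
    also have "\<dots> = 2 ^ n" by (simp add: card_Pow)
    finally have "real (card \<S>) \<le> real (2 ^ n)" by (rule of_nat_mono)
    then show ?thesis by simp
  qed
  have fin: "finite (U S)" "finite (V S)" for S using finite_latin_squares by (auto simp: U_def V_def)
  have "E \<subseteq> (\<Union>S\<in>\<S>. U S \<union> V S)"
  proof
    fix L assume "L \<in> E"
    then have L: "L \<in> latin_squares n" "t \<le> real (num_intercalates n L)" by (auto simp: E_def)
    obtain S where S: "S \<subseteq> {1..n}" "card S = k" "real (num_intercalates n L) * (real k * (real k - 1)) \<le>
       quad_count n S L * (real n * (real n - 1))"
      using exists_rows_many_quads[OF L(1) k(1) kn] by blast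
    have "\<theta> * (real n * (real n - 1)) \<le> t * (real k * (real k - 1))" by (rule \<theta>(2))
    also have "\<dots> \<le> real (num_intercalates n L) * (real k * (real k - 1))"
      using L(2) k by (intro mult_right_mono) auto
    also note S(3)
    finally have "\<theta> \<le> quad_count n S L"
      by (rule mult_right_le_imp_le) (use n in \<open>auto intro!: mult_pos_pos\<close>)
    then have "L \<in> U S \<union> V S" using L(1) unfolding U_def V_def by blast
    then show "L \<in> (\<Union>S\<in>\<S>. U S \<union> V S)" using S unfolding \<S>_def by blast
  qed
  then have "card E \<le> card (\<Union>S\<in>\<S>. U S \<union> V S)"
    using f\<S> fin by (intro card_mono) auto
  also have "\<dots> \<le> (\<Sum>S\<in>\<S>. card (U S \<union> V S))" by (rule card_UN_le[OF f\<S>])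
  also have "\<dots> \<le> (\<Sum>S\<in>\<S>. card (U S) + card (V S))" by (intro sum_mono card_Un_le)
  finally have "real (card E) \<le> real (\<Sum>S\<in>\<S>. card (U S) + card (V S))" by (rule of_nat_mono)
  also have "\<dots> = (\<Sum>S\<in>\<S>. real (card (U S)) + real (card (V S)))" by simp
  also have "\<dots> \<le> (\<Sum>S\<in>\<S>. N * B)"
  proof (rule sum_mono)
    fix S assume "S \<in> \<S>"
    then have S: "S \<subseteq> {1..n}" "card S = k" by (auto simp: \<S>_def)
    have Sk: "real (card S) \<le> \<epsilon> * real n" using S k by simp
    have "real (card (U S)) * \<theta> ^ l \<le> N * total_err n * \<mu> ^ l"
      unfolding U_def N_def
    proof (rule card_unseeded_le[OF n0 \<epsilon>(1,2) S(1) Sk _ \<mu>0 less_imp_le[OF \<theta>(1)]])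
      fix P assume P: "P \<subseteq> entry_space n S" "functional P" "card P \<le> 4 * l"
        "real (card (quads_in {1..n} S P)) \<le> b"
      define m where "m = real (card P)"
      have m: "0 \<le> m" "m \<le> M" using P(3) by (auto simp: m_def M)
      have W: "0 \<le> entry_weight n \<epsilon> S P" using \<epsilon> by (simp add: entry_weight_def)
      have "step_factor n \<epsilon> (card S) A Q m (real (card (quads_in {1..n} S P))) \<le>
         step_factor n \<epsilon> (card S) A Q M b"
        using m P(4) AQ \<epsilon> by (intro add_mono mult_left_mono mult_right_mono divide_right_mono power_mono) auto
      also have "\<dots> \<le> \<mu>" using \<mu> S(2) by simp
      finally have "entry_weight n \<epsilon> S P * (step_factor n \<epsilon> (card S) A Q m (real (card (quads_in {1..n} S P)))) \<le> entry_weight n \<epsilon> S P * \<mu>"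
        using W by (rule mult_left_mono)
      with sum_entry_weight_quads_le[OF n0 \<epsilon> S(1) P(1,2) A Q m_def]
      have "(\<Sum>I\<in>quads {1..n} S. entry_weight n \<epsilon> S (P \<union> ents I)) \<le> entry_weight n \<epsilon> S P * \<mu>"
        by (rule order_trans)
      then show "(\<Sum>I\<in>quads {1..n} S. entry_weight n \<epsilon> S (P \<union> ents I)) \<le> \<mu> * entry_weight n \<epsilon> S P"
        by (simp only: mult.commute)
    qed
    then have "real (card (U S)) \<le> N * (total_err n * (\<mu> / \<theta>) ^ l)"
      using \<theta>(1) by (simp add: power_divide field_simps)
    moreover have "real (card (V S)) \<le> N * (total_err n *
       (seed_bound n b z Q (8 * M ^ 2 / b)))"
      unfolding V_def N_def
      by (rule card_seeded_le[OF n0 \<epsilon>(1,2) S(1) Sk b _ z Q]) (use l M in auto)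
    ultimately show "real (card (U S)) + real (card (V S)) \<le> N * B"
      by (simp add: B_def distrib_left)
  qed
  also have "\<dots> = real (card \<S>) * (N * B)" by simp
  also have "\<dots> \<le> 2 ^ n * (N * B)"
  proof (rule mult_right_mono[OF c\<S>])
    have "0 \<le> total_err n" by (rule total_err_nonneg)
    then show "0 \<le> N * B" using N \<mu>0 \<theta> unfolding B_def
      by (intro mult_nonneg_nonneg add_nonneg_nonneg zero_le_power divide_nonneg_nonneg) auto
  qed
  finally have "real (card E) / N \<le> 2 ^ n * B" using N by (simp add: field_simps)
  moreover have "measure_pmf.prob (pmf_of_set (latin_squares n)) {L. t \<le> real (num_intercalates n L)} = real (card E) / N"
    unfolding E_def N_def using finite_latin_squares latin_squares_nonempty
    by (subst measure_pmf_of_set) (auto simp: Int_def conj_commute)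
  ultimately show ?thesis by (simp add: B_def)
qed

section \<open>Choice of the parameters and asymptotics\<close>

lemma exists_small_eps:
  fixes \<delta> :: real
  assumes "0 < \<delta>"
  obtains \<epsilon> :: real where "0 < \<epsilon>" "\<epsilon> \<le> 1 / 8" "(exp (2 * \<epsilon>) / (1 - \<epsilon>)) ^ 4 \<le> 1 + \<delta> / 8"
proof -
  have "((\<lambda>\<epsilon>::real. (exp (2 * \<epsilon>) / (1 - \<epsilon>)) ^ 4) \<longlongrightarrow> (exp (2 * 0) / (1 - 0)) ^ 4) (at_right 0)"
    by (intro tendsto_intros) auto
  then have "eventually (\<lambda>\<epsilon>::real. (exp (2 * \<epsilon>) / (1 - \<epsilon>)) ^ 4 < 1 + \<delta> / 8) (at_right 0)"
    using assms by (intro order_tendstoD(2)) auto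
  moreover have "eventually (\<lambda>\<epsilon>::real. \<epsilon> \<in> {0<..<1 / 8}) (at_right 0)"
    by (intro eventually_at_right_real) auto
  ultimately have "eventually (\<lambda>\<epsilon>::real. 0 < \<epsilon> \<and> \<epsilon> \<le> 1 / 8 \<and> (exp (2 * \<epsilon>) / (1 - \<epsilon>)) ^ 4 \<le> 1 + \<delta> / 8) (at_right 0)"
    by eventually_elim auto
  then show ?thesis using that eventually_happens'[OF trivial_limit_at_right_real] by blast
qed

lemma eventually_le_of_tendsto_0:
  fixes f g :: "nat \<Rightarrow> real"
  assumes "((\<lambda>n. f n / g n) \<longlonglongrightarrow> 0)" "eventually (\<lambda>n. 0 < g n) sequentially" "0 < c"
  shows "eventually (\<lambda>n. f n \<le> c * g n) sequentially"
  using order_tendstoD(2)[OF assms(1,3)] assms(2) by eventually_elim (simp add: field_simps)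

theorem theorem2p1:
  fixes \<delta> :: real
  assumes "\<delta> > 0"
  shows "\<exists>c::real. c > 0 \<and>
    (\<exists>n\<^sub>0::nat. \<forall>n\<ge>n\<^sub>0.
      measure_pmf.prob (pmf_of_set (latin_squares n))
        {L. real (num_intercalates n L) \<ge> (1 + \<delta>) * (real n)\<^sup>2 / 4}
      \<le> exp (- c * real n powr (4/3) * ln (real n)))"
proof -
  note \<delta> = assms
  obtain \<epsilon> :: real where \<epsilon>: "0 < \<epsilon>" "\<epsilon> \<le> 1 / 8" "(exp (2 * \<epsilon>) / (1 - \<epsilon>)) ^ 4 \<le> 1 + \<delta> / 8"
    using exists_small_eps[OF \<delta>] .
  define G where "G n = real n powr (4/3) * ln (real n)" for n :: nat
  define q where "q = exp 3 / (1 - \<epsilon>)"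
  \<comment> \<open>The three error parts of \<open>step_factor\<close>, namely
    \<open>C1 * M\<close>, \<open>C2 * M\<^sup>2 / n\<close> and \<open>b\<close>, each get
    \<open>\<delta> * (\<epsilon> * n)\<^sup>2 / 128\<close>. Since
    \<open>k \<ge> \<epsilon> * n / 2\<close>, they add at most \<open>3 * \<delta> / 8\<close> to
    the main term \<open>1 + \<delta> / 8\<close>.\<close>
  define \<beta> where "\<beta> = \<delta> * \<epsilon>\<^sup>2 / 128"
  define C1 where "C1 = 4 * q ^ 4 / \<epsilon> + 4 * q ^ 3"
  define C2 where "C2 = 6 * q ^ 2 + 4 * q"
  define C3 where "C3 = q * (512 / \<beta>) ^ 3"
  \<comment> \<open>The ratio of the moment per step, with \<open>\<delta> / 2\<close>, to the
    threshold in \<open>S\<close>, with \<open>3 * \<delta> / 4\<close>. The remaining gap up to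
    \<open>\<delta>\<close> absorbs the replacement of \<open>k * (k - 1)\<close> by
    \<open>k\<^sup>2\<close>.\<close>
  define \<rho> where "\<rho> = (1 + \<delta> / 2) / (1 + 3 * \<delta> / 4)"
  define \<tau> where "\<tau> = - ln \<rho>"
  define \<kappa> where "\<kappa> = (\<beta> / 4) powr (2 / 3)"
  \<comment> \<open>Both sources decay like \<open>exp (- 2 * c * G n)\<close>:
    \<open>\<tau>\<close> is the gain per moment, and \<open>\<kappa> / 6\<close> combines the core
    size with the exponent of \<open>z\<close>. Half of this is given up, \<open>c / 2\<close> for
    the factors exponential in \<open>n\<close> up to logarithms and \<open>c / 2\<close> for the
    number of cores.\<close>
  define c where "c = min \<tau> (\<kappa> / 6) / 2"
  have q: "0 < q" using \<epsilon> by (simp add: q_def)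
  have \<beta>: "0 < \<beta>" using \<delta> \<epsilon> by (simp add: \<beta>_def)
  have C: "0 < C1" "0 < C2" "0 < C3" using q \<epsilon> \<beta> by (auto simp: C1_def C2_def C3_def intro!: add_pos_pos mult_pos_pos)
  have \<rho>: "0 < \<rho>" "\<rho> < 1" using \<delta> by (auto simp: \<rho>_def)
  have \<tau>: "0 < \<tau>" using \<rho> by (simp add: \<tau>_def)
  have \<kappa>: "0 < \<kappa>" using \<beta> by (simp add: \<kappa>_def)
  have c: "0 < c" "2 * c \<le> \<tau>" "2 * c \<le> \<kappa> / 6" using \<tau> \<kappa> by (auto simp: c_def)

  have G_pos: "eventually (\<lambda>n. 0 < G n) sequentially"
    unfolding G_def by real_asymp
  have G_ge_1: "eventually (\<lambda>n. 1 \<le> G n) sequentially"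
    unfolding G_def by real_asymp
  \<comment> \<open>The 8 makes rounding in \<open>k\<close> harmless; the other summand gives
    \<open>k \<ge> 4 * (1 + \<delta>) / \<delta>\<close>, which is what the comparison of
    \<open>k * (k - 1)\<close> with \<open>k\<^sup>2\<close> needs.\<close>
  have large: "eventually (\<lambda>n. 8 + 8 * (1 + \<delta>) / \<delta> \<le> \<epsilon> * real n) sequentially"
  proof -
    have "filterlim (\<lambda>n. \<epsilon> * real n) at_top sequentially"
      using \<epsilon>(1) by (intro filterlim_tendsto_pos_mult_at_top[OF tendsto_const] filterlim_real_sequentially)
    then show ?thesis by (rule eventually_compose_filterlim[OF eventually_ge_at_top])
  qed
  have err1: "eventually (\<lambda>n. G n \<le> \<delta> * \<epsilon>\<^sup>2 / (1024 * C1) * (real n)\<^sup>2) sequentially"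
  proof (rule eventually_le_of_tendsto_0)
    show "(\<lambda>n. G n / (real n)\<^sup>2) \<longlonglongrightarrow> 0" unfolding G_def by real_asymp
    show "eventually (\<lambda>n. 0 < (real n)\<^sup>2) sequentially" by real_asymp
  qed (use \<delta> \<epsilon> C in auto)
  have err2: "eventually (\<lambda>n. (G n)\<^sup>2 / real n \<le> \<delta> * \<epsilon>\<^sup>2 / (8192 * C2) * (real n)\<^sup>2) sequentially"
  proof (rule eventually_le_of_tendsto_0)
    show "(\<lambda>n. (G n)\<^sup>2 / real n / (real n)\<^sup>2) \<longlonglongrightarrow> 0" unfolding G_def by real_asymp
    show "eventually (\<lambda>n. 0 < (real n)\<^sup>2) sequentially" by real_asymp
  qed (use \<delta> \<epsilon> C in auto)
  have err3: "eventually (\<lambda>n. real n * ln 2 + 3 * real n * (1 + ln (real n))\<^sup>2 + real n * ln 8 + ln 2 \<le> c / 2 * G n) sequentially"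
  proof (rule eventually_le_of_tendsto_0[OF _ G_pos])
    show "(\<lambda>n. (real n * ln 2 + 3 * real n * (1 + ln (real n))\<^sup>2 + real n * ln 8 + ln 2) / G n) \<longlonglongrightarrow> 0"
      unfolding G_def by real_asymp
  qed (use c in auto)
  have err4: "eventually (\<lambda>n. real n powr (7 / 6) * ln (real n) ^ 6 \<le> c / (2 * C3) * G n) sequentially"
  proof (rule eventually_le_of_tendsto_0[OF _ G_pos])
    show "(\<lambda>n. real n powr (7 / 6) * ln (real n) ^ 6 / G n) \<longlonglongrightarrow> 0" unfolding G_def by real_asymp
  qed (use c C in auto)

  have "eventually (\<lambda>n. measure_pmf.prob (pmf_of_set (latin_squares n))
        {L. real (num_intercalates n L) \<ge> (1 + \<delta>) * (real n)\<^sup>2 / 4}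
      \<le> exp (- c * real n powr (4/3) * ln (real n))) sequentially"
    using G_pos G_ge_1 large err1 err2 err3 err4 eventually_ge_at_top[of 2]
  proof eventually_elim
    case (elim n)
    define k where "k = nat \<lfloor>\<epsilon> * real n\<rfloor>"
    \<comment> \<open>As many moments as the target exponent demands; since
      \<open>G n \<ge> 1\<close>, rounding up at most doubles this. The resulting \<open>M\<close>
      is still well below \<open>n powr (3/2)\<close>.\<close>
    define l where "l = nat \<lceil>G n\<rceil>"
    define M where "M = 4 * real l"
    define b where "b = \<beta> * (real n)\<^sup>2"
    \<comment> \<open>With \<open>V\<close> of order \<open>n powr (2/3) * (ln n)\<^sup>2\<close>,
      the product \<open>Q * V ^ 3\<close> has order \<open>n * ln n ^ 6\<close>. Any fixed positive
      exponent below 1/3 would keep \<open>Q * z * V ^ 3\<close> below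
      \<open>n powr (4/3)\<close>.\<close>
    define z where "z = real n powr (1 / 6)"
    define Q where "Q = 1 / ((1 - \<epsilon>) * real n) * exp 3"
    define A where "A = 1 / ((1 - \<epsilon>) * real n) * exp (2 * \<epsilon>)"
    define \<mu> where "\<mu> = (1 + \<delta> / 2) * (real k)\<^sup>2 / 4"
    define \<theta> where "\<theta> = (1 + 3 * \<delta> / 4) * (real k)\<^sup>2 / 4"
    have n: "2 \<le> n" "0 < real n" using elim by auto
    have en: "8 \<le> \<epsilon> * real n" "8 * (1 + \<delta>) / \<delta> \<le> \<epsilon> * real n"
    proof -
      have "0 \<le> 8 * (1 + \<delta>) / \<delta>" using \<delta> by simp
      then show "8 \<le> \<epsilon> * real n" "8 * (1 + \<delta>) / \<delta> \<le> \<epsilon> * real n" using elim(3) by linarith+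
    qed
    have k: "real k \<le> \<epsilon> * real n" "\<epsilon> * real n / 2 \<le> real k"
    proof -
      have "real k = of_int \<lfloor>\<epsilon> * real n\<rfloor>" using en by (simp add: k_def)
      then show "real k \<le> \<epsilon> * real n" "\<epsilon> * real n / 2 \<le> real k"
        using en floor_correct[of "\<epsilon> * real n"] by linarith+
    qed
    have k2: "2 \<le> k" using k en by linarith
    have k\<delta>: "1 + \<delta> \<le> \<delta> / 4 * real k"
    proof -
      have "4 * (1 + \<delta>) / \<delta> \<le> real k" using en k by linarith
      then show ?thesis using \<delta> by (simp add: field_simps)
    qed
    have l: "G n \<le> real l" "real l \<le> 2 * G n"
    proof -
      have "real l = of_int \<lceil>G n\<rceil>" using elim by (simp add: l_def)
      then show "G n \<le> real l" "real l \<le> 2 * G n" using elim(2) ceiling_correct[of "G n"] by linarith+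
    qed
    have l0: "0 < l" using l elim by linarith
    have M: "0 \<le> M" "M \<le> 8 * G n" using l by (auto simp: M_def)
    have M2: "M\<^sup>2 \<le> 64 * (G n)\<^sup>2" using power_mono[OF M(2,1), of 2] by (simp add: power_mult_distrib)
    have b: "0 < b" using \<beta> n by (simp add: b_def)
    have z: "1 \<le> z" unfolding z_def using n by (intro ge_one_powr_ge_zero) auto
    have \<theta>0: "0 < \<theta>" using \<delta> k2 by (simp add: \<theta>_def)
    have Qn: "Q * real n = q" using n \<epsilon> by (simp add: Q_def q_def)
    have An: "A * real n = exp (2 * \<epsilon>) / (1 - \<epsilon>)" using n \<epsilon> by (simp add: A_def)
    have \<theta>: "\<theta> * (real n * (real n - 1)) \<le> (1 + \<delta>) * (real n)\<^sup>2 / 4 * (real k * (real k - 1))"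
    proof -
      have "(1 + 3 * \<delta> / 4) * real k \<le> (1 + \<delta>) * (real k - 1)" using k\<delta> by (simp add: algebra_simps)
      then have kk: "(1 + 3 * \<delta> / 4) * real k * real k \<le> (1 + \<delta>) * (real k - 1) * real k"
        by (intro mult_right_mono) auto
      have "\<theta> * (real n * (real n - 1)) \<le> \<theta> * (real n * real n)"
        using \<theta>0 n by (intro mult_left_mono) auto
      also have "\<dots> = (1 + 3 * \<delta> / 4) * real k * real k * ((real n)\<^sup>2 / 4)"
        by (simp add: \<theta>_def power2_eq_square)
      also have "\<dots> \<le> (1 + \<delta>) * (real k - 1) * real k * ((real n)\<^sup>2 / 4)"
        by (intro mult_right_mono kk) auto
      finally show ?thesis by (simp add: mult_ac)
    qed
    have \<mu>: "step_factor n \<epsilon> k A Q M b \<le> \<mu>"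
    proof -
      have t1: "A ^ 4 * (real k ^ 2 * real n ^ 4 / 4) \<le> (1 + \<delta> / 8) * (real k ^ 2 / 4)"
      proof -
        have "A ^ 4 * (real k ^ 2 * real n ^ 4 / 4) = (A * real n) ^ 4 * (real k ^ 2 / 4)"
          by (simp add: power_mult_distrib)
        also have "\<dots> \<le> (1 + \<delta> / 8) * (real k ^ 2 / 4)"
          unfolding An using \<epsilon>(3) by (intro mult_right_mono) auto
        finally show ?thesis .
      qed
      have t2: "Q ^ 4 * (4 * M / \<epsilon> * real n ^ 4) + Q ^ 3 * (4 * M * real n ^ 3) = C1 * M"
        unfolding C1_def Qn[symmetric] by (simp add: power_mult_distrib field_simps)
      have t3: "Q ^ 2 * (6 * M ^ 2 * real n) + Q * (4 * M ^ 2) = C2 * (M ^ 2 / real n)"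
        unfolding C2_def Qn[symmetric] using n by (simp add: power2_eq_square field_simps)
      have "C1 * M \<le> C1 * (8 * G n)" using C M by (intro mult_left_mono) auto
      also have "\<dots> \<le> C1 * (8 * (\<delta> * \<epsilon>\<^sup>2 / (1024 * C1) * (real n)\<^sup>2))"
        using C elim(4) by (intro mult_left_mono) auto
      also have "\<dots> = \<delta> * (\<epsilon> * real n)\<^sup>2 / 128" using C by (simp add: power_mult_distrib)
      finally have t4: "C1 * M \<le> \<delta> * (\<epsilon> * real n)\<^sup>2 / 128" .
      have "C2 * (M ^ 2 / real n) \<le> C2 * (64 * (G n)\<^sup>2 / real n)"
        using C M2 n by (intro mult_left_mono divide_right_mono) auto
      also have "\<dots> \<le> C2 * (64 * (\<delta> * \<epsilon>\<^sup>2 / (8192 * C2) * (real n)\<^sup>2))"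
        using C mult_left_mono[OF elim(5), of 64] by (intro mult_left_mono) auto
      also have "\<dots> = \<delta> * (\<epsilon> * real n)\<^sup>2 / 128" using C by (simp add: power_mult_distrib)
      finally have t5: "C2 * (M ^ 2 / real n) \<le> \<delta> * (\<epsilon> * real n)\<^sup>2 / 128" .
      have t6: "b = \<delta> * (\<epsilon> * real n)\<^sup>2 / 128" by (simp add: b_def \<beta>_def power_mult_distrib)
      have "(\<epsilon> * real n)\<^sup>2 \<le> (2 * real k)\<^sup>2" using k en by (intro power_mono) auto
      then have "\<delta> * (\<epsilon> * real n)\<^sup>2 \<le> \<delta> * (4 * (real k)\<^sup>2)"
        using \<delta> by (intro mult_left_mono) (auto simp: power_mult_distrib)
      then have t7: "3 * (\<delta> * (\<epsilon> * real n)\<^sup>2 / 128) \<le> 3 * \<delta> / 8 * (real k ^ 2 / 4)" by simp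
      have "\<mu> = (1 + \<delta> / 8) * (real k ^ 2 / 4) + 3 * \<delta> / 8 * (real k ^ 2 / 4)"
        by (simp add: \<mu>_def field_simps)
      then show ?thesis using t1 t2 t3 t4 t5 t6 t7 by linarith
    qed
    have en4: "4 \<le> \<epsilon> * real n" using en by linarith
    have prob: "measure_pmf.prob (pmf_of_set (latin_squares n))
        {L. (1 + \<delta>) * (real n)\<^sup>2 / 4 \<le> real (num_intercalates n L)} \<le>
      2 ^ n * (total_err n * ((\<mu> / \<theta>) ^ l +
      seed_bound n b z Q (8 * M ^ 2 / b)))"
      by (rule prob_many_intercalates_le[OF n(1) \<epsilon>(1,2) en4 k2 k(1) l0 b z \<theta>0 \<theta> A_def Q_def M_def \<mu>])
    have "\<mu> / \<theta> = \<rho>" using k2 by (simp add: \<mu>_def \<theta>_def \<rho>_def)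
    then have "(\<mu> / \<theta>) ^ l = exp (real l * ln \<rho>)" using \<rho> by (simp add: exp_of_nat_mult)
    also have "real l * ln \<rho> \<le> - (2 * c * G n)"
    proof -
      have "2 * c * G n \<le> \<tau> * real l" using c \<tau> l elim by (intro mult_mono) auto
      then show ?thesis by (simp add: \<tau>_def mult.commute)
    qed
    finally have p1: "(\<mu> / \<theta>) ^ l \<le> exp (- (2 * c * G n))" by simp
    have "(b / 4) powr (2 / 3) = \<kappa> * real n powr (4 / 3)"
    proof -
      have "(b / 4) powr (2 / 3) = (\<beta> / 4 * (real n)\<^sup>2) powr (2 / 3)" by (simp add: b_def)
      also have "\<dots> = \<kappa> * ((real n)\<^sup>2) powr (2 / 3)"
        unfolding \<kappa>_def by (rule powr_mult)
      also have "((real n)\<^sup>2) powr (2 / 3) = (real n powr 2) powr (2 / 3)" using n by (simp add: powr_numeral)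
      also have "\<dots> = real n powr (4 / 3)" by (subst powr_powr) simp
      finally show ?thesis .
    qed
    \<comment> \<open>From \<open>ln z = ln n / 6\<close>: here the logarithm in the final exponent
      appears for seeded squares.\<close>
    then have "z powr (- ((b / 4) powr (2 / 3))) = exp (- (\<kappa> / 6 * G n))"
      using n by (simp add: z_def powr_def G_def)
    also have "\<dots> \<le> exp (- (2 * c * G n))"
      using c(3) elim(1) by (simp add: mult_right_mono)
    finally have p2: "z powr (- ((b / 4) powr (2 / 3))) \<le> exp (- (2 * c * G n))" .
    have p3: "Q * z * (8 * M ^ 2 / b) ^ 3 \<le> c / 2 * G n"
    proof -
      have "8 * M ^ 2 / b \<le> 8 * (64 * (G n)\<^sup>2) / b" using M2 b by (intro divide_right_mono mult_left_mono) auto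
      also have "\<dots> = 512 / \<beta> * (real n powr (2 / 3) * (ln (real n))\<^sup>2)"
      proof -
        have "(G n)\<^sup>2 = real n powr (8 / 3) * (ln (real n))\<^sup>2"
          using n by (simp add: G_def power_mult_distrib powr_power)
        also have "real n powr (8 / 3) = real n powr (2 / 3) * (real n)\<^sup>2"
          using n powr_add[of "real n" "2 / 3" 2] by (simp add: powr_numeral)
        finally show ?thesis using n \<beta> by (simp add: b_def)
      qed
      finally have "(8 * M ^ 2 / b) ^ 3 \<le> (512 / \<beta> * (real n powr (2 / 3) * (ln (real n))\<^sup>2)) ^ 3"
        using b by (intro power_mono) auto
      also have "\<dots> = (512 / \<beta>) ^ 3 * ((real n powr (2 / 3)) ^ 3 * ln (real n) ^ 6)"
        by (simp only: power_mult_distrib power_mult[symmetric]) simp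
      also have "(real n powr (2 / 3)) ^ 3 = real n powr 2"
        using n by (simp add: powr_power)
      finally have "Q * z * (8 * M ^ 2 / b) ^ 3 \<le> Q * z * ((512 / \<beta>) ^ 3 * (real n powr 2 * ln (real n) ^ 6))"
        using \<epsilon> z by (intro mult_left_mono) (auto simp: Q_def)
      also have "Q * z * ((512 / \<beta>) ^ 3 * (real n powr 2 * ln (real n) ^ 6)) =
          q / real n * z * ((512 / \<beta>) ^ 3 * (real n powr 2 * ln (real n) ^ 6))"
      proof -
        have "Q = q / real n" using Qn n by (simp add: field_simps)
        then show ?thesis by (simp only:)
      qed
      also have "q / real n * z * ((512 / \<beta>) ^ 3 * (real n powr 2 * ln (real n) ^ 6)) =
          C3 * (real n powr (7 / 6) * ln (real n) ^ 6)"
      proof -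
        have "z * real n powr 2 = real n powr (7 / 6) * real n"
          using n powr_add[of "real n" "1 / 6" 2] powr_add[of "real n" "7 / 6" 1] by (simp add: z_def)
        then have "z * real n powr 2 / real n = real n powr (7 / 6)" using n by simp
        moreover have "q / real n * z * ((512 / \<beta>) ^ 3 * (real n powr 2 * ln (real n) ^ 6)) =
            C3 * (z * real n powr 2 / real n * ln (real n) ^ 6)"
          by (simp add: C3_def)
        ultimately show ?thesis by (simp only:)
      qed
      also have "\<dots> \<le> C3 * (c / (2 * C3) * G n)" using elim(7) C by (intro mult_left_mono) auto
      also have "\<dots> = c / 2 * G n" using C by simp
      finally show ?thesis .
    qed
    have "(\<mu> / \<theta>) ^ l + seed_bound n b z Q (8 * M ^ 2 / b) \<le>
        exp (- (2 * c * G n)) + 8 ^ n * (exp (- (2 * c * G n)) * exp (c / 2 * G n))"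
      using p1 p2 p3 by (intro add_mono mult_left_mono mult_mono) auto
    also have "\<dots> \<le> 2 * (8 ^ n * (exp (- (2 * c * G n)) * exp (c / 2 * G n)))"
    proof -
      have "1 * (exp (- (2 * c * G n)) * 1) \<le> 8 ^ n * (exp (- (2 * c * G n)) * exp (c / 2 * G n))"
        using c elim by (intro mult_mono mult_left_mono) auto
      then show ?thesis by simp
    qed
    also have "\<dots> = exp (ln 2 + real n * ln 8 - 2 * c * G n + c / 2 * G n)"
    proof -
      have "exp (ln 2 + real n * ln 8 - 2 * c * G n + c / 2 * G n) =
          exp (ln 2) * (exp (real n * ln 8) * (exp (- (2 * c * G n)) * exp (c / 2 * G n)))"
        unfolding exp_add[symmetric] by (rule arg_cong[where f = exp]) simp
      then show ?thesis by (simp add: exp_of_nat_mult)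
    qed
    finally have inner: "(\<mu> / \<theta>) ^ l + seed_bound n b z Q (8 * M ^ 2 / b) \<le>
        exp (ln 2 + real n * ln 8 - 2 * c * G n + c / 2 * G n)" .
    have te: "0 \<le> total_err n" by (rule total_err_nonneg)
    note prob
    also have "2 ^ n * (total_err n * ((\<mu> / \<theta>) ^ l +
      seed_bound n b z Q (8 * M ^ 2 / b))) \<le>
      2 ^ n * (exp (3 * real n * (1 + ln (real n))\<^sup>2) * exp (ln 2 + real n * ln 8 - 2 * c * G n + c / 2 * G n))"
      using total_err_le[of n] n te by (intro mult_left_mono order_trans[OF mult_left_mono[OF inner te] mult_right_mono]) auto
    also have "\<dots> = exp (real n * ln 2 + 3 * real n * (1 + ln (real n))\<^sup>2 + (ln 2 + real n * ln 8 - 2 * c * G n + c / 2 * G n))"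
      by (simp add: exp_add exp_of_nat_mult)
    also have "\<dots> \<le> exp (- c * G n)" unfolding exp_le_cancel_iff using elim(6) by linarith
    finally show ?case by (simp add: G_def mult.assoc)
  qed
  then show ?thesis using c(1) unfolding eventually_sequentially by blast
qed

end
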